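(* Let $l\geqslant 4$ and $n\geqslant \max\{2.16\times 10^{17},\ 9\times 2^{l-1}+3,\ \frac{625}{32}\lfloor\frac{l-3}{2}\rfloor^2+4\}$. Let $G$ be a planar graph on $n$ vertices that does not contain $C_{l,l}$ as a subgraph. Then $\rho(G)\leqslant \rho(K_2+H(l-2,l-2))$, with equality if and only if $G\cong K_2+H(l-2,l-2)$.
   Context: All graphs are finite and simple. $\rho(G)$ denotes the spectral radius of the adjacency matrix of $G$. For $l\geqslant 3$, $C_{l,l}$ denotes the graph consisting of two cycles of length $l$ sharing exactly one common vertex. $P_m$ denotes the path on $m$ vertices, $\cup$ denotes vertex-disjoint union, and $cP_m$ denotes $c$ disjoint copies of $P_m$. For graphs $G_1,G_2$, $G_1+G_2$ denotes their join (disjoint union plus all edges between a vertex of $G_1$ and a vertex of $G_2$). For positive integers $n_1\geqslant n_2$ with $n_1<n-2$ (the number $n$ being the number of vertices), $H(n_1,n_2)$ is the graph on $n-2$ vertices defined by $H(n_1,n_2)=P_{n_1}\cup \frac{n-2-n_1}{n_2}P_{n_2}$ if $n_2$ divides $n-2-n_1$, and $H(n_1,n_2)=P_{n_1}\cup \lfloor \frac{n-2-n_1}{n_2}\rfloor P_{n_2}\cup P_{r}$ with $r=n-2-n_1-\lfloor \frac{n-2-n_1}{n_2}\rfloor n_2$ otherwise. *)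

theory Defs
  imports "HOL-Analysis.Analysis"
begin

type_synonym 'a graph = "'a set \<times> 'a set set"

definition simple_graph :: "'a graph \<Rightarrow> bool" where
  "simple_graph G \<longleftrightarrow> finite (fst G) \<and>
     (\<forall>e\<in>snd G. \<exists>u v. u \<in> fst G \<and> v \<in> fst G \<and> u \<noteq> v \<and> e = {u, v})"

definition adj_eigenvalue :: "'a graph \<Rightarrow> complex \<Rightarrow> bool" where
  "adj_eigenvalue G \<mu> \<longleftrightarrow> (\<exists>x :: 'a \<Rightarrow> complex. (\<exists>v\<in>fst G. x v \<noteq> 0) \<and>
     (\<forall>v\<in>fst G. (\<Sum>u\<in>{u\<in>fst G. {u, v} \<in> snd G}. x u) = \<mu> * x v))"

definition spectral_radius :: "'a graph \<Rightarrow> real" where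
  "spectral_radius G = Max (cmod ` {\<mu>. adj_eigenvalue G \<mu>})"

definition planar :: "'a graph \<Rightarrow> bool" where
  "planar G \<longleftrightarrow> (\<exists>(p :: 'a \<Rightarrow> complex) (\<gamma> :: 'a set \<Rightarrow> real \<Rightarrow> complex).
     inj_on p (fst G) \<and>
     (\<forall>e\<in>snd G. arc (\<gamma> e) \<and> {pathstart (\<gamma> e), pathfinish (\<gamma> e)} = p ` e) \<and>
     (\<forall>e\<in>snd G. \<forall>v\<in>fst G. p v \<in> path_image (\<gamma> e) \<longrightarrow> v \<in> e) \<and>
     (\<forall>e\<in>snd G. \<forall>e'\<in>snd G. e \<noteq> e' \<longrightarrow>
         path_image (\<gamma> e) \<inter> path_image (\<gamma> e') \<subseteq> p ` (e \<inter> e')))"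

definition contains_subgraph :: "'a graph \<Rightarrow> 'b graph \<Rightarrow> bool" where
  "contains_subgraph G F \<longleftrightarrow> (\<exists>f. inj_on f (fst F) \<and> f ` fst F \<subseteq> fst G \<and>
     (\<forall>e\<in>snd F. f ` e \<in> snd G))"

definition graph_iso :: "'a graph \<Rightarrow> 'b graph \<Rightarrow> bool" where
  "graph_iso G F \<longleftrightarrow> (\<exists>f. bij_betw f (fst G) (fst F) \<and>
     (\<forall>u\<in>fst G. \<forall>v\<in>fst G. {u, v} \<in> snd G \<longleftrightarrow> {f u, f v} \<in> snd F))"

text \<open>C_{l,l}: vertices 0..2l-2; first cycle 0,1,...,l-1,0; second cycle 0,l,...,2l-2,0.\<close>
definition Cll :: "nat \<Rightarrow> nat graph" where
  "Cll l = ({0..2*l-2},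
     {{i, i+1} | i. i + 1 \<le> l - 1} \<union> {{l - 1, 0}} \<union>
     {{0, l}} \<union> {{i, i+1} | i. l \<le> i \<and> i + 1 \<le> 2*l - 2} \<union> {{2*l - 2, 0}})"

text \<open>H(n1,n2) on vertex set {0..<n-2}: a path on the first n1 vertices, followed by
  consecutive paths on n2 vertices each, the last one possibly shorter (P_r).
  Vertices j, j+1 are adjacent iff they lie in the same block.\<close>
definition Hgraph :: "nat \<Rightarrow> nat \<Rightarrow> nat \<Rightarrow> nat graph" where
  "Hgraph n n1 n2 = ({0..<n-2},
     {{j, j+1} | j. j + 1 < n - 2 \<and>
        (if j + 1 < n1 then True else if j + 1 = n1 then False
         else (j + 1 - n1) mod n2 \<noteq> 0)})"

definition graph_join :: "'a graph \<Rightarrow> 'b graph \<Rightarrow> ('a + 'b) graph" where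
  "graph_join G1 G2 = (Inl ` fst G1 \<union> Inr ` fst G2,
     ((\<lambda>e. Inl ` e) ` snd G1) \<union> ((\<lambda>e. Inr ` e) ` snd G2) \<union>
     {{Inl u, Inr v} | u v. u \<in> fst G1 \<and> v \<in> fst G2})"

definition K2 :: "nat graph" where
  "K2 = ({0, 1}, {{0, 1}})"

end

theory Submission
  imports Defs "Jordan_Normal_Form.Char_Poly"
begin

text \<open>Splitting a plane cycle along a path in its interior (theta curves), and inverting the plane for
  the exterior, gives \<open>e \<le> 3n - 6\<close> and, without triangles, \<open>e \<le> 2n - 4\<close> for plane graphs. Hence
  every three vertices have at most two common neighbours, and the common neighbours of two vertices
  span no cycle that misses one of them.

  Let \<open>\<rho>(G) \<ge> \<rho>(K\<^sub>2 + H) \<ge> \<surd>(2n - 4)\<close> and let \<open>x\<close> be a Perron vector with maximum \<open>1\<close>. Counting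
  walks of length two shows that two vertices \<open>u, v\<close> have entries close to \<open>1\<close> and almost all vertices
  as common neighbours, while all other entries are at most \<open>0.09\<close>. Joining all vertices to \<open>u\<close> and
  \<open>v\<close>, and keeping only the edges among the common neighbours, therefore does not decrease the Rayleigh
  quotient of \<open>x\<close>. The result is a cone \<open>K\<^sub>2 + L\<close> over a linear forest \<open>L\<close>, for which
  \<open>\<rho> - 1 = 2 \<Sum> f\<^sub>\<rho>(k)\<close> over the orders \<open>k\<close> of the components of \<open>L\<close>, where \<open>f\<^sub>\<rho>(k)\<close> is the sum of the
  entries of \<open>(\<rho> - A(P\<^sub>k))\<^sup>-\<^sup>1\<close>. Since \<open>f\<^sub>\<rho>\<close> is strictly convex, packing into paths of the largest
  admissible order \<open>l - 2\<close> is optimal; a longer path would force almost all other components to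
  have at most \<open>(l - 3) / 2\<close> vertices, and so about twice as many components.\<close>

subsection \<open>Paths and cycles as vertex lists\<close>

text \<open>The topology is confined to one count that never mentions faces: inside a cycle, (g - 2)
  * edges + g is at most g * vertices + length. It adds up along theta curves, inversion lends it to
  the outside, and the sum of both sides is the Euler bound. What resists splitting is a part of the
  drawing that hangs on the cycle at one vertex or floats freely inside. Such parts have fewer
  vertices, so an induction on the number of vertices is wrapped around the induction on inner
  edges. The passage to the cone must not create long blocks: vertices outside the common
  neighbourhood become blocks of order one, and from then on only the multiset of block orders
  matters. Two cones are compared at the parameter t of one of them. A vector that solves the path
  recursions can violate the eigenvalue equation only at the two apexes, so its form on the other
  cone deviates from rho times the squared norm by a multiple of the difference of the weights. How
  the weights vary with t never has to be studied.\<close>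

fun path_edges :: "'a list \<Rightarrow> 'a set set" where
  "path_edges (x # y # zs) = insert {x, y} (path_edges (y # zs))"
| "path_edges _ = {}"

definition cycle_edges :: "'a list \<Rightarrow> 'a set set" where
  "cycle_edges xs = path_edges (xs @ [hd xs])"

definition is_cycle :: "'a set \<Rightarrow> 'a set set \<Rightarrow> 'a list \<Rightarrow> bool" where
  "is_cycle V E xs \<longleftrightarrow> length xs \<ge> 3 \<and> distinct xs \<and> set xs \<subseteq> V \<and> cycle_edges xs \<subseteq> E"

lemma path_edges_append:
  "path_edges (xs @ x # ys) = path_edges (xs @ [x]) \<union> path_edges (x # ys)"
  by (induction xs rule: path_edges.induct) auto

lemma path_edges_snoc:
  "xs \<noteq> [] \<Longrightarrow> path_edges (xs @ [y]) = insert {last xs, y} (path_edges xs)"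
  by (induction xs rule: path_edges.induct) auto

lemma path_edges_rev: "path_edges (rev xs) = path_edges xs"
proof (induction xs rule: path_edges.induct)
  case (1 x y zs)
  have "path_edges (rev (x # y # zs)) = path_edges (rev zs @ [y]) \<union> path_edges [y, x]"
    using path_edges_append[of "rev zs" y "[x]"] by simp
  then show ?case using 1 by (auto simp: insert_commute)
qed auto

lemma path_edges_subset: "e \<in> path_edges xs \<Longrightarrow> e \<subseteq> set xs"
  by (induction xs rule: path_edges.induct) auto

lemma Union_path_edges: "length xs \<ge> 2 \<Longrightarrow> \<Union>(path_edges xs) = set xs"
proof (induction xs rule: path_edges.induct)
  case (1 x y zs)
  then show ?case by (cases zs) auto
qed auto

lemma finite_path_edges [simp]: "finite (path_edges xs)"
  by (induction xs rule: path_edges.induct) auto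

lemma card_path_edges_le: "card (path_edges xs) \<le> length xs - 1"
proof (induction xs rule: path_edges.induct)
  case (1 x y zs)
  then show ?case using card_insert_le_m1[of "length (x#y#zs) - 1" "path_edges (y#zs)" "{x,y}"]
    by auto
qed auto

text \<open>With an inner vertex present, the edge would have to occur after the first vertex; yet
  it contains \<open>a\<close>, which does not recur. This rules out that two arcs with common ends
  share an edge.\<close>

lemma path_edges_ends:
  assumes "distinct (a # A @ [b])" "{a, b} \<in> path_edges (a # A @ [b])"
  shows "A = []"
proof (cases A)
  case (Cons x A')
  then have "{a,b} \<in> path_edges (x # A' @ [b])" using assms by (auto simp: doubleton_eq_iff)
  then have "{a,b} \<subseteq> set (x # A' @ [b])" by (rule path_edges_subset)
  then show ?thesis using assms Cons by auto
qed

lemma cycle_edges_subset: "e \<in> cycle_edges xs \<Longrightarrow> e \<subseteq> set xs"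
  unfolding cycle_edges_def
  by (cases xs) (auto dest!: path_edges_subset)

lemma finite_cycle_edges [simp]: "finite (cycle_edges xs)"
  by (simp add: cycle_edges_def)

lemma card_cycle_edges_le: "card (cycle_edges xs) \<le> length xs"
  using card_path_edges_le[of "xs @ [hd xs]"] by (simp add: cycle_edges_def)

lemma cycle_edges_split:
  "cycle_edges (a # A @ b # B) = path_edges (a # A @ [b]) \<union> path_edges (b # B @ [a])"
  using path_edges_append[of "a # A" b "B @ [a]"] by (simp add: cycle_edges_def)

lemma cycle_edges_rotate1: "cycle_edges (xs @ [x]) = cycle_edges (x # xs)"
proof (cases xs)
  case (Cons a ys)
  then show ?thesis
    using cycle_edges_split[of a ys x "[]"] cycle_edges_split[of x "[]" a ys] by auto
qed simp

lemma cycle_edges_rotate: "cycle_edges (xs @ ys) = cycle_edges (ys @ xs)"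
proof (induction ys arbitrary: xs)
  case (Cons y ys)
  have "cycle_edges (xs @ y # ys) = cycle_edges (ys @ xs @ [y])"
    using Cons[of "xs @ [y]"] by simp
  also have "\<dots> = cycle_edges (y # ys @ xs)" using cycle_edges_rotate1[of "ys @ xs" y] by simp
  finally show ?case by simp
qed simp

lemma is_cycle_rotate: "is_cycle V E (xs @ ys) \<Longrightarrow> is_cycle V E (ys @ xs)"
  unfolding is_cycle_def using cycle_edges_rotate[of xs ys] by auto

text \<open>Brings two chosen vertices into the form \<open>a # A @ b # B\<close>, in which both
  arcs between them are visible. The sides of a cycle depend only on \<open>cycle_edges\<close>,
  which is preserved.\<close>

lemma cycle_rotate_to:
  assumes "is_cycle V E xs" "a \<in> set xs" "b \<in> set xs" "a \<noteq> b"
  obtains A B where "is_cycle V E (a # A @ b # B)" "cycle_edges (a # A @ b # B) = cycle_edges xs"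
    "length (a # A @ b # B) = length xs" "set (a # A @ b # B) = set xs"
proof -
  obtain X Y where X: "xs = X @ a # Y" using assms(2) by (meson split_list)
  define ys where "ys = Y @ X"
  have c: "cycle_edges (a # ys) = cycle_edges xs" "is_cycle V E (a # ys)"
    using cycle_edges_rotate[of X "a # Y"] is_cycle_rotate[of V E X "a # Y"] assms X
    by (auto simp: ys_def)
  have "b \<in> set ys" using assms X by (auto simp: ys_def)
  then obtain A B where AB: "ys = A @ b # B" by (meson split_list)
  have "length xs = Suc (length ys)" "set xs = insert a (set ys)" using X by (auto simp: ys_def)
  then show ?thesis using that[of A B] c AB by auto
qed

lemma is_cycle_subgraph:
  "is_cycle V E xs \<Longrightarrow> V \<subseteq> V' \<Longrightarrow> E \<subseteq> E' \<Longrightarrow> is_cycle V' E' xs"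
  unfolding is_cycle_def by auto

section \<open>Longest paths and the existence of cycles\<close>

definition is_path :: "'a set \<Rightarrow> 'a set set \<Rightarrow> 'a list \<Rightarrow> bool" where
  "is_path V E xs \<longleftrightarrow> xs \<noteq> [] \<and> distinct xs \<and> set xs \<subseteq> V \<and> path_edges xs \<subseteq> E"

lemma is_path_rev: "is_path V E (rev xs) = is_path V E xs"
  by (simp add: is_path_def path_edges_rev)

lemma is_path_length: "finite V \<Longrightarrow> is_path V E xs \<Longrightarrow> length xs \<le> card V"
  unfolding is_path_def by (metis card_mono distinct_card)

lemma longest_path_exists:
  assumes "finite V" "V \<noteq> {}"
  obtains xs where "is_path V E xs" "\<And>ys. is_path V E ys \<Longrightarrow> length ys \<le> length xs"
proof -
  obtain v where "v \<in> V" using assms by auto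
  then have ex: "is_path V E [v]" by (simp add: is_path_def)
  have "\<forall>y. is_path V E y \<longrightarrow> length y \<le> card V" using is_path_length[OF assms(1)] by auto
  then have "\<forall>y. is_path V E y \<longrightarrow> length y < Suc (card V)" by (simp add: less_Suc_eq_le)
  from ex_has_greatest_nat[where P = "is_path V E" and f = length, OF ex this] that
  show ?thesis by blast
qed

lemma longest_path_neighbour:
  assumes "is_path V E (x # xs)" "\<And>ys. is_path V E ys \<Longrightarrow> length ys \<le> length (x # xs)"
    and "{x, y} \<in> E" "y \<in> V"
  shows "y \<in> set (x # xs)"
proof (rule ccontr)
  assume "y \<notin> set (x # xs)"
  then have "is_path V E (y # x # xs)" using assms by (auto simp: is_path_def insert_commute)
  from assms(2)[OF this] show False by simp
qed

text \<open>The tail \<open>r\<close> starts two places after \<open>x\<close>, so the chord closes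
  a list of at least three vertices.\<close>

lemma path_chord_cycle:
  assumes "is_path V E (x # x1 # r)" "y \<in> set r" "{x, y} \<in> E"
  obtains xs where "is_cycle V E xs" "set xs \<subseteq> set (x # x1 # r)"
proof -
  obtain r1 r2 where r: "r = r1 @ y # r2" using assms(2) by (meson split_list)
  have "path_edges (x # x1 # r1 @ [y]) \<subseteq> path_edges (x # x1 # r)"
    unfolding r using path_edges_append[of "x # x1 # r1" y r2] by auto
  then have "is_cycle V E (x # x1 # r1 @ [y])"
    using assms r path_edges_append[of "x # x1 # r1" y "[x]"]
    unfolding is_cycle_def is_path_def cycle_edges_def by (auto simp: insert_commute)
  then show ?thesis by (rule that) (auto simp: r)
qed

definition graph_edges :: "'a set \<Rightarrow> 'a set set \<Rightarrow> bool" where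
  "graph_edges V E \<longleftrightarrow> finite V \<and> (\<forall>e\<in>E. \<exists>u v. u \<in> V \<and> v \<in> V \<and> u \<noteq> v \<and> e = {u, v})"

lemma graph_edges_finite: "graph_edges V E \<Longrightarrow> finite E"
  unfolding graph_edges_def by (rule finite_subset[of _ "Pow V"]) auto

lemma graph_edges_vertex: "graph_edges V E \<Longrightarrow> e \<in> E \<Longrightarrow> v \<in> e \<Longrightarrow> v \<in> V"
  unfolding graph_edges_def by fastforce

lemma graph_edges_other:
  assumes "graph_edges V E" "e \<in> E" "v \<in> e"
  obtains w where "w \<in> V" "w \<noteq> v" "e = {v, w}"
proof -
  obtain a b where "a \<in> V" "b \<in> V" "a \<noteq> b" "e = {a, b}"
    using assms(1,2) by (auto simp: graph_edges_def)
  then show ?thesis using assms(3) that[of a] that[of b] by auto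
qed

lemma graph_edges_subset:
  assumes "graph_edges V E" "V' \<subseteq> V" "E' \<subseteq> E" "\<And>e. e \<in> E' \<Longrightarrow> e \<subseteq> V'"
  shows "graph_edges V' E'"
  unfolding graph_edges_def
proof (intro conjI ballI)
  show "finite V'" using assms(1,2) finite_subset by (auto simp: graph_edges_def)
  fix e assume e: "e \<in> E'"
  then have "e \<in> E" using assms(3) by blast
  then obtain u v where "e = {u, v}" "u \<noteq> v" using assms(1) by (auto simp: graph_edges_def)
  then show "\<exists>u v. u \<in> V' \<and> v \<in> V' \<and> u \<noteq> v \<and> e = {u, v}" using assms(4)[OF e] by blast
qed

text \<open>A second edge at the first vertex of a longest path must lead back into the path, and
  this chord closes a cycle.\<close>

lemma min_degree_two_cycle:
  assumes "graph_edges V E" "V \<noteq> {}" "\<And>v. v \<in> V \<Longrightarrow> 2 \<le> card {e\<in>E. v \<in> e}"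
  obtains xs where "is_cycle V E xs"
proof -
  have fin: "finite V" using assms(1) by (auto simp: graph_edges_def)
  obtain ps where ps: "is_path V E ps" "\<And>ys. is_path V E ys \<Longrightarrow> length ys \<le> length ps"
    using longest_path_exists[OF fin assms(2)] by blast
  obtain x r0 where x: "ps = x # r0" using ps(1) by (cases ps) (auto simp: is_path_def)
  have xV: "x \<in> V" using ps(1) x by (auto simp: is_path_def)
  have deg: "\<not> {e\<in>E. x \<in> e} \<subseteq> {f}" for f
  proof
    assume "{e\<in>E. x \<in> e} \<subseteq> {f}"
    then have "card {e\<in>E. x \<in> e} \<le> 1" using card_mono[of "{f}"] by fastforce
    then show False using assms(3)[OF xV] by simp
  qed
  have nb: "y \<in> set r0" if "{x,y} \<in> E" "y \<noteq> x" "y \<in> V" for y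
    using longest_path_neighbour[of V E x r0 y] ps that unfolding x by auto
  obtain e0 where "e0 \<in> E" "x \<in> e0" using deg[of undefined] by auto
  then obtain y0 where "y0 \<in> V" "y0 \<noteq> x" "{x,y0} \<in> E" using graph_edges_other[OF assms(1)] by metis
  then have "r0 \<noteq> []" using nb by fastforce
  then obtain x1 r where r: "r0 = x1 # r" by (cases r0) auto
  obtain e where e: "e \<in> E" "x \<in> e" "e \<noteq> {x,x1}" using deg[of "{x,x1}"] by auto
  obtain y where y: "y \<in> V" "y \<noteq> x" "e = {x,y}" using graph_edges_other[OF assms(1) e(1,2)] by metis
  then have "y \<in> set r" using nb[of y] e r by auto
  then obtain xs where "is_cycle V E xs"
    using path_chord_cycle[of V E x x1 r y] ps(1) e y unfolding x r by auto
  then show ?thesis by (rule that)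
qed

subsection \<open>Plane drawings\<close>

text \<open>\<open>planar\<close> with its witnesses as parameters: subgraphs, inverted drawings and
  drawings with an added edge can then be formed explicitly.\<close>

definition drawing :: "'a set \<Rightarrow> 'a set set \<Rightarrow> ('a \<Rightarrow> complex) \<Rightarrow> ('a set \<Rightarrow> real \<Rightarrow> complex) \<Rightarrow> bool" where
  "drawing V E p \<gamma> \<longleftrightarrow> graph_edges V E \<and> inj_on p V \<and>
     (\<forall>e\<in>E. arc (\<gamma> e) \<and> {pathstart (\<gamma> e), pathfinish (\<gamma> e)} = p ` e) \<and>
     (\<forall>e\<in>E. \<forall>v\<in>V. p v \<in> path_image (\<gamma> e) \<longrightarrow> v \<in> e) \<and>
     (\<forall>e\<in>E. \<forall>e'\<in>E. e \<noteq> e' \<longrightarrow>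
         path_image (\<gamma> e) \<inter> path_image (\<gamma> e') \<subseteq> p ` (e \<inter> e'))"

lemma
  assumes "drawing V E p \<gamma>"
  shows drawing_graph: "graph_edges V E"
    and drawing_inj: "inj_on p V"
    and drawing_arc: "\<And>e. e \<in> E \<Longrightarrow> arc (\<gamma> e)"
    and drawing_ends: "\<And>e. e \<in> E \<Longrightarrow> {pathstart (\<gamma> e), pathfinish (\<gamma> e)} = p ` e"
    and drawing_vertex: "\<And>e v. e \<in> E \<Longrightarrow> v \<in> V \<Longrightarrow> p v \<in> path_image (\<gamma> e) \<Longrightarrow> v \<in> e"
    and drawing_Int: "\<And>e e'. e \<in> E \<Longrightarrow> e' \<in> E \<Longrightarrow> e \<noteq> e' \<Longrightarrow>
           path_image (\<gamma> e) \<inter> path_image (\<gamma> e') \<subseteq> p ` (e \<inter> e')"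
  using assms unfolding drawing_def by simp_all

lemma planar_drawing:
  assumes "simple_graph G" "planar G"
  obtains p \<gamma> where "drawing (fst G) (snd G) p \<gamma>"
proof -
  have "graph_edges (fst G) (snd G)"
    using assms(1) unfolding simple_graph_def graph_edges_def by blast
  then have "\<exists>p \<gamma>. drawing (fst G) (snd G) p \<gamma>"
    using assms(2) unfolding planar_def drawing_def by simp
  then show ?thesis using that by (elim exE)
qed

lemma drawing_subset:
  assumes "drawing V E p \<gamma>" "V' \<subseteq> V" "E' \<subseteq> E" "\<And>e. e \<in> E' \<Longrightarrow> e \<subseteq> V'"
  shows "drawing V' E' p \<gamma>"
proof -
  have "graph_edges V' E'" using graph_edges_subset[of V E V' E'] assms by (auto simp: drawing_def)
  moreover have "inj_on p V'" using assms by (auto simp: drawing_def intro: inj_on_subset)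
  moreover have "e \<in> E" if "e \<in> E'" for e using assms(3) that by blast
  moreover have "v \<in> V" if "v \<in> V'" for v using assms(2) that by blast
  ultimately show ?thesis using assms(1) unfolding drawing_def by simp
qed

definition edge_image :: "('a set \<Rightarrow> real \<Rightarrow> complex) \<Rightarrow> 'a set set \<Rightarrow> complex set" where
  "edge_image \<gamma> F = (\<Union>e\<in>F. path_image (\<gamma> e))"

lemma edge_image_Un [simp]: "edge_image \<gamma> (A \<union> B) = edge_image \<gamma> A \<union> edge_image \<gamma> B"
  by (auto simp: edge_image_def)

lemma drawing_vertex_in_edge:
  assumes "drawing V E p \<gamma>" "e \<in> E" "v \<in> e"
  shows "p v \<in> path_image (\<gamma> e)"
proof -
  have "p v \<in> {pathstart (\<gamma> e), pathfinish (\<gamma> e)}"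
    unfolding drawing_ends[OF assms(1,2)] using assms(3) by (rule imageI)
  then show ?thesis by auto
qed

lemma drawing_vertex_on:
  assumes "drawing V E p \<gamma>" "F \<subseteq> E" "v \<in> V"
  shows "p v \<in> edge_image \<gamma> F \<longleftrightarrow> v \<in> \<Union>F"
proof
  assume "p v \<in> edge_image \<gamma> F"
  then obtain e where "e \<in> F" "p v \<in> path_image (\<gamma> e)" by (auto simp: edge_image_def)
  then show "v \<in> \<Union>F" using drawing_vertex[OF assms(1), of e v] assms(2,3) by blast
next
  assume "v \<in> \<Union>F"
  then show "p v \<in> edge_image \<gamma> F"
    using drawing_vertex_in_edge[OF assms(1)] assms(2) by (auto simp: edge_image_def)
qed

lemma edge_image_Int:
  assumes "drawing V E p \<gamma>" "A \<subseteq> E" "B \<subseteq> E" "A \<inter> B = {}"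
  shows "edge_image \<gamma> A \<inter> edge_image \<gamma> B \<subseteq> p ` (\<Union>A \<inter> \<Union>B)"
proof
  fix z assume "z \<in> edge_image \<gamma> A \<inter> edge_image \<gamma> B"
  then obtain a b where ab: "a \<in> A" "b \<in> B" "z \<in> path_image (\<gamma> a) \<inter> path_image (\<gamma> b)"
    by (auto simp: edge_image_def)
  then have "z \<in> p ` (a \<inter> b)" using drawing_Int[OF assms(1), of a b] assms(2-4) by blast
  then show "z \<in> p ` (\<Union>A \<inter> \<Union>B)" using ab by blast
qed

lemma edge_image_Int_eq:
  assumes "drawing V E p \<gamma>" "A \<subseteq> E" "B \<subseteq> E" "A \<inter> B = {}" "\<Union>A \<inter> \<Union>B = S"
  shows "edge_image \<gamma> A \<inter> edge_image \<gamma> B = p ` S"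
proof
  show "edge_image \<gamma> A \<inter> edge_image \<gamma> B \<subseteq> p ` S" using edge_image_Int[OF assms(1-4)] assms(5) by simp
  show "p ` S \<subseteq> edge_image \<gamma> A \<inter> edge_image \<gamma> B"
    using drawing_vertex_in_edge[OF assms(1)] assms(2,3,5) unfolding edge_image_def by blast
qed

text \<open>One sample point per edge decides its side of a cycle. The endpoints would not do, since
  they may lie on the cycle.\<close>

definition edge_mid :: "('a set \<Rightarrow> real \<Rightarrow> complex) \<Rightarrow> 'a set \<Rightarrow> complex" where
  "edge_mid \<gamma> e = \<gamma> e (1/2)"

lemma edge_mid_in: "edge_mid \<gamma> e \<in> path_image (\<gamma> e)"
  unfolding edge_mid_def path_image_def by auto

lemma arc_endpoint_only:
  assumes "arc g" "t \<in> {0<..<1::real}"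
  shows "g t \<noteq> pathstart g" "g t \<noteq> pathfinish g"
  using assms inj_onD[of g "{0..1}" t 0] inj_onD[of g "{0..1}" t 1]
  by (auto simp: arc_def pathstart_def pathfinish_def)

text \<open>Distinct edges meet only in images of common vertices. These are endpoints of the arc,
  and an arc does not return to its endpoints.\<close>

lemma drawing_interior_point:
  assumes "drawing V E p \<gamma>" "e \<in> E" "F \<subseteq> E" "e \<notin> F" "t \<in> {0<..<1}"
  shows "\<gamma> e t \<notin> edge_image \<gamma> F"
proof
  assume "\<gamma> e t \<in> edge_image \<gamma> F"
  then obtain f where f: "f \<in> F" "\<gamma> e t \<in> path_image (\<gamma> f)" by (auto simp: edge_image_def)
  have "\<gamma> e t \<in> path_image (\<gamma> e)" using assms(5) by (auto simp: path_image_def)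
  then have "\<gamma> e t \<in> p ` (e \<inter> f)" using drawing_Int[OF assms(1,2), of f] f assms(3,4) by blast
  then have "\<gamma> e t \<in> {pathstart (\<gamma> e), pathfinish (\<gamma> e)}" unfolding drawing_ends[OF assms(1,2)] by blast
  moreover note drawing_arc[OF assms(1,2)]
  ultimately show False using arc_endpoint_only[of "\<gamma> e" t] assms(5) by auto
qed

lemma edge_mid_notin:
  assumes "drawing V E p \<gamma>" "e \<in> E" "F \<subseteq> E" "e \<notin> F"
  shows "edge_mid \<gamma> e \<notin> edge_image \<gamma> F"
  unfolding edge_mid_def by (rule drawing_interior_point[OF assms]) auto

lemma path_arc:
  assumes "drawing V E p \<gamma>" "distinct xs" "length xs \<ge> 2" "path_edges xs \<subseteq> E"
  shows "\<exists>g. arc g \<and> pathstart g = p (hd xs) \<and> pathfinish g = p (last xs)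
           \<and> path_image g = edge_image \<gamma> (path_edges xs)"
  using assms(2-)
proof (induction xs rule: path_edges.induct)
  case (1 x y zs)
  have e: "{x,y} \<in> E" using 1 by auto
  have ends: "arc (\<gamma> {x,y})" "{pathstart (\<gamma> {x,y}), pathfinish (\<gamma> {x,y})} = {p x, p y}"
    using drawing_arc[OF assms(1) e] drawing_ends[OF assms(1) e] by auto
  have "\<exists>g. arc g \<and> pathstart g = p x \<and> pathfinish g = p y \<and> path_image g = path_image (\<gamma> {x,y})"
  proof (cases "pathstart (\<gamma> {x,y}) = p x \<and> pathfinish (\<gamma> {x,y}) = p y")
    \<comment> \<open>The arc of an edge has no prescribed direction; it is reversed when it starts
      at \<open>p y\<close>.\<close>
    case False
    then have "pathstart (\<gamma> {x,y}) = p y \<and> pathfinish (\<gamma> {x,y}) = p x"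
      using ends(2) by (auto simp: doubleton_eq_iff)
    then show ?thesis using ends(1)
      by (intro exI[of _ "reversepath (\<gamma> {x,y})"]) (auto simp: arc_reversepath)
  qed (use ends in auto)
  then obtain g where g: "arc g" "pathstart g = p x" "pathfinish g = p y"
    "path_image g = path_image (\<gamma> {x,y})" by blast
  show ?case
  proof (cases zs)
    case Nil
    then show ?thesis using g by (auto simp: edge_image_def)
  next
    case (Cons z zs')
    obtain h where h: "arc h" "pathstart h = p y" "pathfinish h = p (last (y # zs))"
      "path_image h = edge_image \<gamma> (path_edges (y # zs))"
      using 1 Cons by auto
    have nin: "{x,y} \<notin> path_edges (y # zs)"
      using path_edges_subset[of "{x,y}" "y # zs"] 1 by auto
    have sub: "e \<subseteq> set (y # zs)" if "e \<in> path_edges (y # zs)" for e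
      using path_edges_subset[OF that] .
    have "path_image g \<inter> path_image h \<subseteq> p ` (\<Union>{{x,y}} \<inter> \<Union>(path_edges (y # zs)))"
      using edge_image_Int[OF assms(1), of "{{x,y}}" "path_edges (y # zs)"] e 1 nin
      unfolding g h by (simp add: edge_image_def)
    also have "\<dots> \<subseteq> {p y}" using sub 1 by fastforce
    finally have "arc (g +++ h)" using g h by (intro arc_join) auto
    then show ?thesis using g h Cons
      by (intro exI[of _ "g +++ h"]) (auto simp: path_image_join edge_image_def)
  qed
qed auto

text \<open>One edge against the rest of the cycle: two arcs that meet only at their common ends
  form a simple closed path.\<close>

lemma cycle_simple_path:
  assumes "drawing V E p \<gamma>" "is_cycle V E xs"
  obtains c where "simple_path c" "pathfinish c = pathstart c"
    "path_image c = edge_image \<gamma> (cycle_edges xs)"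
proof -
  obtain a b z zs where xs: "xs = a # b # z # zs" using assms(2)
    by (auto simp: is_cycle_def numeral_3_eq_3 Suc_le_length_iff)
  let ?P = "b # z # zs @ [a]"
  have d: "distinct ?P" "distinct [a,b]" "path_edges ?P \<subseteq> E" "path_edges [a,b] \<subseteq> E"
    using assms(2) unfolding is_cycle_def cycle_edges_def xs by auto
  obtain g where g: "arc g" "pathstart g = p a" "pathfinish g = p b"
    "path_image g = edge_image \<gamma> (path_edges [a,b])"
    using path_arc[OF assms(1) d(2) _ d(4)] by auto
  obtain h where h: "arc h" "pathstart h = p b" "pathfinish h = p a"
    "path_image h = edge_image \<gamma> (path_edges ?P)"
    using path_arc[OF assms(1) d(1) _ d(3)] by auto
  have "{a,b} \<notin> path_edges ?P" using path_edges_ends[of b "z # zs" a] d by (auto simp: insert_commute)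
  then have "path_image g \<inter> path_image h \<subseteq> p ` (\<Union>(path_edges [a,b]) \<inter> \<Union>(path_edges ?P))"
    unfolding g h by (intro edge_image_Int[OF assms(1)]) (use d in auto)
  then have "path_image g \<inter> path_image h \<subseteq> {pathstart g, pathstart h}" using g h by auto
  then have "simple_path (g +++ h)" using g h by (intro simple_path_join_loop) auto
  moreover have "path_image (g +++ h) = edge_image \<gamma> (cycle_edges xs)"
    using g h by (auto simp: path_image_join edge_image_def cycle_edges_def xs)
  ultimately show ?thesis using that[of "g +++ h"] g h by auto
qed

lemma cycle_inside_outside:
  assumes "drawing V E p \<gamma>" "is_cycle V E xs"
  defines "J \<equiv> edge_image \<gamma> (cycle_edges xs)"
  shows "inside J \<noteq> {}" "open (inside J)" "connected (inside J)" "open (outside J)"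
    "connected (outside J)" "bounded (inside J)" "\<not> bounded (outside J)" "inside J \<inter> outside J = {}"
    "inside J \<union> outside J = - J" "closed J" "bounded J"
proof -
  obtain c where c: "simple_path c" "pathfinish c = pathstart c" "path_image c = J"
    using cycle_simple_path[OF assms(1,2)] J_def by metis
  show "inside J \<noteq> {}" "open (inside J)" "connected (inside J)" "open (outside J)"
    "connected (outside J)" "bounded (inside J)" "\<not> bounded (outside J)" "inside J \<inter> outside J = {}"
    "inside J \<union> outside J = - J"
    using Jordan_inside_outside[OF c(1,2)] unfolding c(3) by auto
  show "closed J" "bounded J"
    using closed_simple_path_image[OF c(1)] bounded_simple_path_image[OF c(1)] c(3) by auto
qed

text \<open>The arc can touch the cycle only at its two ends, so the parameters of the remaining
  points still form an interval.\<close>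

lemma edge_off_cycle_connected:
  assumes "drawing V E p \<gamma>" "is_cycle V E xs" "e \<in> E" "e \<notin> cycle_edges xs"
  shows "connected (path_image (\<gamma> e) - edge_image \<gamma> (cycle_edges xs))"
proof -
  let ?J = "edge_image \<gamma> (cycle_edges xs)"
  let ?T = "{t\<in>{0..1}. \<gamma> e t \<notin> ?J}"
  have int: "{0<..<1} \<subseteq> ?T"
    using drawing_interior_point[OF assms(1,3) _ assms(4)] assms(2) by (auto simp: is_cycle_def)
  have "is_interval ?T"
    unfolding is_interval_1
  proof (intro ballI allI impI)
    fix a b x assume ab: "a \<in> ?T" "b \<in> ?T" "a \<le> x \<and> x \<le> b"
    show "x \<in> ?T"
    proof (cases "x = a \<or> x = b")
      case False
      then have "x \<in> {0<..<1}" using ab by auto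
      then show ?thesis using int by blast
    qed (use ab in auto)
  qed
  then have "connected ?T" using is_interval_connected_1 by blast
  moreover have "continuous_on ?T (\<gamma> e)"
    using drawing_arc[OF assms(1,3)] by (auto simp: arc_def path_def intro: continuous_on_subset)
  ultimately have "connected (\<gamma> e ` ?T)" by (rule connected_continuous_image[rotated])
  moreover have "\<gamma> e ` ?T = path_image (\<gamma> e) - ?J" by (auto simp: path_image_def)
  ultimately show ?thesis by simp
qed

lemma edge_off_cycle:
  assumes "drawing V E p \<gamma>" "is_cycle V E xs" "e \<in> E" "e \<notin> cycle_edges xs"
  defines "J \<equiv> edge_image \<gamma> (cycle_edges xs)"
  shows "path_image (\<gamma> e) - J \<subseteq> inside J \<or> path_image (\<gamma> e) - J \<subseteq> outside J"
proof -
  note io = cycle_inside_outside[OF assms(1,2), folded J_def]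
  have "connected (path_image (\<gamma> e) - J)"
    unfolding J_def by (rule edge_off_cycle_connected[OF assms(1-4)])
  from connectedD[OF this io(2,4)] show ?thesis using io(8,9) by blast
qed

section \<open>Edges and vertices inside a cycle\<close>

definition inner_edges :: "'a set set \<Rightarrow> ('a set \<Rightarrow> real \<Rightarrow> complex) \<Rightarrow> 'a list \<Rightarrow> 'a set set" where
  "inner_edges E \<gamma> xs = {e\<in>E. edge_mid \<gamma> e \<in> inside (edge_image \<gamma> (cycle_edges xs))}"

definition inner_vertices ::
  "'a set \<Rightarrow> ('a \<Rightarrow> complex) \<Rightarrow> ('a set \<Rightarrow> real \<Rightarrow> complex) \<Rightarrow> 'a list \<Rightarrow> 'a set" where
  "inner_vertices V p \<gamma> xs = {v\<in>V. p v \<in> inside (edge_image \<gamma> (cycle_edges xs))}"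

lemma inner_edge_not_cycle:
  assumes "drawing V E p \<gamma>" "is_cycle V E xs" "e \<in> inner_edges E \<gamma> xs"
  shows "e \<in> E" "e \<notin> cycle_edges xs"
proof -
  show "e \<in> E" using assms(3) by (simp add: inner_edges_def)
  show "e \<notin> cycle_edges xs"
  proof
    assume "e \<in> cycle_edges xs"
    then have "edge_mid \<gamma> e \<in> edge_image \<gamma> (cycle_edges xs)"
      using edge_mid_in by (auto simp: edge_image_def)
    moreover have "edge_mid \<gamma> e \<in> inside (edge_image \<gamma> (cycle_edges xs))"
      using assms(3) by (simp add: inner_edges_def)
    ultimately show False using inside_no_overlap by blast
  qed
qed

lemma Union_cycle_edges: "length xs \<ge> 2 \<Longrightarrow> \<Union>(cycle_edges xs) = set xs"
  using Union_path_edges[of "xs @ [hd xs]"] by (cases xs) (auto simp: cycle_edges_def)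

lemma vertex_off_cycle:
  assumes "drawing V E p \<gamma>" "is_cycle V E xs" "v \<in> V"
  shows "p v \<in> edge_image \<gamma> (cycle_edges xs) \<longleftrightarrow> v \<in> set xs"
  using drawing_vertex_on[OF assms(1) _ assms(3), of "cycle_edges xs"] Union_cycle_edges[of xs] assms(2)
  by (auto simp: is_cycle_def)

text \<open>Off the cycle, the whole edge lies on the side of its midpoint, and hence so does every
  endpoint that is not on the cycle.\<close>

lemma inner_edge_vertex:
  assumes "drawing V E p \<gamma>" "is_cycle V E xs" "e \<in> inner_edges E \<gamma> xs" "v \<in> e"
  shows "v \<in> inner_vertices V p \<gamma> xs \<or> v \<in> set xs"
proof (cases "v \<in> set xs")
  case False
  let ?J = "edge_image \<gamma> (cycle_edges xs)"
  note io = cycle_inside_outside[OF assms(1,2)]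
  note ec = inner_edge_not_cycle[OF assms(1-3)]
  have vV: "v \<in> V" using graph_edges_vertex[OF drawing_graph[OF assms(1)] ec(1) assms(4)] .
  have pv: "p v \<in> path_image (\<gamma> e) - ?J"
    using drawing_vertex_in_edge[OF assms(1) ec(1) assms(4)] vertex_off_cycle[OF assms(1,2) vV] False by auto
  have "edge_mid \<gamma> e \<in> inside ?J" using assms(3) by (simp add: inner_edges_def)
  then have "edge_mid \<gamma> e \<in> path_image (\<gamma> e) - ?J" using edge_mid_in io(9) by blast
  then have "path_image (\<gamma> e) - ?J \<subseteq> inside ?J"
    using edge_off_cycle[OF assms(1,2) ec] \<open>edge_mid \<gamma> e \<in> inside ?J\<close> io(8) by blast
  then show ?thesis using pv vV by (auto simp: inner_vertices_def)
qed auto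

lemma inner_vertex_edge:
  assumes "drawing V E p \<gamma>" "is_cycle V E xs" "e \<in> E" "v \<in> e" "v \<in> inner_vertices V p \<gamma> xs"
  shows "e \<in> inner_edges E \<gamma> xs"
proof -
  let ?J = "edge_image \<gamma> (cycle_edges xs)"
  note io = cycle_inside_outside[OF assms(1,2)]
  have pv: "p v \<in> inside ?J" "v \<in> V" using assms(5) by (auto simp: inner_vertices_def)
  then have "v \<notin> set xs" using vertex_off_cycle[OF assms(1,2)] io(9) by blast
  then have ec: "e \<notin> cycle_edges xs" using cycle_edges_subset assms(4) by blast
  have "p v \<notin> ?J" using pv(1) inside_no_overlap by blast
  then have pe: "p v \<in> path_image (\<gamma> e) - ?J"
    using drawing_vertex_in_edge[OF assms(1,3,4)] by blast
  have "p v \<notin> outside ?J" using pv(1) io(8) by blast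
  then have sub: "path_image (\<gamma> e) - ?J \<subseteq> inside ?J"
    using edge_off_cycle[OF assms(1,2,3) ec] pe by blast
  have "edge_mid \<gamma> e \<notin> ?J"
    by (rule edge_mid_notin[OF assms(1,3) _ ec]) (use assms(2) in \<open>auto simp: is_cycle_def\<close>)
  then have "edge_mid \<gamma> e \<in> inside ?J" using sub edge_mid_in by blast
  then show ?thesis using assms(3) by (simp add: inner_edges_def)
qed

subsection \<open>Counting edges of plane graphs\<close>

definition girth_ge :: "nat \<Rightarrow> 'a set \<Rightarrow> 'a set set \<Rightarrow> bool" where
  "girth_ge g V E \<longleftrightarrow> (\<forall>xs. is_cycle V E xs \<longrightarrow> g \<le> length xs)"

lemma girth_ge_subgraph: "girth_ge g V E \<Longrightarrow> V' \<subseteq> V \<Longrightarrow> E' \<subseteq> E \<Longrightarrow> girth_ge g V' E'"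
  unfolding girth_ge_def using is_cycle_subgraph by blast

text \<open>The induction hypothesis of \<open>plane_edge_bound\<close> in portable form. The
  constant is \<open>g\<close> rather than \<open>2 * g\<close>: the weaker bound also holds for one
  or two vertices, and it is exactly what a part hanging at a single cycle vertex consumes.\<close>

definition sparse_below :: "nat \<Rightarrow> nat \<Rightarrow> ('a \<Rightarrow> complex) \<Rightarrow> ('a set \<Rightarrow> real \<Rightarrow> complex) \<Rightarrow> bool" where
  "sparse_below N g p \<gamma> \<longleftrightarrow> (\<forall>V E. drawing V E p \<gamma> \<longrightarrow> girth_ge g V E \<longrightarrow> V \<noteq> {} \<longrightarrow> card V < N \<longrightarrow>
     (g - 2) * card E + g \<le> g * card V)"

lemma finite_inner [simp]:
  "drawing V E p \<gamma> \<Longrightarrow> finite (inner_edges E \<gamma> xs)"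
  "drawing V E p \<gamma> \<Longrightarrow> finite (inner_vertices V p \<gamma> xs)"
  using graph_edges_finite[OF drawing_graph, of V E p \<gamma>] drawing_graph[of V E p \<gamma>]
  unfolding inner_edges_def inner_vertices_def graph_edges_def by auto

text \<open>The two arcs of the cycle and the new path meet pairwise in \<open>p a\<close> and
  \<open>p b\<close> only, so the theta curve theorem applies; each of the two new cycles consists
  of the path and one old arc.\<close>

lemma theta_split:
  assumes d: "drawing V E p \<gamma>" and cyc: "is_cycle V E (a # A @ b # B)"
    and Q: "distinct Q" "set Q \<subseteq> inner_vertices V p \<gamma> (a # A @ b # B)"
    and PE: "path_edges (a # Q @ [b]) \<subseteq> inner_edges E \<gamma> (a # A @ b # B)"
  defines "I \<equiv> inside (edge_image \<gamma> (cycle_edges (a # A @ b # B)))"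
    and "I1 \<equiv> inside (edge_image \<gamma> (cycle_edges (a # A @ b # rev Q)))"
    and "I2 \<equiv> inside (edge_image \<gamma> (cycle_edges (a # Q @ b # B)))"
  shows "is_cycle V E (a # A @ b # rev Q)" "is_cycle V E (a # Q @ b # B)" "I1 \<inter> I2 = {}"
    "I1 \<union> I2 \<union> (edge_image \<gamma> (path_edges (a # Q @ [b])) - {p a, p b}) = I"
    "I1 \<inter> edge_image \<gamma> (path_edges (a # Q @ [b])) = {}" "I2 \<inter> edge_image \<gamma> (path_edges (a # Q @ [b])) = {}"
proof -
  let ?C = "a # A @ b # B"
  define P1 P2 P where "P1 = a # A @ [b]" and "P2 = a # rev B @ [b]" and "P = a # Q @ [b]"
  have dC: "distinct ?C" "set ?C \<subseteq> V" "cycle_edges ?C \<subseteq> E" "length ?C \<ge> 3"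
    using cyc by (auto simp: is_cycle_def)
  have cC: "cycle_edges ?C = path_edges P1 \<union> path_edges P2"
    using path_edges_rev[of P2] by (simp add: cycle_edges_split P1_def P2_def)
  have c1: "cycle_edges (a # A @ b # rev Q) = path_edges P1 \<union> path_edges P"
    using path_edges_rev[of P] by (simp add: cycle_edges_split P1_def P_def)
  have c2: "cycle_edges (a # Q @ b # B) = path_edges P \<union> path_edges P2"
    using path_edges_rev[of P2] by (simp add: cycle_edges_split P_def P2_def)
  have QC: "set Q \<inter> set ?C = {}"
  proof -
    have "v \<notin> set ?C" if "v \<in> inner_vertices V p \<gamma> ?C" for v
      using that vertex_off_cycle[OF d cyc, of v] inside_no_overlap unfolding inner_vertices_def by blast
    then show ?thesis using Q(2) by blast
  qed
  have QV: "set Q \<subseteq> V" using Q(2) by (auto simp: inner_vertices_def)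
  have dP: "distinct P1" "distinct P2" "distinct P"
    using dC(1) Q(1) QC by (auto simp: P1_def P2_def P_def)
  have len: "length P1 \<ge> 2" "length P2 \<ge> 2" "length P \<ge> 2" by (auto simp: P1_def P2_def P_def)
  have PI: "e \<in> E" "e \<notin> cycle_edges ?C" if "e \<in> path_edges P" for e
    using inner_edge_not_cycle[OF d cyc, of e] that PE unfolding P_def by blast+
  have sub: "path_edges P1 \<subseteq> E" "path_edges P2 \<subseteq> E" "path_edges P \<subseteq> E"
    using dC(3) cC PI by auto
  have U: "\<Union>(path_edges P1) = set P1" "\<Union>(path_edges P2) = set P2" "\<Union>(path_edges P) = set P"
    using Union_path_edges len by auto
  \<comment> \<open>A common edge of both arcs would be \<open>{a, b}\<close> itself; then both arcs
    are single edges and the cycle has only two vertices.\<close>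
  have i12: "path_edges P1 \<inter> path_edges P2 = {}"
  proof (rule ccontr)
    assume "path_edges P1 \<inter> path_edges P2 \<noteq> {}"
    then obtain e where e: "e \<in> path_edges P1" "e \<in> path_edges P2" by blast
    then have "e \<subseteq> set P1 \<inter> set P2" using path_edges_subset by blast
    also have "\<dots> \<subseteq> {a,b}" using dC(1) by (auto simp: P1_def P2_def)
    finally have "e \<subseteq> {a,b}" .
    moreover obtain x y where "e = {x,y}" "x \<noteq> y"
      using e(1) sub(1) drawing_graph[OF d] unfolding graph_edges_def by blast
    ultimately have "e = {a,b}" by blast
    then have "A = []" "rev B = []"
      using e path_edges_ends[of a A b] path_edges_ends[of a "rev B" b] dP unfolding P1_def P2_def by auto
    then show False using dC(4) by simp
  qed
  have ab: "a \<noteq> b" using dC(1) by auto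
  have img: "edge_image \<gamma> (path_edges P1) \<inter> edge_image \<gamma> (path_edges P2) = p ` {a,b}"
    "edge_image \<gamma> (path_edges P1) \<inter> edge_image \<gamma> (path_edges P) = p ` {a,b}"
    "edge_image \<gamma> (path_edges P2) \<inter> edge_image \<gamma> (path_edges P) = p ` {a,b}"
  proof -
    have "path_edges P1 \<inter> path_edges P = {}" "path_edges P2 \<inter> path_edges P = {}"
      using PI cC by auto
    moreover have "set P1 \<inter> set P2 = {a,b}" "set P1 \<inter> set P = {a,b}" "set P2 \<inter> set P = {a,b}"
      using dC(1) QC by (auto simp: P1_def P2_def P_def)
    ultimately show "edge_image \<gamma> (path_edges P1) \<inter> edge_image \<gamma> (path_edges P2) = p ` {a,b}"
      "edge_image \<gamma> (path_edges P1) \<inter> edge_image \<gamma> (path_edges P) = p ` {a,b}"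
      "edge_image \<gamma> (path_edges P2) \<inter> edge_image \<gamma> (path_edges P) = p ` {a,b}"
      using edge_image_Int_eq[OF d sub(1,2) i12] edge_image_Int_eq[OF d sub(1,3)]
        edge_image_Int_eq[OF d sub(2,3)] unfolding U by simp_all
  qed
  obtain g1 where g1: "arc g1" "pathstart g1 = p a" "pathfinish g1 = p b"
    "path_image g1 = edge_image \<gamma> (path_edges P1)"
    using path_arc[OF d dP(1) len(1) sub(1)] by (auto simp: P1_def)
  obtain g2 where g2: "arc g2" "pathstart g2 = p a" "pathfinish g2 = p b"
    "path_image g2 = edge_image \<gamma> (path_edges P2)"
    using path_arc[OF d dP(2) len(2) sub(2)] by (auto simp: P2_def)
  obtain h where h: "arc h" "pathstart h = p a" "pathfinish h = p b"
    "path_image h = edge_image \<gamma> (path_edges P)"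
    using path_arc[OF d dP(3) len(3) sub(3)] by (auto simp: P_def)
  have pab: "p a \<noteq> p b" using drawing_inj[OF d] ab dC(2) by (auto dest: inj_onD)
  have I: "I = inside (path_image g1 \<union> path_image g2)" "I1 = inside (path_image g1 \<union> path_image h)"
    "I2 = inside (path_image g2 \<union> path_image h)"
    unfolding I_def I1_def I2_def cC c1 c2 g1(4) g2(4) h(4) by (simp_all add: Un_commute)
  \<comment> \<open>The theta curve theorem asks that the path enters the inside; the midpoint of
    any of its edges lies there.\<close>
  obtain e where e: "e \<in> path_edges P" by (cases Q) (auto simp: P_def)
  then have "edge_mid \<gamma> e \<in> I" using PE unfolding I_def P_def inner_edges_def by blast
  moreover have "edge_mid \<gamma> e \<in> path_image h" using e edge_mid_in h(4) by (auto simp: edge_image_def)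
  ultimately have ne: "path_image h \<inter> inside (path_image g1 \<union> path_image g2) \<noteq> {}" using I(1) by blast
  note sp = split_inside_simple_closed_curve[OF arc_imp_simple_path[OF g1(1)] g1(2,3)
      arc_imp_simple_path[OF g2(1)] g2(2,3) arc_imp_simple_path[OF h(1)] h(2,3) pab _ _ _ ne]
  have "I1 \<inter> I2 = {} \<and> I1 \<union> I2 \<union> (path_image h - {p a, p b}) = I"
    unfolding I by (rule sp) (use img in \<open>auto simp: g1 g2 h\<close>)
  then show "I1 \<inter> I2 = {}" "I1 \<union> I2 \<union> (edge_image \<gamma> (path_edges (a # Q @ [b])) - {p a, p b}) = I"
    by (auto simp: h P_def)
  show "I1 \<inter> edge_image \<gamma> (path_edges (a # Q @ [b])) = {}"
    "I2 \<inter> edge_image \<gamma> (path_edges (a # Q @ [b])) = {}"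
    unfolding I h(4)[symmetric, unfolded P_def] using inside_no_overlap by blast+
  \<comment> \<open>If the path is the single edge \<open>{a, b}\<close>, neither old arc is that
    edge, so both new cycles still have at least three vertices.\<close>
  have AQ: "A \<noteq> [] \<or> Q \<noteq> []" "B \<noteq> [] \<or> Q \<noteq> []"
    using PI(2)[of "{a,b}"] unfolding cC by (auto simp: P_def P1_def P2_def)
  show "is_cycle V E (a # A @ b # rev Q)" "is_cycle V E (a # Q @ b # B)"
    using AQ dP dC QC QV sub unfolding is_cycle_def c1 c2
    by (auto simp: P1_def P2_def P_def Suc_le_eq simp flip: length_greater_0_conv)
qed

text \<open>The path contributes \<open>Q + 1\<close> edges and lies on both new boundaries:
  \<open>(g - 2) * (Q + 1) + 2 * (Q + 1) = g * (Q + 1)\<close>. This is balanced by the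
  \<open>Q\<close> vertices that move from the inside to the boundary and by one of the two
  constants \<open>g\<close>.\<close>

lemma split_count:
  fixes g :: nat
  assumes "(g - 2) * e1 + g \<le> g * m1 + (A + Q + 2)" "(g - 2) * e2 + g \<le> g * m2 + (Q + B + 2)"
    and "e \<le> Q + 1 + e1 + e2" "m1 + m2 + Q \<le> m" "2 \<le> g"
  shows "(g - 2) * e + g \<le> g * m + (A + B + 2)"
proof -
  have "(g - 2) * e \<le> (g - 2) * (Q + 1 + e1 + e2)" by (rule mult_le_mono2[OF assms(3)])
  also have "\<dots> = (g - 2) * (Q + 1) + (g - 2) * e1 + (g - 2) * e2"
    by (simp only: add_mult_distrib2)
  finally have 1: "(g - 2) * e \<le> (g - 2) * (Q + 1) + (g - 2) * e1 + (g - 2) * e2" .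
  have 2: "(g - 2) * (Q + 1) + 2 * (Q + 1) = g * (Q + 1)"
    using assms(5) by (metis add_mult_distrib le_add_diff_inverse2)
  have 3: "g * (m1 + m2 + Q) \<le> g * m" using assms(4) by simp
  have "g * (m1 + m2 + Q) = g * m1 + g * m2 + g * Q" by (simp add: algebra_simps)
  then show ?thesis using 1 2 3 assms(1,2) by (simp add: algebra_simps)
qed

lemma inner_split:
  assumes d: "drawing V E p \<gamma>" and cyc: "is_cycle V E (a # A @ b # B)" and g: "2 \<le> g"
    and Q: "distinct Q" "set Q \<subseteq> inner_vertices V p \<gamma> (a # A @ b # B)"
    and PE: "path_edges (a # Q @ [b]) \<subseteq> inner_edges E \<gamma> (a # A @ b # B)"
    and IH: "\<And>ys. is_cycle V E ys \<Longrightarrow> inner_vertices V p \<gamma> ys \<subseteq> inner_vertices V p \<gamma> (a # A @ b # B) \<Longrightarrow>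
       inner_edges E \<gamma> ys \<subset> inner_edges E \<gamma> (a # A @ b # B) \<Longrightarrow>
       (g - 2) * card (inner_edges E \<gamma> ys) + g \<le> g * card (inner_vertices V p \<gamma> ys) + length ys"
  shows "(g - 2) * card (inner_edges E \<gamma> (a # A @ b # B)) + g
     \<le> g * card (inner_vertices V p \<gamma> (a # A @ b # B)) + length (a # A @ b # B)"
proof -
  let ?C = "a # A @ b # B" let ?C1 = "a # A @ b # rev Q" let ?C2 = "a # Q @ b # B"
  let ?PE = "path_edges (a # Q @ [b])"
  note t = theta_split[OF d cyc Q PE]
  have midP: "edge_mid \<gamma> e \<in> edge_image \<gamma> ?PE" if "e \<in> ?PE" for e
    using that edge_mid_in by (auto simp: edge_image_def)
  have midN: "edge_mid \<gamma> e \<notin> edge_image \<gamma> ?PE" if "e \<in> E" "e \<notin> ?PE" for e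
    by (rule edge_mid_notin[OF d that(1) _ that(2)]) (use PE in \<open>auto simp: inner_edges_def\<close>)
  obtain e0 where e0: "e0 \<in> ?PE" by (cases Q) auto
  have Psub: "?PE \<subseteq> E" using PE by (auto simp: inner_edges_def)
  have sube: "inner_edges E \<gamma> ?C1 \<subseteq> inner_edges E \<gamma> ?C - ?PE" "inner_edges E \<gamma> ?C2 \<subseteq> inner_edges E \<gamma> ?C - ?PE"
    using t(4,5,6) midP unfolding inner_edges_def by blast+
  have e0C: "e0 \<in> inner_edges E \<gamma> ?C" using PE e0 by blast
  have ss: "inner_edges E \<gamma> ?C1 \<subset> inner_edges E \<gamma> ?C" "inner_edges E \<gamma> ?C2 \<subset> inner_edges E \<gamma> ?C"
    using sube e0 e0C by blast+
  have subv: "inner_vertices V p \<gamma> ?C1 \<subseteq> inner_vertices V p \<gamma> ?C" "inner_vertices V p \<gamma> ?C2 \<subseteq> inner_vertices V p \<gamma> ?C"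
    using t(4) unfolding inner_vertices_def by blast+
  have QP: "p v \<in> edge_image \<gamma> ?PE" if "v \<in> set Q" for v
  proof -
    have "v \<in> V" using that Q(2) by (auto simp: inner_vertices_def)
    moreover have "\<Union>?PE = set (a # Q @ [b])" by (rule Union_path_edges) simp
    ultimately show ?thesis using drawing_vertex_on[OF d Psub, of v] that by auto
  qed
  have disjv: "inner_vertices V p \<gamma> ?C1 \<inter> inner_vertices V p \<gamma> ?C2 = {}"
    using t(3) unfolding inner_vertices_def by blast
  have disjQ: "(inner_vertices V p \<gamma> ?C1 \<union> inner_vertices V p \<gamma> ?C2) \<inter> set Q = {}"
    using t(5,6) QP unfolding inner_vertices_def by blast
  note fin = finite_inner[OF d]
  have cv: "card (inner_vertices V p \<gamma> ?C1) + card (inner_vertices V p \<gamma> ?C2) + length Q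
      \<le> card (inner_vertices V p \<gamma> ?C)"
  proof -
    have "card (inner_vertices V p \<gamma> ?C1) + card (inner_vertices V p \<gamma> ?C2) + length Q =
        card (inner_vertices V p \<gamma> ?C1 \<union> inner_vertices V p \<gamma> ?C2 \<union> set Q)"
      using disjv disjQ fin(2) distinct_card[OF Q(1)] by (simp add: card_Un_disjoint)
    also have "\<dots> \<le> card (inner_vertices V p \<gamma> ?C)"
      by (rule card_mono) (use fin subv Q(2) in auto)
    finally show ?thesis .
  qed
  have "inner_edges E \<gamma> ?C \<subseteq> ?PE \<union> (inner_edges E \<gamma> ?C1 \<union> inner_edges E \<gamma> ?C2)"
  proof
    fix e assume e: "e \<in> inner_edges E \<gamma> ?C"
    show "e \<in> ?PE \<union> (inner_edges E \<gamma> ?C1 \<union> inner_edges E \<gamma> ?C2)"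
    proof (cases "e \<in> ?PE")
      case False
      then have "edge_mid \<gamma> e \<notin> edge_image \<gamma> ?PE" using midN e by (auto simp: inner_edges_def)
      then show ?thesis using e t(4) unfolding inner_edges_def by blast
    qed auto
  qed
  then have "card (inner_edges E \<gamma> ?C) \<le> card (?PE \<union> (inner_edges E \<gamma> ?C1 \<union> inner_edges E \<gamma> ?C2))"
    by (rule card_mono[rotated]) (use fin in auto)
  also have "\<dots> \<le> card ?PE + (card (inner_edges E \<gamma> ?C1) + card (inner_edges E \<gamma> ?C2))"
    by (meson card_Un_le add_left_mono le_trans)
  also have "\<dots> \<le> length Q + 1 + card (inner_edges E \<gamma> ?C1) + card (inner_edges E \<gamma> ?C2)"
    using card_path_edges_le[of "a # Q @ [b]"] by simp
  finally have ce: "card (inner_edges E \<gamma> ?C)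
      \<le> length Q + 1 + card (inner_edges E \<gamma> ?C1) + card (inner_edges E \<gamma> ?C2)" .
  have "(g - 2) * card (inner_edges E \<gamma> ?C1) + g \<le> g * card (inner_vertices V p \<gamma> ?C1) + (length A + length Q + 2)"
    using IH[OF t(1) subv(1) ss(1)] by simp
  moreover have "(g - 2) * card (inner_edges E \<gamma> ?C2) + g \<le> g * card (inner_vertices V p \<gamma> ?C2) + (length Q + length B + 2)"
    using IH[OF t(2) subv(2) ss(2)] by simp
  ultimately have "(g - 2) * card (inner_edges E \<gamma> ?C) + g
      \<le> g * card (inner_vertices V p \<gamma> ?C) + (length A + length B + 2)"
    using split_count[OF _ _ ce cv g] by blast
  then show ?thesis by simp
qed

text \<open>Applied to a cycle vertex \<open>c\<close> outside \<open>I\<close>, this is the part of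
  the drawing that hangs at \<open>c\<close>.\<close>

definition reach_through :: "'a set \<Rightarrow> 'a set set \<Rightarrow> 'a \<Rightarrow> 'a set" where
  "reach_through I E c = {w. \<exists>Q. distinct (Q @ [w]) \<and> set (Q @ [w]) \<subseteq> I \<and> path_edges (c # Q @ [w]) \<subseteq> E}"

lemma reach_through_step:
  assumes "w \<in> reach_through I E c" "w' \<in> I" "{w, w'} \<in> E"
  shows "w' \<in> reach_through I E c"
proof -
  obtain Q where Q: "distinct (Q @ [w])" "set (Q @ [w]) \<subseteq> I" "path_edges (c # Q @ [w]) \<subseteq> E"
    using assms(1) unfolding reach_through_def by auto
  show ?thesis
  proof (cases "w' \<in> set (Q @ [w])")
    \<comment> \<open>A vertex already on the path is reached by an initial piece of it; appending
      it again would break distinctness.\<close>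
    case True
    then obtain R S where RS: "Q @ [w] = R @ w' # S" by (meson split_list)
    have "path_edges (c # R @ [w']) \<subseteq> path_edges (c # Q @ [w])"
      using path_edges_append[of "c # R" w' S] unfolding RS by auto
    then have "path_edges (c # R @ [w']) \<subseteq> E" using Q(3) by blast
    moreover have "distinct (R @ [w'])" "set (R @ [w']) \<subseteq> I" using Q(1,2) unfolding RS by auto
    ultimately show ?thesis unfolding reach_through_def by blast
  next
    case False
    have "path_edges (c # (Q @ [w]) @ [w']) \<subseteq> E"
      using path_edges_snoc[of "c # Q @ [w]" w'] Q(3) assms(3) by auto
    moreover have "distinct ((Q @ [w]) @ [w'])" "set ((Q @ [w]) @ [w']) \<subseteq> I" using Q(1,2) False assms(2) by auto
    ultimately show ?thesis unfolding reach_through_def by blast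
  qed
qed

text \<open>Three cases. A path through the inside between two cycle vertices splits the cycle.
  Otherwise a part hanging at a single cycle vertex \<open>c\<close> is cut off and bounded,
  together with \<open>c\<close>, by \<open>sparse_below\<close>; the \<open>+ 1\<close> in the size
  condition counts \<open>c\<close>. If nothing inside touches the cycle,
  \<open>sparse_below\<close> bounds all inner edges at once.\<close>

lemma inner_edges_bound:
  assumes "drawing V E p \<gamma>" "girth_ge g V E" "is_cycle V E xs" "sparse_below N g p \<gamma>" "2 \<le> g"
    and "card (inner_vertices V p \<gamma> xs) + 1 < N"
  shows "(g - 2) * card (inner_edges E \<gamma> xs) + g \<le> g * card (inner_vertices V p \<gamma> xs) + length xs"
  using assms
proof (induction "card (inner_edges E \<gamma> xs)" arbitrary: V E xs rule: less_induct)
  case less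
  note d = less.prems(1) and gir = less.prems(2) and cyc = less.prems(3) and sp = less.prems(4)
    and g2 = less.prems(5) and N = less.prems(6)
  let ?I = "inner_vertices V p \<gamma> xs" let ?E = "inner_edges E \<gamma> xs"
  have IV: "?I \<subseteq> V" by (auto simp: inner_vertices_def)
  have Ixs: "?I \<inter> set xs = {}"
  proof -
    have "v \<notin> set xs" if "v \<in> ?I" for v
      using that vertex_off_cycle[OF d cyc, of v] inside_no_overlap unfolding inner_vertices_def by blast
    then show ?thesis by blast
  qed
  show ?case
  proof (cases "\<exists>a b Q. a \<in> set xs \<and> b \<in> set xs \<and> a \<noteq> b \<and> distinct Q \<and> set Q \<subseteq> ?I \<and> path_edges (a # Q @ [b]) \<subseteq> ?E")
    case True
    then obtain a b Q where Q: "a \<in> set xs" "b \<in> set xs" "a \<noteq> b" "distinct Q" "set Q \<subseteq> ?I"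
      "path_edges (a # Q @ [b]) \<subseteq> ?E" by blast
    obtain A B where AB: "is_cycle V E (a # A @ b # B)" "cycle_edges (a # A @ b # B) = cycle_edges xs"
      "length (a # A @ b # B) = length xs"
      using cycle_rotate_to[OF cyc Q(1-3)] by metis
    have eq: "inner_edges E \<gamma> (a # A @ b # B) = ?E" "inner_vertices V p \<gamma> (a # A @ b # B) = ?I"
      unfolding inner_edges_def inner_vertices_def AB(2) by auto
    have "(g - 2) * card (inner_edges E \<gamma> (a # A @ b # B)) + g
     \<le> g * card (inner_vertices V p \<gamma> (a # A @ b # B)) + length (a # A @ b # B)"
    proof (rule inner_split[OF d AB(1) g2 Q(4)], unfold eq)
      fix ys assume ys: "is_cycle V E ys" "inner_vertices V p \<gamma> ys \<subseteq> ?I" "inner_edges E \<gamma> ys \<subset> ?E"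
      have "card (inner_edges E \<gamma> ys) < card ?E" using ys(3) finite_inner(1)[OF d] by (rule psubset_card_mono[rotated])
      moreover have "card (inner_vertices V p \<gamma> ys) + 1 < N"
        using card_mono[OF finite_inner(2)[OF d] ys(2)] N by simp
      ultimately show "(g - 2) * card (inner_edges E \<gamma> ys) + g \<le> g * card (inner_vertices V p \<gamma> ys) + length ys"
        using less.hyps[OF _ d gir ys(1) sp g2] by blast
    qed (use Q in auto)
    then show ?thesis unfolding eq AB(3) .
  next
    case nosplit: False
    show ?thesis
    proof (cases "\<exists>c\<in>set xs. \<exists>w\<in>?I. {c, w} \<in> E")
      case True
      then obtain c w0 where c: "c \<in> set xs" "w0 \<in> ?I" "{c, w0} \<in> E" by blast
      define K where "K = reach_through ?I E c"
      define F where "F = {e\<in>E. e \<inter> K \<noteq> {}}"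
      have KI: "K \<subseteq> ?I" unfolding K_def reach_through_def by auto
      have w0: "w0 \<in> K" unfolding K_def reach_through_def using c by (auto intro!: exI[of _ "[]"])
      have FE: "F \<subseteq> ?E" using inner_vertex_edge[OF d cyc] KI unfolding F_def by blast
      have Fsub: "e \<subseteq> insert c K" if eF: "e \<in> F" for e
      proof -
        obtain w where w: "w \<in> e" "w \<in> K" "e \<in> E" using eF unfolding F_def by blast
        obtain y where y: "y \<in> V" "e = {w, y}" using graph_edges_other[OF drawing_graph[OF d] w(3,1)] by metis
        have "y \<in> ?I \<or> y \<in> set xs" using inner_edge_vertex[OF d cyc, of e y] FE eF y by blast
        then show ?thesis
        proof
          assume "y \<in> ?I"
          then have "y \<in> K" using reach_through_step[of w ?I E c y] w y unfolding K_def by blast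
          then show ?thesis using w y by blast
        next
          assume yx: "y \<in> set xs"
          \<comment> \<open>A second attachment vertex would give an inner path between two cycle
            vertices, which is excluded in this case.\<close>
          have "y = c"
          proof (rule ccontr)
            assume "y \<noteq> c"
            obtain Q where Q: "distinct (Q @ [w])" "set (Q @ [w]) \<subseteq> ?I" "path_edges (c # Q @ [w]) \<subseteq> E"
              using w(2) unfolding K_def reach_through_def by auto
            have "path_edges (c # (Q @ [w]) @ [y]) \<subseteq> E"
              using path_edges_snoc[of "c # Q @ [w]" y] Q(3) w y by auto
            \<comment> \<open>Every edge of the path has an end inside: the only other possibility
              is \<open>{c, y}\<close>, and the path has an inner vertex.\<close>
            moreover have "f \<inter> ?I \<noteq> {}" if "f \<in> path_edges (c # (Q @ [w]) @ [y])" for f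
            proof -
              have "f \<subseteq> set (c # (Q @ [w]) @ [y])" "f \<in> E"
                using that path_edges_subset[OF that] \<open>path_edges (c # (Q @ [w]) @ [y]) \<subseteq> E\<close> by blast+
              moreover obtain s t where "f = {s,t}" "s \<noteq> t"
                using \<open>f \<in> E\<close> drawing_graph[OF d] unfolding graph_edges_def by blast
              moreover have "f \<noteq> {c, y}"
                using path_edges_ends[of c "Q @ [w]" y] that Q(1,2) Ixs c(1) yx \<open>y \<noteq> c\<close> by auto
              ultimately show ?thesis using Q(2) by auto
            qed
            ultimately have "path_edges (c # (Q @ [w]) @ [y]) \<subseteq> ?E"
              using inner_vertex_edge[OF d cyc] by blast
            then show False using nosplit Q(1,2) c(1) yx \<open>y \<noteq> c\<close> by blast
          qed
          then show ?thesis using w y by blast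
        qed
      qed
      have finK: "finite K" using KI finite_inner(2)[OF d] finite_subset by blast
      have cK: "c \<notin> K" using KI Ixs c(1) by blast
      have cV: "c \<in> V" using cyc c(1) by (auto simp: is_cycle_def)
      have dK: "drawing (insert c K) F p \<gamma>"
        by (rule drawing_subset[OF d]) (use KI IV cV Fsub in \<open>auto simp: F_def\<close>)
      have "girth_ge g (insert c K) F"
        by (rule girth_ge_subgraph[OF gir]) (use KI IV cV in \<open>auto simp: F_def\<close>)
      moreover have "card (insert c K) < N"
        using card_mono[OF finite_inner(2)[OF d] KI] N finK cK by simp
      \<comment> \<open>The extra vertex \<open>c\<close> costs \<open>g\<close>, which the constant
        \<open>g\<close> of the bound returns; the part is charged only
        \<open>g * card K\<close>.\<close>
      ultimately have bK: "(g - 2) * card F + g \<le> g * (card K + 1)"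
        using sp dK finK cK unfolding sparse_below_def by fastforce
      have d': "drawing (V - K) (E - F) p \<gamma>"
        by (rule drawing_subset[OF d]) (use graph_edges_vertex[OF drawing_graph[OF d]] in \<open>auto simp: F_def\<close>)
      have gir': "girth_ge g (V - K) (E - F)" by (rule girth_ge_subgraph[OF gir]) auto
      have cyc': "is_cycle (V - K) (E - F) xs"
        using cyc KI Ixs cycle_edges_subset unfolding is_cycle_def F_def by blast
      have eqE: "inner_edges (E - F) \<gamma> xs = ?E - F" and eqI: "inner_vertices (V - K) p \<gamma> xs = ?I - K"
        unfolding inner_edges_def inner_vertices_def by auto
      have "{c, w0} \<in> F" using c w0 by (auto simp: F_def)
      then have "card (?E - F) < card ?E" using FE finite_inner(1)[OF d] by (intro psubset_card_mono) auto
      moreover have "card (?I - K) + 1 < N"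
        using card_mono[OF finite_inner(2)[OF d], of "?I - K"] N by (meson Diff_subset add_le_mono1 le_less_trans)
      ultimately have IH: "(g - 2) * card (?E - F) + g \<le> g * card (?I - K) + length xs"
        using less.hyps[OF _ d' gir' cyc' sp g2] unfolding eqE eqI by blast
      have "card ?E = card (?E - F) + card F"
        using FE finite_inner(1)[OF d] by (metis card_Diff_subset card_mono finite_subset le_add_diff_inverse2)
      moreover have "card ?I = card (?I - K) + card K"
        using KI finite_inner(2)[OF d] by (metis card_Diff_subset card_mono finite_subset le_add_diff_inverse2)
      ultimately show ?thesis using IH bK by (simp add: algebra_simps)
    next
      case noatt: False
      have sub: "e \<subseteq> ?I" if e: "e \<in> ?E" for e
      proof -
        have eE: "e \<in> E" using e by (simp add: inner_edges_def)
        then obtain s t where st: "e = {s,t}" "s \<noteq> t" using drawing_graph[OF d] unfolding graph_edges_def by blast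
        have "s \<in> ?I \<or> s \<in> set xs" "t \<in> ?I \<or> t \<in> set xs"
          using inner_edge_vertex[OF d cyc e] st by blast+
        moreover have "\<not> (s \<in> set xs \<and> t \<in> ?I)" "\<not> (t \<in> set xs \<and> s \<in> ?I)"
          using noatt eE st by (auto simp: insert_commute)
        moreover have "\<not> (s \<in> set xs \<and> t \<in> set xs)"
        proof
          assume "s \<in> set xs \<and> t \<in> set xs"
          moreover have "path_edges (s # [] @ [t]) \<subseteq> ?E" using e st by simp
          moreover have "distinct ([]::'a list)" "set [] \<subseteq> ?I" by auto
          ultimately show False using nosplit st(2) by blast
        qed
        ultimately show ?thesis using st by blast
      qed
      \<comment> \<open>Without inner edges the claim rests on \<open>g \<le> length xs\<close>;
        here the girth enters directly.\<close>
      have gl: "g \<le> length xs" using gir cyc by (auto simp: girth_ge_def)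
      show ?thesis
      proof (cases "?E = {}")
        case False
        then obtain e where "e \<in> ?E" by blast
        moreover then have "e \<noteq> {}" using drawing_graph[OF d] by (auto simp: graph_edges_def inner_edges_def)
        ultimately have "?I \<noteq> {}" using sub by blast
        moreover have "drawing ?I ?E p \<gamma>"
          by (rule drawing_subset[OF d IV]) (use sub in \<open>auto simp: inner_edges_def\<close>)
        moreover have "girth_ge g ?I ?E" by (rule girth_ge_subgraph[OF gir IV]) (auto simp: inner_edges_def)
        ultimately have "(g - 2) * card ?E + g \<le> g * card ?I"
          using sp N unfolding sparse_below_def by auto
        then show ?thesis by simp
      qed (use gl in simp)
    qed
  qed
qed

section \<open>Inversion of the plane, exchanging the two sides of a cycle\<close>

lemma drawing_map:
  assumes d: "drawing V E p \<gamma>" and inj: "inj \<phi>" and con: "continuous_on (edge_image \<gamma> E) \<phi>"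
  shows "drawing V E (\<phi> \<circ> p) (\<lambda>e. \<phi> \<circ> \<gamma> e)"
  unfolding drawing_def
proof (intro conjI ballI impI)
  show "graph_edges V E" by (rule drawing_graph[OF d])
  show "inj_on (\<phi> \<circ> p) V" using drawing_inj[OF d] inj by (meson comp_inj_on inj_on_subset subset_UNIV)
  fix e assume e: "e \<in> E"
  note a = drawing_arc[OF d e]
  have "continuous_on (path_image (\<gamma> e)) \<phi>"
    using con by (rule continuous_on_subset) (use e in \<open>auto simp: edge_image_def\<close>)
  then have "path (\<phi> \<circ> \<gamma> e)" using a by (intro path_continuous_image) (auto simp: arc_def)
  moreover have "inj_on (\<phi> \<circ> \<gamma> e) {0..1}"
    using a inj unfolding arc_def by (meson comp_inj_on inj_on_subset subset_UNIV)
  ultimately show "arc (\<phi> \<circ> \<gamma> e)" by (simp add: arc_def)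
  have "{pathstart (\<phi> \<circ> \<gamma> e), pathfinish (\<phi> \<circ> \<gamma> e)} = \<phi> ` {pathstart (\<gamma> e), pathfinish (\<gamma> e)}"
    by (simp add: pathstart_compose pathfinish_compose)
  also have "\<dots> = (\<phi> \<circ> p) ` e" unfolding drawing_ends[OF d e] by (simp add: image_comp)
  finally show "{pathstart (\<phi> \<circ> \<gamma> e), pathfinish (\<phi> \<circ> \<gamma> e)} = (\<phi> \<circ> p) ` e" .
  show "v \<in> e" if "v \<in> V" "(\<phi> \<circ> p) v \<in> path_image (\<phi> \<circ> \<gamma> e)" for v
    using drawing_vertex[OF d e that(1)] that(2) inj_image_mem_iff[OF inj] by (simp add: path_image_compose)
  show "path_image (\<phi> \<circ> \<gamma> e) \<inter> path_image (\<phi> \<circ> \<gamma> e') \<subseteq> (\<phi> \<circ> p) ` (e \<inter> e')"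
    if "e' \<in> E" "e \<noteq> e'" for e'
    unfolding path_image_compose image_Int[OF inj, symmetric] image_comp[symmetric]
    using drawing_Int[OF d e that] by (rule image_mono)
qed

text \<open>Otherwise the image of the outside would lie outside \<open>J'\<close>, and so would the
  image of the punctured inside, which is unbounded near \<open>a\<close>. The inside of
  \<open>J'\<close> would then contain at most the point 0, but it is open and nonempty.\<close>

lemma inverse_outside_inside:
  fixes J :: "complex set" and a :: complex
  defines "\<phi> \<equiv> \<lambda>z. inverse (z - a)"
  assumes a: "a \<in> inside J" and opi: "open (inside J)" and coi: "connected (inside J)"
    and coo: "connected (outside J)"
    and un: "inside J \<union> outside J = - J"
    and J': "J' = \<phi> ` J" "inside J' \<noteq> {}" "open (inside J')" "open (outside J')" "bounded (inside J')"
      "inside J' \<inter> outside J' = {}" "inside J' \<union> outside J' = - J'"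
    and z: "z \<in> outside J"
  shows "\<phi> z \<in> inside J'"
proof (rule ccontr)
  assume nz: "\<phi> z \<notin> inside J'"
  \<comment> \<open>Since \<open>inverse 0 = 0\<close>, the point \<open>a\<close> goes to 0, a
    value not taken elsewhere; so the map is injective on the whole plane.\<close>
  have inj: "inj \<phi>" by (auto simp: \<phi>_def inj_def)
  have cont: "continuous_on S \<phi>" if "a \<notin> S" for S
    unfolding \<phi>_def using that by (auto intro!: continuous_intros)
  have io: "inside J \<inter> outside J = {}" by (rule inside_Int_outside)
  have side: "\<phi> ` S \<subseteq> inside J' \<or> \<phi> ` S \<subseteq> outside J'" if "connected S" "a \<notin> S" "S \<inter> J = {}" for S
  proof -
    have c: "connected (\<phi> ` S)" using cont[OF that(2)] that(1) by (rule connected_continuous_image)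
    have "\<phi> ` S \<inter> J' = {}" unfolding J'(1) using that(3) inj by (auto dest: injD)
    then have "\<phi> ` S \<subseteq> inside J' \<union> outside J'" using J'(7) by blast
    then show ?thesis using connectedD[OF c J'(3,4)] J'(6) by blast
  qed
  have "outside J \<inter> J = {}" using outside_no_overlap by blast
  then have o: "\<phi> ` outside J \<subseteq> outside J'"
    using side[OF coo] a io nz z by blast
  have "connected (inside J - {a})"
    by (rule connected_open_delete[OF opi coi]) simp
  then have s: "\<phi> ` (inside J - {a}) \<subseteq> inside J' \<or> \<phi> ` (inside J - {a}) \<subseteq> outside J'"
    by (rule side) (use inside_no_overlap[of J] in \<open>blast+\<close>)
  obtain \<epsilon> where \<epsilon>: "\<epsilon> > 0" "ball a \<epsilon> \<subseteq> inside J" using opi a openE by blast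
  obtain B where B: "B > 0" "\<And>w. w \<in> inside J' \<Longrightarrow> norm w \<le> B" using J'(5) bounded_pos by blast
  \<comment> \<open>The point at distance \<open>r\<close> from \<open>a\<close> is still inside
    \<open>J\<close>, and its image has norm at least \<open>B + 1\<close>.\<close>
  define r where "r = min (\<epsilon> / 2) (inverse (B + 1))"
  have r: "r > 0" "r < \<epsilon>" "r \<le> inverse (B + 1)" using \<epsilon>(1) B(1) by (auto simp: r_def)
  have "inverse (inverse (B + 1)) \<le> inverse r" by (rule le_imp_inverse_le[OF r(3,1)])
  then have "norm (\<phi> (a + of_real r)) > B" using r B(1) by (simp add: \<phi>_def norm_inverse)
  then have "\<phi> (a + of_real r) \<notin> inside J'" using B(2) by fastforce
  moreover have "a + of_real r \<in> inside J - {a}" using r \<epsilon>(2) by (auto simp: dist_norm)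
  ultimately have i: "\<phi> ` (inside J - {a}) \<subseteq> outside J'" using s by blast
  have "inside J' \<subseteq> {0}"
  proof
    fix w assume w: "w \<in> inside J'"
    show "w \<in> {0}"
    proof (rule ccontr)
      assume "w \<notin> {0}"
      define y where "y = a + inverse w"
      have y: "\<phi> y = w" "y \<noteq> a" using \<open>w \<notin> {0}\<close> by (auto simp: y_def \<phi>_def)
      have "w \<notin> J'" using w inside_no_overlap by blast
      then have "y \<notin> J" using y(1) J'(1) by blast
      then have "y \<in> inside J - {a} \<or> y \<in> outside J" using un y(2) by blast
      then have "w \<in> outside J'" using o i y(1) by blast
      then show False using w J'(6) by blast
    qed
  qed
  then have "inside J' = {0}" using J'(2) by blast
  then show False using J'(3) not_open_singleton by metis
qed

definition outer_edges :: "'a set set \<Rightarrow> ('a set \<Rightarrow> real \<Rightarrow> complex) \<Rightarrow> 'a list \<Rightarrow> 'a set set" where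
  "outer_edges E \<gamma> xs = {e\<in>E. edge_mid \<gamma> e \<in> outside (edge_image \<gamma> (cycle_edges xs))}"

definition outer_vertices ::
  "'a set \<Rightarrow> ('a \<Rightarrow> complex) \<Rightarrow> ('a set \<Rightarrow> real \<Rightarrow> complex) \<Rightarrow> 'a list \<Rightarrow> 'a set" where
  "outer_vertices V p \<gamma> xs = {v\<in>V. p v \<in> outside (edge_image \<gamma> (cycle_edges xs))}"

lemma outer_edge_subset:
  assumes d: "drawing V E p \<gamma>" and cyc: "is_cycle V E xs" and e: "e \<in> outer_edges E \<gamma> xs"
  shows "path_image (\<gamma> e) - edge_image \<gamma> (cycle_edges xs) \<subseteq> outside (edge_image \<gamma> (cycle_edges xs))"
    "e \<subseteq> outer_vertices V p \<gamma> xs \<union> set xs"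
proof -
  let ?J = "edge_image \<gamma> (cycle_edges xs)"
  have mid: "edge_mid \<gamma> e \<in> outside ?J" "e \<in> E" using e by (auto simp: outer_edges_def)
  then have nJ: "edge_mid \<gamma> e \<notin> ?J" using outside_no_overlap by blast
  then have "e \<notin> cycle_edges xs" using edge_mid_in by (auto simp: edge_image_def)
  moreover have "edge_mid \<gamma> e \<notin> inside ?J" using mid inside_Int_outside by blast
  ultimately show sub: "path_image (\<gamma> e) - ?J \<subseteq> outside ?J"
    using edge_off_cycle[OF d cyc mid(2)] edge_mid_in nJ by blast
  show "e \<subseteq> outer_vertices V p \<gamma> xs \<union> set xs"
  proof
    fix v assume v: "v \<in> e"
    have vV: "v \<in> V" by (rule graph_edges_vertex[OF drawing_graph[OF d] mid(2) v])
    show "v \<in> outer_vertices V p \<gamma> xs \<union> set xs"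
    proof (cases "v \<in> set xs")
      case False
      then have "p v \<notin> ?J" using vertex_off_cycle[OF d cyc vV] by blast
      then have "p v \<in> outside ?J" using sub drawing_vertex_in_edge[OF d mid(2) v] by blast
      then show ?thesis using vV by (auto simp: outer_vertices_def)
    qed auto
  qed
qed

text \<open>The inner edges are dropped first: the centre of the inversion lies inside the cycle and
  must avoid all arcs that are mapped.\<close>

lemma invert_drawing:
  assumes d: "drawing V E p \<gamma>" and cyc: "is_cycle V E xs"
  defines "Eo \<equiv> outer_edges E \<gamma> xs" and "Vo \<equiv> outer_vertices V p \<gamma> xs"
  obtains p' \<gamma>' where "drawing (Vo \<union> set xs) (Eo \<union> cycle_edges xs) p' \<gamma>'"
    "is_cycle (Vo \<union> set xs) (Eo \<union> cycle_edges xs) xs"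
    "Eo \<subseteq> inner_edges (Eo \<union> cycle_edges xs) \<gamma>' xs"
    "inner_vertices (Vo \<union> set xs) p' \<gamma>' xs \<subseteq> Vo"
proof -
  let ?J = "edge_image \<gamma> (cycle_edges xs)" let ?V = "Vo \<union> set xs" let ?E = "Eo \<union> cycle_edges xs"
  note io = cycle_inside_outside[OF d cyc]
  obtain a where a: "a \<in> inside ?J" using io(1) by blast
  define \<phi> where "\<phi> = (\<lambda>z. inverse (z - a))"
  have inj: "inj \<phi>" by (auto simp: \<phi>_def inj_def)
  have cyc': "is_cycle ?V ?E xs" using cyc by (auto simp: is_cycle_def)
  have d': "drawing ?V ?E p \<gamma>"
  proof (rule drawing_subset[OF d])
    show "?V \<subseteq> V" "?E \<subseteq> E" using cyc by (auto simp: Vo_def Eo_def outer_vertices_def outer_edges_def is_cycle_def)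
    show "e \<subseteq> ?V" if "e \<in> ?E" for e
      using that outer_edge_subset(2)[OF d cyc, of e] cycle_edges_subset[of e xs] unfolding Eo_def Vo_def by blast
  qed
  have an: "a \<notin> edge_image \<gamma> ?E"
  proof
    assume "a \<in> edge_image \<gamma> ?E"
    moreover have nJ: "a \<notin> ?J" using a inside_no_overlap by blast
    ultimately obtain e where "e \<in> Eo" "a \<in> path_image (\<gamma> e)" by (auto simp: edge_image_def)
    then have "a \<in> outside ?J" using outer_edge_subset(1)[OF d cyc, of e] nJ unfolding Eo_def by blast
    then show False using a inside_Int_outside by blast
  qed
  have con: "continuous_on (edge_image \<gamma> ?E) \<phi>"
    unfolding \<phi>_def using an by (auto intro!: continuous_intros)
  define p' \<gamma>' where "p' = \<phi> \<circ> p" and "\<gamma>' = (\<lambda>e. \<phi> \<circ> \<gamma> e)"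
  have dr: "drawing ?V ?E p' \<gamma>'" unfolding p'_def \<gamma>'_def by (rule drawing_map[OF d' inj con])
  define J' where "J' = edge_image \<gamma>' (cycle_edges xs)"
  have J': "J' = \<phi> ` ?J" by (auto simp: J'_def edge_image_def \<gamma>'_def path_image_compose)
  note io' = cycle_inside_outside[OF dr cyc', folded J'_def]
  have out: "\<phi> z \<in> inside J'" if "z \<in> outside ?J" for z
    unfolding \<phi>_def
    by (rule inverse_outside_inside[OF a io(2,3,5,9) J'[unfolded \<phi>_def] io'(1,2,4,6,8,9) that])
  show ?thesis
  proof (rule that[OF dr cyc'])
    show "Eo \<subseteq> inner_edges ?E \<gamma>' xs"
      using out unfolding inner_edges_def Eo_def outer_edges_def J'_def[symmetric] edge_mid_def
      by (auto simp: \<gamma>'_def)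
    show "inner_vertices ?V p' \<gamma>' xs \<subseteq> Vo"
    proof
      fix v assume v: "v \<in> inner_vertices ?V p' \<gamma>' xs"
      then have "v \<notin> set xs"
        using vertex_off_cycle[OF dr cyc', of v] inside_no_overlap unfolding inner_vertices_def by blast
      then show "v \<in> Vo" using v by (auto simp: inner_vertices_def)
    qed
  qed
qed

lemma graph_edges_small:
  assumes "graph_edges V E" "card V \<le> 2"
  shows "card E \<le> 1"
proof -
  have fin: "finite V" using assms(1) by (simp add: graph_edges_def)
  have "e = V" if "e \<in> E" for e
  proof -
    obtain u v where uv: "e = {u,v}" "u \<noteq> v" "u \<in> V" "v \<in> V"
      using assms(1) \<open>e \<in> E\<close> unfolding graph_edges_def by blast
    then have "card e = 2" "e \<subseteq> V" by auto
    then show ?thesis using assms(2) card_seteq[OF fin] by simp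
  qed
  then have "E \<subseteq> {V}" by blast
  then show ?thesis using card_mono[of "{V}" E] by simp
qed

text \<open>The bounds for the two sides of a cycle of length c add up to \<open>2 * g\<close> on
  the left and 2c on the right; the c cycle edges bring a further (g - 2)c, and (g - 2)c + 2c = gc
  gives the Euler bound. Vertices of degree at most one are deleted beforehand. The restriction on
  \<open>g\<close> is natural: the path on three vertices satisfies the sharper bound only for
  \<open>g \<le> 4\<close>.\<close>

lemma plane_edge_bound:
  assumes "drawing V E p \<gamma>" "girth_ge g V E" "g = 3 \<or> g = 4" "V \<noteq> {}"
  shows "(g - 2) * card E + g \<le> g * card V \<and> (3 \<le> card V \<longrightarrow> (g - 2) * card E + 2 * g \<le> g * card V)"
  using assms
proof (induction "card V" arbitrary: V E p \<gamma> rule: less_induct)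
  case less
  note d = less.prems(1) and gir = less.prems(2) and g = less.prems(3) and ne = less.prems(4)
  note gr = drawing_graph[OF d]
  have fin: "finite V" "finite E" using gr graph_edges_finite by (auto simp: graph_edges_def)
  \<comment> \<open>The hypothesis must be available for other drawings as well, since the outer
    side is measured in the inverted one.\<close>
  have sp: "sparse_below (card V) g p' \<gamma>'" for p' :: "'a \<Rightarrow> complex" and \<gamma>'
    unfolding sparse_below_def using less.hyps g by blast
  have pos: "card V \<ge> 1" using fin(1) ne by (simp add: Suc_leI card_gt_0_iff)
  have small: "card E \<le> 1" if "card V \<le> 2" using graph_edges_small[OF gr that] .
  have none: "E = {}" if "card V = 1"
  proof (rule ccontr)
    assume "E \<noteq> {}"
    then obtain u v where "u \<noteq> v" "u \<in> V" "v \<in> V" using gr unfolding graph_edges_def by blast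
    then show False using that card_1_singletonE[of V] by (metis singletonD)
  qed
  have big: "(g - 2) * card E + 2 * g \<le> g * card V" if n3: "3 \<le> card V"
  proof (cases "\<exists>v\<in>V. card {e\<in>E. v \<in> e} \<le> 1")
    case True
    then obtain v where v: "v \<in> V" "card {e\<in>E. v \<in> e} \<le> 1" by blast
    let ?V = "V - {v}" let ?E = "{e\<in>E. v \<notin> e}"
    have cV: "card V = card ?V + 1" using v(1) fin(1) pos by simp
    have "E = ?E \<union> {e\<in>E. v \<in> e}" by blast
    then have "card E \<le> card ?E + card {e\<in>E. v \<in> e}" by (metis card_Un_le)
    then have cE: "card E \<le> card ?E + 1" using v(2) by simp
    have d': "drawing ?V ?E p \<gamma>"
      by (rule drawing_subset[OF d]) (use graph_edges_vertex[OF gr] in auto)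
    have gir': "girth_ge g ?V ?E" by (rule girth_ge_subgraph[OF gir]) auto
    have ne': "?V \<noteq> {}"
    proof
      assume "?V = {}"
      then have "card ?V = 0" by (simp only: card.empty)
      then show False using n3 cV by linarith
    qed
    have lt: "card ?V < card V" using cV by simp
    note IH = less.hyps[OF lt d' gir' g ne']
    show ?thesis
    proof (cases "card V = 3")
      case True
      have "card ?E \<le> 1"
        by (rule graph_edges_small[OF drawing_graph[OF d']]) (use True cV in linarith)
      then have "card E \<le> 2" using cE by simp
      then show ?thesis using g True by auto
    next
      case False
      then have "3 \<le> card ?V" using n3 cV by simp
      then have b: "(g - 2) * card ?E + 2 * g \<le> g * card ?V" using IH by blast
      show ?thesis using g
      proof
        assume "g = 3" then show ?thesis using b cE cV by simp
      next
        assume "g = 4" then show ?thesis using b cE cV by simp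
      qed
    qed
  next
    case False
    have "2 \<le> card {e\<in>E. v \<in> e}" if "v \<in> V" for v using False that by force
    then obtain xs where cyc: "is_cycle V E xs" using min_degree_two_cycle[OF gr ne] by blast
    let ?Ei = "inner_edges E \<gamma> xs" let ?Eo = "outer_edges E \<gamma> xs"
    let ?Vi = "inner_vertices V p \<gamma> xs" let ?Vo = "outer_vertices V p \<gamma> xs"
    have len: "length xs \<ge> 3" "card (set xs) = length xs" "set xs \<subseteq> V"
      using cyc distinct_card by (auto simp: is_cycle_def)
    note io = cycle_inside_outside[OF d cyc]
    have Vdisj: "?Vi \<inter> ?Vo = {}" "(?Vi \<union> ?Vo) \<inter> set xs = {}"
    proof -
      show "?Vi \<inter> ?Vo = {}" using io(8) unfolding inner_vertices_def outer_vertices_def by blast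
      have "v \<notin> set xs" if "v \<in> ?Vi \<union> ?Vo" for v
        using that vertex_off_cycle[OF d cyc, of v] inside_no_overlap outside_no_overlap
        unfolding inner_vertices_def outer_vertices_def by blast
      then show "(?Vi \<union> ?Vo) \<inter> set xs = {}" by blast
    qed
    have finVo: "finite ?Vo" "finite ?Vi" using fin(1) by (auto simp: outer_vertices_def inner_vertices_def)
    have "card ?Vi + card ?Vo + length xs = card (?Vi \<union> ?Vo \<union> set xs)"
      using Vdisj finVo len(2) by (simp add: card_Un_disjoint)
    also have "\<dots> \<le> card V"
      by (rule card_mono[OF fin(1)]) (use len(3) in \<open>auto simp: outer_vertices_def inner_vertices_def\<close>)
    finally have cV: "card ?Vi + card ?Vo + length xs \<le> card V" .
    have "E \<subseteq> cycle_edges xs \<union> (?Ei \<union> ?Eo)"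
    proof
      fix e assume e: "e \<in> E"
      show "e \<in> cycle_edges xs \<union> (?Ei \<union> ?Eo)"
      proof (cases "e \<in> cycle_edges xs")
        case False
        have "edge_mid \<gamma> e \<notin> edge_image \<gamma> (cycle_edges xs)"
          by (rule edge_mid_notin[OF d e _ False]) (use cyc in \<open>auto simp: is_cycle_def\<close>)
        then show ?thesis using io(9) e unfolding inner_edges_def outer_edges_def by blast
      qed auto
    qed
    then have "card E \<le> card (cycle_edges xs \<union> (?Ei \<union> ?Eo))"
      by (rule card_mono[rotated]) (use fin(2) in \<open>auto simp: inner_edges_def outer_edges_def\<close>)
    also have "\<dots> \<le> card (cycle_edges xs) + (card ?Ei + card ?Eo)"
      by (meson card_Un_le add_left_mono le_trans)
    finally have cE: "card E \<le> length xs + (card ?Ei + card ?Eo)"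
      using card_cycle_edges_le[of xs] by linarith
    have g2: "2 \<le> g" using g by auto
    \<comment> \<open>The cycle has at least three vertices, which leaves room for the extra vertex
      in the size condition.\<close>
    have bi: "(g - 2) * card ?Ei + g \<le> g * card ?Vi + length xs"
      by (rule inner_edges_bound[OF d gir cyc sp g2]) (use cV len(1) in simp)
    obtain p' \<gamma>' where inv: "drawing (?Vo \<union> set xs) (?Eo \<union> cycle_edges xs) p' \<gamma>'"
      "is_cycle (?Vo \<union> set xs) (?Eo \<union> cycle_edges xs) xs"
      "?Eo \<subseteq> inner_edges (?Eo \<union> cycle_edges xs) \<gamma>' xs"
      "inner_vertices (?Vo \<union> set xs) p' \<gamma>' xs \<subseteq> ?Vo"
      by (rule invert_drawing[OF d cyc])
    have gir': "girth_ge g (?Vo \<union> set xs) (?Eo \<union> cycle_edges xs)"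
      by (rule girth_ge_subgraph[OF gir]) (use cyc in \<open>auto simp: outer_vertices_def outer_edges_def is_cycle_def\<close>)
    have cm: "card (inner_vertices (?Vo \<union> set xs) p' \<gamma>' xs) \<le> card ?Vo"
      "card ?Eo \<le> card (inner_edges (?Eo \<union> cycle_edges xs) \<gamma>' xs)"
      using card_mono[OF finVo(1) inv(4)] card_mono[OF finite_inner(1)[OF inv(1)] inv(3)] by auto
    have "(g - 2) * card (inner_edges (?Eo \<union> cycle_edges xs) \<gamma>' xs) + g
        \<le> g * card (inner_vertices (?Vo \<union> set xs) p' \<gamma>' xs) + length xs"
      by (rule inner_edges_bound[OF inv(1) gir' inv(2) sp g2]) (use cV cm(1) len(1) in simp)
    moreover have "(g - 2) * card ?Eo \<le> (g - 2) * card (inner_edges (?Eo \<union> cycle_edges xs) \<gamma>' xs)"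
      using cm(2) by simp
    moreover have "g * card (inner_vertices (?Vo \<union> set xs) p' \<gamma>' xs) \<le> g * card ?Vo" using cm(1) by simp
    ultimately have bo: "(g - 2) * card ?Eo + g \<le> g * card ?Vo + length xs" by linarith
    show ?thesis using g
    proof
      assume "g = 3" then show ?thesis using bi bo cE cV by simp
    next
      assume "g = 4" then show ?thesis using bi bo cE cV by simp
    qed
  qed
  have "(g - 2) * card E + g \<le> g * card V"
  proof (cases "3 \<le> card V")
    case True
    then show ?thesis using big by simp
  next
    case False
    then consider "card V = 1" | "card V = 2" using pos by linarith
    then show ?thesis
    proof cases
      case 1
      then show ?thesis using none by simp
    next
      case 2
      then have "card E \<le> 1" using small by simp
      then show ?thesis using 2 g by auto
    qed
  qed
  then show ?case using big by blast
qed

section \<open>Consequences of the edge bound for common neighbourhoods\<close>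

definition nbrs :: "'a set \<Rightarrow> 'a set set \<Rightarrow> 'a \<Rightarrow> 'a set" where
  "nbrs V E v = {u\<in>V. {u, v} \<in> E}"

lemma card_path_edges: "distinct xs \<Longrightarrow> card (path_edges xs) = length xs - 1"
proof (induction xs rule: path_edges.induct)
  case (1 x y zs)
  have "{x,y} \<notin> path_edges (y # zs)" using path_edges_subset[of "{x,y}" "y # zs"] 1(2) by auto
  then show ?case using 1 by simp
qed auto

lemma card_cycle_edges:
  assumes "distinct xs" "length xs \<ge> 3"
  shows "card (cycle_edges xs) = length xs"
proof -
  obtain a b z zs where xs: "xs = a # b # z # zs"
    using assms(2) by (auto simp: numeral_3_eq_3 Suc_le_length_iff)
  have "{a,b} \<notin> path_edges (b # (z # zs) @ [a])"
    using path_edges_ends[of b "z # zs" a] assms(1) xs by (auto simp: insert_commute)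
  moreover have "card (path_edges (b # (z # zs) @ [a])) = length xs - 1"
    by (subst card_path_edges) (use assms(1) xs in auto)
  moreover have "cycle_edges xs = insert {a,b} (path_edges (b # (z # zs) @ [a]))"
    by (simp add: cycle_edges_def xs)
  ultimately show ?thesis using xs by simp
qed

lemma plane_card_edges:
  assumes "drawing V E p \<gamma>"
  shows "card E \<le> 3 * card V" "3 \<le> card V \<Longrightarrow> card E + 6 \<le> 3 * card V"
proof -
  have "girth_ge 3 V E" by (simp add: girth_ge_def is_cycle_def)
  then have *: "V \<noteq> {} \<Longrightarrow> card E + 3 \<le> 3 * card V \<and> (3 \<le> card V \<longrightarrow> card E + 6 \<le> 3 * card V)"
    using plane_edge_bound[OF assms, of 3] by simp
  show "3 \<le> card V \<Longrightarrow> card E + 6 \<le> 3 * card V" using * by fastforce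
  show "card E \<le> 3 * card V"
  proof (cases "V = {}")
    case True
    then have "E = {}" using drawing_graph[OF assms] by (auto simp: graph_edges_def)
    then show ?thesis by simp
  qed (use * in simp)
qed

lemma plane_induced_card_edges:
  assumes "drawing V E p \<gamma>" "S \<subseteq> V"
  shows "card {e\<in>E. e \<subseteq> S} \<le> 3 * card S"
  by (rule plane_card_edges, rule drawing_subset[OF assms]) auto

text \<open>A bipartite graph has no triangle, so the bound for \<open>g = 4\<close> applies, and
  \<open>2 * 9 + 8 > 4 * 6\<close>.\<close>

lemma plane_no_K33:
  assumes d: "drawing V E p \<gamma>" and AB: "A \<inter> B = {}" "card A = 3" "card B = 3" "A \<union> B \<subseteq> V"
    and e: "\<And>a b. a \<in> A \<Longrightarrow> b \<in> B \<Longrightarrow> {a, b} \<in> E"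
  shows False
proof -
  define F where "F = (\<lambda>(a, b). {a, b}) ` (A \<times> B)"
  have fin: "finite A" "finite B" using AB by (auto intro: card_ge_0_finite)
  have F: "f \<in> F \<longleftrightarrow> (\<exists>a\<in>A. \<exists>b\<in>B. f = {a,b})" for f by (auto simp: F_def)
  have "inj_on (\<lambda>(a, b). {a, b}) (A \<times> B)" using AB(1) by (auto simp: inj_on_def doubleton_eq_iff)
  then have cF: "card F = 9" unfolding F_def using AB by (simp add: card_image card_cartesian_product)
  have dF: "drawing (A \<union> B) F p \<gamma>" by (rule drawing_subset[OF d AB(4)]) (use e in \<open>auto simp: F_def\<close>)
  have cross: "x \<in> A \<longleftrightarrow> y \<notin> A" if "{x,y} \<in> F" for x y
    using that AB(1) unfolding F by (auto simp: doubleton_eq_iff)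
  have gir: "girth_ge 4 (A \<union> B) F"
    unfolding girth_ge_def
  proof (intro allI impI, rule ccontr)
    fix xs assume c: "is_cycle (A \<union> B) F xs" and "\<not> 4 \<le> length xs"
    then have "length xs = 3" by (simp add: is_cycle_def)
    then obtain x y z where "xs = [x,y,z]" by (auto simp: numeral_3_eq_3 length_Suc_conv)
    then have "{x,y} \<in> F" "{y,z} \<in> F" "{z,x} \<in> F" using c by (auto simp: is_cycle_def cycle_edges_def)
    then show False using cross by blast
  qed
  have "card (A \<union> B) = 6" using AB fin by (simp add: card_Un_disjoint)
  then have "(4 - 2) * card F + 2 * 4 \<le> 4 * card (A \<union> B)"
    using plane_edge_bound[OF dF gir] by force
  then show False using cF \<open>card (A \<union> B) = 6\<close> by simp
qed

lemma graph_edges_no_loop: "graph_edges V E \<Longrightarrow> {v} \<notin> E"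
  unfolding graph_edges_def by fastforce

lemma plane_common_nbrs:
  assumes d: "drawing V E p \<gamma>" and abc: "a \<in> V" "b \<in> V" "c \<in> V" "a \<noteq> b" "a \<noteq> c" "b \<noteq> c"
  shows "card (nbrs V E a \<inter> nbrs V E b \<inter> nbrs V E c) \<le> 2"
proof (rule ccontr)
  let ?N = "nbrs V E a \<inter> nbrs V E b \<inter> nbrs V E c"
  assume "\<not> card ?N \<le> 2"
  then have "3 \<le> card ?N" by simp
  then obtain B where B: "B \<subseteq> ?N" "card B = 3" by (rule obtain_subset_with_card_n)
  have "{a} \<notin> E" "{b} \<notin> E" "{c} \<notin> E" using graph_edges_no_loop[OF drawing_graph[OF d]] by auto
  then have "{a,b,c} \<inter> B = {}" using B(1) by (auto simp: nbrs_def)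
  moreover have "card {a,b,c} = 3" using abc by simp
  moreover have "{a,b,c} \<union> B \<subseteq> V" using abc B(1) by (auto simp: nbrs_def)
  moreover have "{x,y} \<in> E" if "x \<in> {a,b,c}" "y \<in> B" for x y
    using that B(1) by (auto simp: nbrs_def insert_commute)
  ultimately show False using plane_no_K33[OF d _ _ B(2)] by blast
qed

text \<open>Since \<open>u\<close> and \<open>v\<close> are linked through \<open>w\<close>, an edge \<open>uv\<close> can be drawn along the path \<open>u, w, v\<close>;
  together with the wheels over the cycle this would be a plane graph with more than \<open>3n - 6\<close> edges.\<close>

lemma plane_common_nbrs_acyclic:
  assumes d: "drawing V E p \<gamma>" and uv: "u \<in> V" "v \<in> V" "u \<noteq> v"
    and cyc: "is_cycle (nbrs V E u \<inter> nbrs V E v) E xs" and w: "w \<in> nbrs V E u \<inter> nbrs V E v" "w \<notin> set xs"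
  shows False
proof -
  note gr = drawing_graph[OF d]
  have loop: "{z} \<notin> E" for z by (rule graph_edges_no_loop[OF gr])
  have xs: "distinct xs" "length xs \<ge> 3" "set xs \<subseteq> nbrs V E u \<inter> nbrs V E v" "cycle_edges xs \<subseteq> E"
    using cyc by (auto simp: is_cycle_def)
  have nu: "u \<notin> set xs" "v \<notin> set xs" "w \<noteq> u" "w \<noteq> v" using xs(3) w(1) loop by (auto simp: nbrs_def)
  have E0: "{u, x} \<in> E" "{v, x} \<in> E" "x \<in> V" if "x \<in> insert w (set xs)" for x
    using that xs(3) w(1) by (auto simp: nbrs_def insert_commute)
  obtain g where g: "arc g" "pathstart g = p u" "pathfinish g = p v" "path_image g = edge_image \<gamma> (path_edges [u,w,v])"
    using path_arc[OF d, of "[u,w,v]"] nu uv E0 by (auto simp: insert_commute)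
  have gi: "path_image g = path_image (\<gamma> {u,w}) \<union> path_image (\<gamma> {w,v})" using g(4) by (simp add: edge_image_def)
  have uw: "{u,w} \<in> E" "{w,v} \<in> E" using E0[of w] by (auto simp: insert_commute[of w])
  define V' where "V' = {u,v} \<union> set xs"
  define F where "F = cycle_edges xs \<union> (\<lambda>x. {u,x}) ` set xs \<union> (\<lambda>x. {v,x}) ` set xs"
  \<comment> \<open>\<open>F\<close> leaves out \<open>{u, v}\<close>, so the arc of this pair can
    be set to \<open>g\<close> whether or not \<open>E\<close> contains the edge.\<close>
  define \<gamma>' where "\<gamma>' = \<gamma>({u,v} := g)"
  have FE: "F \<subseteq> E" using xs(4) E0 by (auto simp: F_def)
  have FV: "e \<subseteq> V'" if "e \<in> F" for e using that cycle_edges_subset by (auto simp: F_def V'_def)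
  have V'V: "V' \<subseteq> V" using uv E0 by (auto simp: V'_def)
  have uvF: "{u,v} \<notin> F"
  proof
    assume "{u,v} \<in> F"
    then consider "{u,v} \<in> cycle_edges xs" | x where "x \<in> set xs" "{u,v} = {u,x}"
      | x where "x \<in> set xs" "{u,v} = {v,x}" unfolding F_def by blast
    then show False
      by cases (use nu uv cycle_edges_subset[of "{u,v}" xs] in \<open>auto simp: doubleton_eq_iff\<close>)
  qed
  have dF: "drawing V' F p \<gamma>" by (rule drawing_subset[OF d V'V FE FV])
  have wF: "w \<notin> V'" using w(2) nu by (auto simp: V'_def)
  have g': "\<gamma>' e = \<gamma> e" if "e \<in> F" for e using that uvF by (auto simp: \<gamma>'_def)
  \<comment> \<open>The rerouted edge passes through \<open>w\<close>, which is no vertex of the new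
    graph; the other arcs can meet it only at \<open>u\<close> or \<open>v\<close>.\<close>
  have int: "path_image (\<gamma> e) \<inter> path_image g \<subseteq> p ` (e \<inter> {u,v})" if "e \<in> F" for e
  proof -
    have "w \<notin> e" using FV[OF that] wF by blast
    then have ne: "e \<noteq> {u,w}" "e \<noteq> {w,v}" by auto
    have "e \<in> E" using that FE by blast
    then have "path_image (\<gamma> e) \<inter> path_image (\<gamma> {u,w}) \<subseteq> p ` (e \<inter> {u,w})"
      "path_image (\<gamma> e) \<inter> path_image (\<gamma> {w,v}) \<subseteq> p ` (e \<inter> {w,v})"
      using drawing_Int[OF d] uw ne by auto
    moreover have "e \<inter> {u,w} \<subseteq> e \<inter> {u,v}" "e \<inter> {w,v} \<subseteq> e \<inter> {u,v}" using \<open>w \<notin> e\<close> by auto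
    ultimately show ?thesis unfolding gi by blast
  qed
  have dr: "drawing V' (insert {u,v} F) p \<gamma>'"
    unfolding drawing_def
  proof (intro conjI)
    show "graph_edges V' (insert {u,v} F)"
      using drawing_graph[OF dF] uv unfolding graph_edges_def V'_def by blast
    show "inj_on p V'" by (rule drawing_inj[OF dF])
    show "\<forall>e\<in>insert {u,v} F. arc (\<gamma>' e) \<and> {pathstart (\<gamma>' e), pathfinish (\<gamma>' e)} = p ` e"
      using drawing_arc[OF dF] drawing_ends[OF dF] g g' by (auto simp: \<gamma>'_def)
    show "\<forall>e\<in>insert {u,v} F. \<forall>x\<in>V'. p x \<in> path_image (\<gamma>' e) \<longrightarrow> x \<in> e"
    proof (intro ballI impI)
      fix e x assume e: "e \<in> insert {u,v} F" and x: "x \<in> V'" and px: "p x \<in> path_image (\<gamma>' e)"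
      show "x \<in> e"
      proof (cases "e = {u,v}")
        case True
        then have "p x \<in> path_image (\<gamma> {u,w}) \<or> p x \<in> path_image (\<gamma> {w,v})" using px gi by (auto simp: \<gamma>'_def)
        then have "x \<in> {u,w} \<or> x \<in> {w,v}" using drawing_vertex[OF d] uw x V'V by blast
        then show ?thesis using True x wF by auto
      next
        case False
        then show ?thesis using drawing_vertex[OF dF _ x] e px g' by auto
      qed
    qed
    show "\<forall>e\<in>insert {u,v} F. \<forall>e'\<in>insert {u,v} F. e \<noteq> e' \<longrightarrow>
       path_image (\<gamma>' e) \<inter> path_image (\<gamma>' e') \<subseteq> p ` (e \<inter> e')"
    proof (intro ballI impI)
      fix e e' assume e: "e \<in> insert {u,v} F" "e' \<in> insert {u,v} F" "e \<noteq> e'"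
      have gg: "\<gamma>' {u,v} = g" by (simp add: \<gamma>'_def)
      consider "e = {u,v}" "e' \<in> F" | "e' = {u,v}" "e \<in> F" | "e \<in> F" "e' \<in> F" using e by auto
      then show "path_image (\<gamma>' e) \<inter> path_image (\<gamma>' e') \<subseteq> p ` (e \<inter> e')"
      proof cases
        case 1
        then show ?thesis using int[OF 1(2)] g'[OF 1(2)] gg by (simp add: Int_commute)
      next
        case 2
        then show ?thesis using int[OF 2(2)] g'[OF 2(2)] gg by simp
      next
        case 3
        then show ?thesis using drawing_Int[OF dF 3 e(3)] g' by simp
      qed
    qed
  qed
  have cV: "card V' = length xs + 2"
    using nu uv xs(1) distinct_card[OF xs(1)] by (simp add: V'_def)
  have "card ((\<lambda>x. {u,x}) ` set xs) = length xs" "card ((\<lambda>x. {v,x}) ` set xs) = length xs"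
    using distinct_card[OF xs(1)] nu by (subst card_image; auto simp: inj_on_def doubleton_eq_iff)+
  moreover have "cycle_edges xs \<inter> ((\<lambda>x. {u,x}) ` set xs \<union> (\<lambda>x. {v,x}) ` set xs) = {}"
    using cycle_edges_subset[of _ xs] nu by blast
  moreover have "(\<lambda>x. {u,x}) ` set xs \<inter> (\<lambda>x. {v,x}) ` set xs = {}"
    using nu uv by (auto simp: doubleton_eq_iff)
  ultimately have "card F = 3 * length xs"
    using card_cycle_edges[OF xs(1,2)] by (simp add: F_def card_Un_disjoint Un_assoc)
  then have "card (insert {u,v} F) = 3 * length xs + 1"
    using uvF graph_edges_finite[OF drawing_graph[OF dF]] by simp
  \<comment> \<open>With \<open>length xs + 2\<close> vertices the bound allows just
    \<open>3 * length xs\<close> edges.\<close>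
  then show False using plane_card_edges(2)[OF dr] cV xs(2) by simp
qed

subsection \<open>Perron vectors and the Rayleigh quotient\<close>

text \<open>The bilinear form of the adjacency matrix. The two arguments are kept apart because it
  is later evaluated on a Perron vector against a test vector.\<close>

definition adj_form :: "'a set \<Rightarrow> 'a set set \<Rightarrow> ('a \<Rightarrow> real) \<Rightarrow> ('a \<Rightarrow> real) \<Rightarrow> real" where
  "adj_form V E x y = (\<Sum>v\<in>V. x v * (\<Sum>u\<in>nbrs V E v. y u))"

lemma finite_nbrs [simp]: "finite V \<Longrightarrow> finite (nbrs V E v)"
  by (simp add: nbrs_def)

lemma nbrs_sym: "u \<in> V \<Longrightarrow> v \<in> V \<Longrightarrow> u \<in> nbrs V E v \<longleftrightarrow> v \<in> nbrs V E u"
  by (simp add: nbrs_def insert_commute)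

lemma adj_form_commute:
  assumes "finite V"
  shows "adj_form V E x y = adj_form V E y x"
proof -
  have "adj_form V E x y = (\<Sum>v\<in>V. \<Sum>u\<in>{u. u \<in> V \<and> {u, v} \<in> E}. x v * y u)"
    by (simp add: adj_form_def nbrs_def sum_distrib_left)
  also have "\<dots> = (\<Sum>u\<in>V. \<Sum>v\<in>{v. v \<in> V \<and> {u, v} \<in> E}. x v * y u)"
    by (rule sum.swap_restrict) (use assms in auto)
  also have "\<dots> = adj_form V E y x"
    by (simp add: adj_form_def nbrs_def sum_distrib_left insert_commute mult.commute)
  finally show ?thesis .
qed

lemma adj_form_add_scaled:
  assumes "finite V"
  shows "adj_form V E (\<lambda>v. x v + t * y v) (\<lambda>v. x v + t * y v)
    = adj_form V E x x + 2 * t * adj_form V E y x + t\<^sup>2 * adj_form V E y y"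
proof -
  have "adj_form V E (\<lambda>v. x v + t * y v) (\<lambda>v. x v + t * y v)
    = adj_form V E x x + t * adj_form V E x y + t * adj_form V E y x + t\<^sup>2 * adj_form V E y y"
    by (simp add: adj_form_def sum.distrib sum_distrib_left algebra_simps power2_eq_square)
  then show ?thesis using adj_form_commute[OF assms, of E x y] by simp
qed

lemma adj_form_scale: "adj_form V E (\<lambda>v. c * x v) (\<lambda>v. c * x v) = (c * c) * adj_form V E x x"
  by (simp add: adj_form_def sum_distrib_left algebra_simps)

lemma linear_term_zero:
  fixes a b :: real
  assumes "\<And>t. 2 * t * a + t\<^sup>2 * b \<le> 0" "a \<ge> 0"
  shows "a = 0"
proof (rule ccontr)
  assume "a \<noteq> 0"
  then have a: "a > 0" using assms(2) by simp
  \<comment> \<open>With this \<open>t\<close> the quadratic term is at least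
    \<open>- t * a\<close>, so it cannot cancel the linear term \<open>2 * t * a\<close>.\<close>
  define t where "t = a / (\<bar>b\<bar> + 1)"
  have t: "t > 0" using a by (simp add: t_def)
  have "2 * t * a + t\<^sup>2 * b = t * (2 * a + t * b)" by (simp add: algebra_simps power2_eq_square)
  moreover have "t * b \<ge> - a"
  proof -
    have "t * (\<bar>b\<bar> + 1) = a" by (simp add: t_def)
    moreover have "t * (- b) \<le> t * (\<bar>b\<bar> + 1)" using t by (intro mult_left_mono) auto
    ultimately show ?thesis by simp
  qed
  ultimately have "2 * t * a + t\<^sup>2 * b > 0" using t a by simp
  then show False using assms(1)[of t] by simp
qed

text \<open>Perturbing a maximiser in the direction of its residual \<open>r\<close> gains, to first
  order, twice the squared norm of \<open>r\<close>; this must therefore vanish.\<close>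

lemma rayleigh_max_eigenvector:
  assumes fin: "finite V" and le: "\<And>y. adj_form V E y y \<le> M * (\<Sum>v\<in>V. (y v)\<^sup>2)"
    and eq: "adj_form V E x x = M * (\<Sum>v\<in>V. (x v)\<^sup>2)" and v: "v \<in> V"
  shows "(\<Sum>u\<in>nbrs V E v. x u) = M * x v"
proof -
  define r where "r v = (\<Sum>u\<in>nbrs V E v. x u) - M * x v" for v
  have xr: "adj_form V E r x - M * (\<Sum>v\<in>V. x v * r v) = (\<Sum>v\<in>V. (r v)\<^sup>2)"
    by (simp add: adj_form_def r_def sum_distrib_left sum_subtractf[symmetric] algebra_simps power2_eq_square)
  have sq: "(\<Sum>v\<in>V. (x v + t * r v)\<^sup>2) = (\<Sum>v\<in>V. (x v)\<^sup>2) + 2 * t * (\<Sum>v\<in>V. x v * r v) + t\<^sup>2 * (\<Sum>v\<in>V. (r v)\<^sup>2)" for t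
    by (simp add: sum.distrib sum_distrib_left algebra_simps power2_eq_square)
  have "2 * t * (\<Sum>v\<in>V. (r v)\<^sup>2) + t\<^sup>2 * (adj_form V E r r - M * (\<Sum>v\<in>V. (r v)\<^sup>2)) \<le> 0" for t
  proof -
    have "adj_form V E x x + 2 * t * adj_form V E r x + t\<^sup>2 * adj_form V E r r
       \<le> M * ((\<Sum>v\<in>V. (x v)\<^sup>2) + 2 * t * (\<Sum>v\<in>V. x v * r v) + t\<^sup>2 * (\<Sum>v\<in>V. (r v)\<^sup>2))"
      using le[of "\<lambda>v. x v + t * r v"] unfolding adj_form_add_scaled[OF fin] sq .
    then show ?thesis unfolding xr[symmetric] using eq by (simp add: algebra_simps)
  qed
  from linear_term_zero[OF this] have "(\<Sum>v\<in>V. (r v)\<^sup>2) = 0" by (simp add: sum_nonneg)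
  then have "r v = 0" using fin v by (simp add: sum_nonneg_eq_0_iff)
  then show ?thesis by (simp add: r_def)
qed

lemma adj_form_abs_le:
  assumes "\<And>v. v \<in> V \<Longrightarrow> \<bar>y v\<bar> \<le> z v"
  shows "adj_form V E y y \<le> adj_form V E z z"
proof -
  have z0: "0 \<le> z v" if "v \<in> V" for v using assms[OF that] by linarith
  have nV: "u \<in> V" if "u \<in> nbrs V E v" for u v using that by (simp add: nbrs_def)
  have "y v * (\<Sum>u\<in>nbrs V E v. y u) \<le> z v * (\<Sum>u\<in>nbrs V E v. z u)" if "v \<in> V" for v
  proof -
    have "y v * (\<Sum>u\<in>nbrs V E v. y u) \<le> \<bar>y v\<bar> * \<bar>\<Sum>u\<in>nbrs V E v. y u\<bar>" by (metis abs_ge_self abs_mult)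
    also have "\<bar>\<Sum>u\<in>nbrs V E v. y u\<bar> \<le> (\<Sum>u\<in>nbrs V E v. \<bar>y u\<bar>)" by (rule sum_abs)
    also have "\<dots> \<le> (\<Sum>u\<in>nbrs V E v. z u)" by (rule sum_mono) (use assms nV in blast)
    finally have "y v * (\<Sum>u\<in>nbrs V E v. y u) \<le> \<bar>y v\<bar> * (\<Sum>u\<in>nbrs V E v. z u)"
      by (simp add: mult_left_mono)
    also have "\<dots> \<le> z v * (\<Sum>u\<in>nbrs V E v. z u)"
      by (rule mult_right_mono) (use assms that z0 nV in \<open>auto intro!: sum_nonneg\<close>)
    finally show ?thesis .
  qed
  then show ?thesis unfolding adj_form_def by (rule sum_mono)
qed

text \<open>Absolute values do not decrease the form, so it suffices to maximise over unit vectors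
  with entries in \<open>{0..1}\<close>. Functions live on the whole type; setting them to 0 off
  \<open>V\<close> makes this box compact in the product topology.\<close>

lemma rayleigh_max_exists:
  assumes fin: "finite V" and ne: "V \<noteq> {}"
  obtains x M where "\<And>v. v \<in> V \<Longrightarrow> 0 \<le> x v" "(\<Sum>v\<in>V. (x v)\<^sup>2) = 1" "adj_form V E x x = M"
    "\<And>y. adj_form V E y y \<le> M * (\<Sum>v\<in>V. (y v)\<^sup>2)"
proof -
  define B where "B = (PiE UNIV (\<lambda>v. if v \<in> V then {0..1} else {0}) :: ('a \<Rightarrow> real) set)"
  have "compactin (product_topology (\<lambda>i. euclidean) UNIV) B"
    unfolding B_def compactin_PiE by auto
  then have cB: "compact B" by (simp add: euclidean_product_topology)
  have cc: "continuous_on UNIV (\<lambda>x :: 'a \<Rightarrow> real. x v)" for v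
    by (rule continuous_on_product_coordinates)
  have cs: "continuous_on UNIV (\<lambda>x :: 'a \<Rightarrow> real. \<Sum>v\<in>V. (x v)\<^sup>2)"
    by (intro continuous_intros cc)
  have cq: "continuous_on UNIV (\<lambda>x :: 'a \<Rightarrow> real. adj_form V E x x)"
    unfolding adj_form_def by (intro continuous_intros cc)
  define K where "K = B \<inter> {x. (\<Sum>v\<in>V. (x v)\<^sup>2) = 1}"
  have "closed {x :: 'a \<Rightarrow> real. (\<Sum>v\<in>V. (x v)\<^sup>2) = 1}"
    using continuous_closed_preimage_constant[OF cs closed_UNIV, of 1] by simp
  then have cK: "compact K" unfolding K_def using cB by (rule compact_Int_closed[rotated])
  obtain v0 where v0: "v0 \<in> V" using ne by auto
  have "(\<lambda>v. if v = v0 then 1 else 0 :: real) \<in> K"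
  proof -
    have "(\<Sum>v\<in>V. (if v = v0 then 1 else 0 :: real)\<^sup>2) = (\<Sum>v\<in>V. if v = v0 then 1 else 0)"
      by (rule sum.cong) auto
    then show ?thesis using v0 fin by (auto simp: K_def B_def PiE_def extensional_def)
  qed
  then have "K \<noteq> {}" by blast
  then obtain x where x: "x \<in> K" "\<And>y. y \<in> K \<Longrightarrow> adj_form V E y y \<le> adj_form V E x x"
    using continuous_attains_sup[OF cK _ continuous_on_subset[OF cq subset_UNIV]] by blast
  have x0: "0 \<le> x v" if "v \<in> V" for v
    using x(1) that by (auto simp: K_def B_def PiE_def Pi_def split: if_splits)
  show ?thesis
  proof (rule that[OF x0])
    show "(\<Sum>v\<in>V. (x v)\<^sup>2) = 1" using x(1) by (simp add: K_def)
    fix y :: "'a \<Rightarrow> real"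
    define s where "s = (\<Sum>v\<in>V. (y v)\<^sup>2)"
    show "adj_form V E y y \<le> adj_form V E x x * (\<Sum>v\<in>V. (y v)\<^sup>2)"
    proof (cases "s = 0")
      case True
      then have "y v = 0" if "v \<in> V" for v using fin that by (simp add: s_def sum_nonneg_eq_0_iff)
      then have "adj_form V E y y = 0" by (simp add: adj_form_def)
      then show ?thesis using True by (simp add: s_def)
    next
      case False
      then have s: "s > 0" using sum_nonneg[of V "\<lambda>v. (y v)\<^sup>2"] by (simp add: s_def less_le)
      define z where "z v = (if v \<in> V then \<bar>y v\<bar> / sqrt s else 0)" for v
      have zz: "(\<Sum>v\<in>V. (z v)\<^sup>2) = 1"
      proof -
        have "(\<Sum>v\<in>V. (z v)\<^sup>2) = (\<Sum>v\<in>V. (y v)\<^sup>2 / s)"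
          by (rule sum.cong) (use s in \<open>auto simp: z_def power_divide\<close>)
        then show ?thesis using s by (simp add: s_def sum_divide_distrib[symmetric])
      qed
      have z1: "z v \<le> 1" if "v \<in> V" for v
      proof -
        have "(z v)\<^sup>2 \<le> (\<Sum>v\<in>V. (z v)\<^sup>2)" using fin that by (intro member_le_sum) auto
        then have "(z v)\<^sup>2 \<le> 1\<^sup>2" using zz by simp
        then show ?thesis by (rule power2_le_imp_le) simp
      qed
      have "z \<in> K" using zz z1 s by (auto simp: K_def B_def PiE_def extensional_def z_def)
      then have le: "adj_form V E z z \<le> adj_form V E x x" by (rule x(2))
      have "adj_form V E y y \<le> adj_form V E (\<lambda>v. sqrt s * z v) (\<lambda>v. sqrt s * z v)"
        by (rule adj_form_abs_le) (use s in \<open>auto simp: z_def\<close>)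
      also have "\<dots> = (sqrt s * sqrt s) * adj_form V E z z"
        by (rule adj_form_scale)
      also have "\<dots> = s * adj_form V E z z" using s by simp
      also have "\<dots> \<le> s * adj_form V E x x" using le s by simp
      finally show ?thesis by (simp add: s_def mult.commute)
    qed
  qed auto
qed

text \<open>\<open>Max\<close> in \<open>spectral_radius\<close> is meaningful only for a finite
  set; the eigenvalues are roots of a characteristic polynomial.\<close>

lemma finite_eigenvalues:
  assumes "finite (fst G)"
  shows "finite {\<mu>. adj_eigenvalue G \<mu>}"
proof -
  define n where "n = card (fst G)"
  obtain f where f: "bij_betw f {0..<n} (fst G)" using ex_bij_betw_nat_finite[OF assms] n_def by blast
  define A where "A = Matrix.mat n n (\<lambda>(i, j). if {f j, f i} \<in> snd G then 1 else (0::complex))"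
  have A: "A \<in> carrier_mat n n" by (simp add: A_def)
  have "eigenvalue A \<mu>" if ev: "adj_eigenvalue G \<mu>" for \<mu>
  proof -
    obtain x where x: "\<exists>v\<in>fst G. x v \<noteq> 0"
      "\<And>v. v \<in> fst G \<Longrightarrow> (\<Sum>u\<in>{u\<in>fst G. {u, v} \<in> snd G}. x u) = \<mu> * x v"
      using ev unfolding adj_eigenvalue_def by blast
    define w where "w = Matrix.vec n (\<lambda>i. x (f i))"
    have w: "w \<in> carrier_vec n" by (simp add: w_def)
    obtain v where v: "v \<in> fst G" "x v \<noteq> 0" using x(1) by blast
    then have "v \<in> f ` {0..<n}" using bij_betw_imp_surj_on[OF f] by simp
    then obtain i where i: "i < n" "f i = v" by auto
    have "w \<noteq> 0\<^sub>v n"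
    proof
      assume "w = 0\<^sub>v n"
      then have "vec_index w i = vec_index (0\<^sub>v n) i" by simp
      then show False using i v by (simp add: w_def)
    qed
    moreover have "A *\<^sub>v w = \<mu> \<cdot>\<^sub>v w"
    proof (rule eq_vecI)
      fix i assume "i < dim_vec (\<mu> \<cdot>\<^sub>v w)"
      then have i: "i < n" by (simp add: w_def)
      then have fi: "f i \<in> fst G" using f by (auto simp: bij_betw_def)
      have "vec_index (A *\<^sub>v w) i = (\<Sum>j = 0..<n. (if {f j, f i} \<in> snd G then 1 else 0) * x (f j))"
        using i by (simp add: A_def w_def scalar_prod_def)
      also have "\<dots> = (\<Sum>u\<in>fst G. (if {u, f i} \<in> snd G then 1 else 0) * x u)"
        using sum.reindex_bij_betw[OF f, of "\<lambda>u. (if {u, f i} \<in> snd G then 1 else 0) * x u"] by simp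
      also have "\<dots> = (\<Sum>u\<in>fst G. if {u, f i} \<in> snd G then x u else 0)"
        by (rule sum.cong) auto
      also have "\<dots> = (\<Sum>u\<in>{u\<in>fst G. {u, f i} \<in> snd G}. x u)"
        using assms by (simp add: sum.If_cases Int_def)
      also have "\<dots> = \<mu> * x (f i)" by (rule x(2)[OF fi])
      finally show "vec_index (A *\<^sub>v w) i = vec_index (\<mu> \<cdot>\<^sub>v w) i" using i by (simp add: w_def)
    qed (simp add: A_def w_def)
    ultimately show ?thesis using w A unfolding eigenvalue_def eigenvector_def by auto
  qed
  then have "{\<mu>. adj_eigenvalue G \<mu>} \<subseteq> {\<mu>. poly (char_poly A) \<mu> = 0}"
    using eigenvalue_root_char_poly[OF A] by auto
  moreover have "char_poly A \<noteq> 0" using degree_monic_char_poly[OF A] by auto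
  ultimately show ?thesis using poly_roots_finite finite_subset by blast
qed

text \<open>The maximum \<open>M\<close> of the Rayleigh quotient is itself an eigenvalue, and the
  moduli of the entries of a complex eigenvector show that no eigenvalue exceeds \<open>M\<close> in
  absolute value.\<close>

lemma spectral_radius_perron:
  fixes V :: "'a set" and E :: "'a set set"
  assumes fin: "finite V" and ne: "V \<noteq> {}"
  defines "\<rho> \<equiv> spectral_radius (V, E)"
  shows "adj_form V E y y \<le> \<rho> * (\<Sum>v\<in>V. (y v)\<^sup>2)"
    and "\<exists>x. (\<forall>v\<in>V. 0 \<le> x v) \<and> (\<exists>v\<in>V. 0 < x v) \<and> (\<forall>v\<in>V. (\<Sum>u\<in>nbrs V E v. x u) = \<rho> * x v)"
proof -
  obtain x M where x: "\<And>v. v \<in> V \<Longrightarrow> 0 \<le> x v" "(\<Sum>v\<in>V. (x v)\<^sup>2) = 1" "adj_form V E x x = M"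
    and M: "\<And>y. adj_form V E y y \<le> M * (\<Sum>v\<in>V. (y v)\<^sup>2)"
    using rayleigh_max_exists[OF fin ne, of E] by blast
  have eig: "(\<Sum>u\<in>nbrs V E v. x u) = M * x v" if "v \<in> V" for v
    by (rule rayleigh_max_eigenvector[OF fin M _ that]) (simp add: x)
  have pos: "\<exists>v\<in>V. 0 < x v"
  proof (rule ccontr)
    assume "\<not> ?thesis"
    then have "x v = 0" if "v \<in> V" for v using x(1)[OF that] that by force
    then show False using x(2) by simp
  qed
  have "M = (\<Sum>v\<in>V. x v * (\<Sum>u\<in>nbrs V E v. x u))" using x(3) by (simp add: adj_form_def)
  also have "\<dots> \<ge> 0" using x(1) by (intro sum_nonneg mult_nonneg_nonneg) (auto simp: nbrs_def)
  finally have M0: "M \<ge> 0" .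
  have "adj_eigenvalue (V, E) (complex_of_real M)"
    unfolding adj_eigenvalue_def
  proof (intro exI conjI ballI)
    show "\<exists>v\<in>fst (V, E). complex_of_real (x v) \<noteq> 0" using pos by force
    fix v assume v: "v \<in> fst (V, E)"
    show "(\<Sum>u\<in>{u \<in> fst (V, E). {u, v} \<in> snd (V, E)}. complex_of_real (x u)) = complex_of_real M * complex_of_real (x v)"
      using eig[of v] v unfolding nbrs_def of_real_sum[symmetric] of_real_mult[symmetric] by simp
  qed
  then have "M \<in> cmod ` {\<mu>. adj_eigenvalue (V, E) \<mu>}" using M0 by (force intro!: image_eqI)
  moreover have "cmod \<mu> \<le> M" if ev: "adj_eigenvalue (V, E) \<mu>" for \<mu>
  proof -
    obtain z where z: "\<exists>v\<in>V. z v \<noteq> 0" "\<And>v. v \<in> V \<Longrightarrow> (\<Sum>u\<in>nbrs V E v. z u) = \<mu> * z v"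
      using ev unfolding adj_eigenvalue_def nbrs_def by auto
    define y where "y v = cmod (z v)" for v
    have "cmod \<mu> * (\<Sum>v\<in>V. (y v)\<^sup>2) = (\<Sum>v\<in>V. y v * (cmod \<mu> * y v))"
      by (simp add: sum_distrib_left power2_eq_square mult.left_commute)
    also have "\<dots> \<le> adj_form V E y y"
      unfolding adj_form_def
    proof (rule sum_mono, rule mult_left_mono)
      fix v assume "v \<in> V"
      then have "cmod \<mu> * y v = cmod (\<Sum>u\<in>nbrs V E v. z u)" using z(2) by (simp add: y_def norm_mult)
      also have "\<dots> \<le> (\<Sum>u\<in>nbrs V E v. y u)" unfolding y_def by (rule norm_sum)
      finally show "cmod \<mu> * y v \<le> (\<Sum>u\<in>nbrs V E v. y u)" .
    qed (simp add: y_def)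
    also have "\<dots> \<le> M * (\<Sum>v\<in>V. (y v)\<^sup>2)" by (rule M)
    finally have le: "cmod \<mu> * (\<Sum>v\<in>V. (y v)\<^sup>2) \<le> M * (\<Sum>v\<in>V. (y v)\<^sup>2)" .
    obtain v where "v \<in> V" "z v \<noteq> 0" using z(1) by blast
    then have "(\<Sum>v\<in>V. (y v)\<^sup>2) > 0" using fin by (intro sum_pos2[of V v]) (auto simp: y_def)
    then show ?thesis using le by (simp add: mult_le_cancel_right)
  qed
  moreover have "finite (cmod ` {\<mu>. adj_eigenvalue (V, E) \<mu>})"
    by (rule finite_imageI, rule finite_eigenvalues) (simp add: fin)
  ultimately have "\<rho> = M" unfolding \<rho>_def spectral_radius_def by (intro Max_eqI) auto
  then show "adj_form V E y y \<le> \<rho> * (\<Sum>v\<in>V. (y v)\<^sup>2)"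
    and "\<exists>x. (\<forall>v\<in>V. 0 \<le> x v) \<and> (\<exists>v\<in>V. 0 < x v) \<and> (\<forall>v\<in>V. (\<Sum>u\<in>nbrs V E v. x u) = \<rho> * x v)"
    using M x(1) pos eig by blast+
qed

subsection \<open>Two dominating vertices\<close>

text \<open>What the walk counting uses of planarity: hereditary sparsity and, in the form of
  \<open>common3\<close>, the absence of K_{3,3}.\<close>

locale plane_like =
  fixes V :: "'a set" and E :: "'a set set"
  assumes gr: "graph_edges V E"
    and sparse: "\<And>S. S \<subseteq> V \<Longrightarrow> card {e\<in>E. e \<subseteq> S} \<le> 3 * card S"
    and common3: "\<And>a b c. a \<in> V \<Longrightarrow> b \<in> V \<Longrightarrow> c \<in> V \<Longrightarrow> a \<noteq> b \<Longrightarrow> a \<noteq> c \<Longrightarrow> b \<noteq> c \<Longrightarrow>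
        card (nbrs V E a \<inter> nbrs V E b \<inter> nbrs V E c) \<le> 2"
begin

abbreviation N where "N \<equiv> nbrs V E"
abbreviation deg where "deg v \<equiv> card (N v)"

lemma finV: "finite V" using gr by (simp add: graph_edges_def)
lemma finE: "finite E" using gr by (rule graph_edges_finite)
lemma finN [simp]: "finite (N v)" using finV by simp
lemma NV: "N v \<subseteq> V" by (auto simp: nbrs_def)
lemma noloop: "v \<notin> N v" using graph_edges_no_loop[OF gr] by (auto simp: nbrs_def)
lemma deg_le: "deg v \<le> card V" by (rule card_mono[OF finV NV])

lemma degree_sum_inside:
  assumes "S \<subseteq> V"
  shows "(\<Sum>v\<in>S. card (N v \<inter> S)) \<le> 6 * card S"
proof -
  let ?F = "{e\<in>E. e \<subseteq> S}"
  let ?P = "SIGMA v:S. N v \<inter> S"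
  have fS: "finite S" using assms finV finite_subset by blast
  have "(\<Sum>v\<in>S. card (N v \<inter> S)) = card ?P" using fS by (subst card_SigmaI) auto
  also have "\<dots> \<le> card (\<Union>f\<in>?F. {(a, b). {a, b} = f \<and> a \<noteq> b})"
  proof (rule card_mono)
    have "(\<Union>f\<in>?F. {(a, b). {a, b} = f \<and> a \<noteq> b}) \<subseteq> S \<times> S" by auto
    then show "finite (\<Union>f\<in>?F. {(a, b). {a, b} = f \<and> a \<noteq> b})" using fS finite_subset by blast
    show "?P \<subseteq> (\<Union>f\<in>?F. {(a, b). {a, b} = f \<and> a \<noteq> b})"
    proof
      fix q assume "q \<in> ?P"
      then obtain a b where q: "q = (a, b)" "a \<in> S" "b \<in> N a" "b \<in> S" by blast
      then have "{a, b} \<in> ?F" by (auto simp: nbrs_def insert_commute)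
      moreover have "a \<noteq> b" using q noloop by auto
      ultimately show "q \<in> (\<Union>f\<in>?F. {(a, b). {a, b} = f \<and> a \<noteq> b})" using q(1) by blast
    qed
  qed
  also have "\<dots> \<le> (\<Sum>f\<in>?F. card {(a, b). {a, b} = f \<and> a \<noteq> b})"
    by (rule card_UN_le) (use finE in auto)
  also have "\<dots> \<le> (\<Sum>f\<in>?F. 2)"
  proof (rule sum_mono)
    fix f assume "f \<in> ?F"
    then obtain a b where f: "f = {a, b}" using gr unfolding graph_edges_def by blast
    have "{(x, y). {x, y} = f \<and> x \<noteq> y} \<subseteq> {(a, b), (b, a)}" unfolding f by (auto simp: doubleton_eq_iff)
    then have "card {(x, y). {x, y} = f \<and> x \<noteq> y} \<le> card {(a, b), (b, a)}" by (rule card_mono[rotated]) simp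
    also have "\<dots> \<le> 2" using card_length[of "[(a, b), (b, a)]"] by simp
    finally show "card {(x, y). {x, y} = f \<and> x \<noteq> y} \<le> 2" .
  qed
  also have "\<dots> = 2 * card ?F" by simp
  also have "\<dots> \<le> 6 * card S" using sparse[OF assms] by simp
  finally show ?thesis .
qed

lemma degree_sum: "(\<Sum>v\<in>V. deg v) \<le> 6 * card V"
proof -
  have "N v \<inter> V = N v" for v using NV by blast
  then show ?thesis using degree_sum_inside[of V] by simp
qed

lemma sum_codegree:
  assumes "S \<subseteq> V" "v \<in> V"
  shows "(\<Sum>w\<in>S. card (N v \<inter> N w)) = (\<Sum>y\<in>N v. card (N y \<inter> S))"
proof -
  have fS: "finite S" using assms finV finite_subset by blast
  have "(\<Sum>w\<in>S. card (N v \<inter> N w)) = (\<Sum>w\<in>S. \<Sum>y\<in>{y. y \<in> N v \<and> y \<in> N w}. 1)"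
    by (simp add: Int_def)
  also have "\<dots> = (\<Sum>y\<in>N v. \<Sum>w\<in>{w. w \<in> S \<and> y \<in> N w}. 1)"
    by (rule sum.swap_restrict) (use fS in auto)
  also have "\<dots> = (\<Sum>y\<in>N v. card (N y \<inter> S))"
  proof (rule sum.cong)
    fix y assume "y \<in> N v"
    then have "y \<in> V" using NV by blast
    then have "{w. w \<in> S \<and> y \<in> N w} = N y \<inter> S" using nbrs_sym[of y V _ E] assms by blast
    then show "(\<Sum>w\<in>{w. w \<in> S \<and> y \<in> N w}. 1) = card (N y \<inter> S)" by simp
  qed simp
  finally show ?thesis .
qed

lemma codegree_sum_total:
  assumes "v \<in> V"
  shows "(\<Sum>w\<in>V. card (N v \<inter> N w)) \<le> 6 * card V"
proof -
  have "(\<Sum>w\<in>V. card (N v \<inter> N w)) = (\<Sum>y\<in>N v. card (N y \<inter> V))"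
    using sum_codegree[OF _ assms] by simp
  also have "\<dots> \<le> (\<Sum>y\<in>V. card (N y \<inter> V))" by (rule sum_mono2) (use finV NV in auto)
  also have "\<dots> \<le> 6 * card V" by (rule degree_sum_inside) simp
  finally show ?thesis .
qed

text \<open>The sum counts adjacent pairs between \<open>N v\<close> and \<open>S\<close>, and the
  sparsity of their union bounds it. This tolerates a large \<open>S\<close> at the price of a
  factor 6 on the degree; \<open>codegree_sum_few\<close> has the opposite virtues.\<close>

lemma codegree_sum_sparse:
  assumes "S \<subseteq> V" "v \<in> V"
  shows "(\<Sum>w\<in>S. card (N v \<inter> N w)) \<le> 6 * (deg v + card S)"
proof -
  let ?T = "N v \<union> S"
  have T: "?T \<subseteq> V" using assms NV by blast
  have fT: "finite ?T" using T finV finite_subset by blast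
  have "(\<Sum>w\<in>S. card (N v \<inter> N w)) = (\<Sum>y\<in>N v. card (N y \<inter> S))" by (rule sum_codegree[OF assms])
  also have "\<dots> \<le> (\<Sum>y\<in>N v. card (N y \<inter> ?T))" by (intro sum_mono card_mono) auto
  also have "\<dots> \<le> (\<Sum>y\<in>?T. card (N y \<inter> ?T))" by (rule sum_mono2) (use fT in auto)
  also have "\<dots> \<le> 6 * card ?T" by (rule degree_sum_inside[OF T])
  also have "\<dots> \<le> 6 * (deg v + card S)" using card_Un_le[of "N v" S] by simp
  finally show ?thesis .
qed

text \<open>A new set shares at most \<open>2 * k\<close> points with the union of \<open>k\<close>
  earlier ones, and \<open>k\<^sup>2 + 2 * k < (k + 1)\<^sup>2\<close>.\<close>

lemma sum_card_le_Union:
  assumes "finite S" "\<And>w. w \<in> S \<Longrightarrow> finite (A w)"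
    and "\<And>w w'. w \<in> S \<Longrightarrow> w' \<in> S \<Longrightarrow> w \<noteq> w' \<Longrightarrow> card (A w \<inter> A w') \<le> 2"
  shows "(\<Sum>w\<in>S. card (A w)) \<le> card (\<Union>w\<in>S. A w) + (card S)\<^sup>2"
  using assms
proof (induction S rule: finite_induct)
  case (insert w S)
  let ?U = "\<Union>w\<in>S. A w"
  have fU: "finite ?U" using insert by auto
  have IH: "(\<Sum>w\<in>S. card (A w)) \<le> card ?U + (card S)\<^sup>2" using insert by auto
  have "A w \<inter> ?U = (\<Union>w'\<in>S. A w \<inter> A w')" by blast
  then have "card (A w \<inter> ?U) \<le> (\<Sum>w'\<in>S. card (A w \<inter> A w'))" using card_UN_le insert(1) by metis
  also have "\<dots> \<le> (\<Sum>w'\<in>S. 2)"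
    by (rule sum_mono, rule insert.prems(2)) (use insert.hyps in auto)
  finally have c: "card (A w \<inter> ?U) \<le> 2 * card S" by simp
  have "card (A w) = card (A w - ?U) + card (A w \<inter> ?U)"
    using insert.prems(1)[of w] by (metis card_Diff_subset_Int card_mono finite_Int inf_le1 insertI1 le_add_diff_inverse2)
  moreover have "card (\<Union>w\<in>insert w S. A w) = card (A w - ?U) + card ?U"
  proof -
    have "(\<Union>w\<in>insert w S. A w) = (A w - ?U) \<union> ?U" by blast
    moreover have "finite (A w)" using insert.prems(1)[of w] by blast
    ultimately show ?thesis using fU by (metis Diff_disjoint card_Un_disjoint finite_Diff inf_commute)
  qed
  moreover have "(card (insert w S))\<^sup>2 = (card S)\<^sup>2 + 2 * card S + 1"
    using insert.hyps by (simp add: power2_eq_square)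
  moreover have "(\<Sum>w\<in>insert w S. card (A w)) = card (A w) + (\<Sum>w\<in>S. card (A w))"
    using insert.hyps by simp
  ultimately show ?case using IH c by linarith
qed simp

text \<open>Inside \<open>N v\<close> the neighbourhoods of distinct members of \<open>S\<close>
  overlap in at most two vertices, so the degree enters with factor 1. This factor makes the later
  estimate of the entries nearly sharp.\<close>

lemma codegree_sum_few:
  assumes "S \<subseteq> V" "v \<in> V" "v \<notin> S"
  shows "(\<Sum>w\<in>S. card (N v \<inter> N w)) \<le> deg v + (card S)\<^sup>2"
proof -
  have fS: "finite S" using assms finV finite_subset by blast
  have "(\<Sum>w\<in>S. card (N v \<inter> N w)) \<le> card (\<Union>w\<in>S. N v \<inter> N w) + (card S)\<^sup>2"
  proof (rule sum_card_le_Union[OF fS])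
    fix w w' assume w: "w \<in> S" "w' \<in> S" "w \<noteq> w'"
    have "N v \<inter> N w \<inter> (N v \<inter> N w') = N v \<inter> N w \<inter> N w'" by blast
    then show "card (N v \<inter> N w \<inter> (N v \<inter> N w')) \<le> 2" using common3[of v w w'] w assms by auto
  qed simp
  also have "card (\<Union>w\<in>S. N v \<inter> N w) \<le> deg v" by (rule card_mono) auto
  finally show ?thesis by simp
qed

end

section \<open>Sizes of the Perron entries\<close>

locale plane_like_perron = plane_like +
  fixes x :: "'a \<Rightarrow> real" and \<rho> :: real and n :: nat
  assumes x0: "\<And>v. v \<in> V \<Longrightarrow> 0 \<le> x v" and x1: "\<And>v. v \<in> V \<Longrightarrow> x v \<le> 1"
    and eig: "\<And>v. v \<in> V \<Longrightarrow> (\<Sum>u\<in>N v. x u) = \<rho> * x v"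
    and n: "card V = n" "real n \<ge> 2.16 * 10 ^ 17"
    and rho: "\<rho> > 0" "\<rho>\<^sup>2 \<ge> 2 * real n - 4"
begin

definition big :: "real \<Rightarrow> 'a set" where "big t = {v\<in>V. x v \<ge> t}"

lemma bigV: "big t \<subseteq> V" by (auto simp: big_def)
lemma fin_big [simp]: "finite (big t)" using finV by (simp add: big_def)

text \<open>The square of the adjacency matrix counts common neighbours; the diagonal term
  \<open>w = v\<close> is the degree.\<close>

lemma two_step:
  assumes "v \<in> V"
  shows "\<rho>\<^sup>2 * x v = (\<Sum>w\<in>V. real (card (N v \<inter> N w)) * x w)"
proof -
  have "\<rho>\<^sup>2 * x v = \<rho> * (\<Sum>y\<in>N v. x y)" using eig[OF assms] by (simp add: power2_eq_square)
  also have "\<dots> = (\<Sum>y\<in>N v. \<rho> * x y)" by (simp add: sum_distrib_left)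
  also have "\<dots> = (\<Sum>y\<in>N v. \<Sum>w\<in>{w. w \<in> V \<and> y \<in> N w}. x w)"
  proof (rule sum.cong)
    fix y assume "y \<in> N v"
    then have y: "y \<in> V" using NV by blast
    then have "{w. w \<in> V \<and> y \<in> N w} = N y" using nbrs_sym[of y V _ E] NV by blast
    then show "\<rho> * x y = (\<Sum>w\<in>{w. w \<in> V \<and> y \<in> N w}. x w)" using eig[OF y] by simp
  qed simp
  also have "\<dots> = (\<Sum>w\<in>V. \<Sum>y\<in>{y. y \<in> N v \<and> y \<in> N w}. x w)"
    by (rule sum.swap_restrict[symmetric]) (use finV in auto)
  also have "\<dots> = (\<Sum>w\<in>V. real (card (N v \<inter> N w)) * x w)" by (simp add: Int_def)
  finally show ?thesis .
qed

text \<open>Vertices are sorted by their entry: \<open>v\<close> itself contributes at most its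
  degree, entries below \<open>t\<close> at most \<open>6 * t * n\<close> by the total codegree, and
  the large entries remain as a sum.\<close>

lemma two_step_bound:
  assumes "v \<in> V" "0 \<le> t"
  shows "\<rho>\<^sup>2 * x v \<le> real (deg v) + (\<Sum>w\<in>big t - {v}. real (card (N v \<inter> N w)) * x w) + 6 * t * real n"
proof -
  let ?c = "\<lambda>w. real (card (N v \<inter> N w))"
  have V: "V = {v} \<union> ((big t - {v}) \<union> (V - big t - {v}))" using assms(1) bigV by blast
  have "(\<Sum>w\<in>V. ?c w * x w) = (\<Sum>w\<in>{v}. ?c w * x w) + (\<Sum>w\<in>(big t - {v}) \<union> (V - big t - {v}). ?c w * x w)"
    by (subst V, rule sum.union_disjoint) (use finV in auto)
  also have "(\<Sum>w\<in>(big t - {v}) \<union> (V - big t - {v}). ?c w * x w)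
     = (\<Sum>w\<in>big t - {v}. ?c w * x w) + (\<Sum>w\<in>V - big t - {v}. ?c w * x w)"
    by (rule sum.union_disjoint) (use finV in auto)
  also have "(\<Sum>w\<in>{v}. ?c w * x w) \<le> real (deg v)" using x0 x1 assms(1) by (simp add: mult_left_le)
  also have "(\<Sum>w\<in>V - big t - {v}. ?c w * x w) \<le> (\<Sum>w\<in>V - big t - {v}. ?c w * t)"
    by (intro sum_mono mult_left_mono) (auto simp: big_def)
  also have "\<dots> \<le> (\<Sum>w\<in>V. ?c w * t)" by (rule sum_mono2) (use finV assms in auto)
  also have "\<dots> = t * real (\<Sum>w\<in>V. card (N v \<inter> N w))" by (simp add: sum_distrib_left mult.commute)
  also have "\<dots> \<le> t * real (6 * n)"
    using codegree_sum_total[OF assms(1)] n assms(2) by (intro mult_left_mono) (simp_all only: of_nat_le_iff)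
  finally show ?thesis using two_step[OF assms(1)] by simp
qed

lemma big_codegree:
  assumes "v \<in> V"
  shows "(\<Sum>w\<in>big t - {v}. real (card (N v \<inter> N w)) * x w) \<le> real (\<Sum>w\<in>big t - {v}. card (N v \<inter> N w))"
  unfolding of_nat_sum by (rule sum_mono, rule mult_left_le) (use x1 bigV in auto)

lemma rho_large: "\<rho> \<ge> 6 * 10 ^ 8"
proof (rule power2_le_imp_le)
  show "(6 * 10 ^ 8)\<^sup>2 \<le> \<rho>\<^sup>2" using rho(2) n(2) by simp
qed (use rho in simp)

text \<open>Summing the eigenvalue equation over the set bounds
  \<open>t * \<rho> * card (big t)\<close> by the degree sum \<open>6 * n\<close>, and
  \<open>\<rho> \<ge> 6 * 10 ^ 8\<close> absorbs the 6.\<close>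

lemma big_card_weak:
  assumes "0 < t"
  shows "t * 10 ^ 8 * real (card (big t)) \<le> real n"
proof -
  have "t * \<rho> * real (card (big t)) = (\<Sum>v\<in>big t. t * \<rho>)" by simp
  also have "\<dots> \<le> (\<Sum>v\<in>big t. \<rho> * x v)" using rho by (intro sum_mono) (auto simp: big_def)
  also have "\<dots> = (\<Sum>v\<in>big t. \<Sum>u\<in>N v. x u)" by (rule sum.cong) (auto simp: eig big_def)
  also have "\<dots> \<le> (\<Sum>v\<in>big t. \<Sum>u\<in>N v. 1)" by (intro sum_mono) (use x1 NV in auto)
  also have "\<dots> = real (\<Sum>v\<in>big t. deg v)" by simp
  also have "(\<Sum>v\<in>big t. deg v) \<le> (\<Sum>v\<in>V. deg v)" by (rule sum_mono2) (use finV bigV in auto)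
  also have "\<dots> \<le> 6 * card V" by (rule degree_sum)
  finally have 1: "t * \<rho> * real (card (big t)) \<le> 6 * real n" using n by simp
  have "t * (6 * 10 ^ 8) * real (card (big t)) \<le> t * \<rho> * real (card (big t))"
    using rho_large assms by (intro mult_right_mono mult_left_mono) auto
  then show ?thesis using 1 by simp
qed

text \<open>The lower threshold 1/1000 keeps the tail \<open>6 * n / 1000\<close> below the main
  term, which is about \<open>n / 100\<close>, while the weak count of entries above it makes the
  sparse codegree bound usable.\<close>

lemma big_degree:
  assumes "v \<in> big (1/200)"
  shows "real n \<le> 2000 * real (deg v)"
proof -
  have v: "v \<in> V" "x v \<ge> 1/200" using assms by (auto simp: big_def)
  have "(2 * real n - 4) * (1/200) \<le> \<rho>\<^sup>2 * x v" using rho v n by (intro mult_mono) auto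
  also have "\<dots> \<le> real (deg v) + real (\<Sum>w\<in>big (1/1000) - {v}. card (N v \<inter> N w)) + 6 * (1/1000) * real n"
    using two_step_bound[OF v(1), of "1/1000"] big_codegree[OF v(1), of "1/1000"] by linarith
  also have "(\<Sum>w\<in>big (1/1000) - {v}. card (N v \<inter> N w)) \<le> 6 * (deg v + card (big (1/1000) - {v}))"
    by (rule codegree_sum_sparse) (use v bigV in auto)
  also have "card (big (1/1000) - {v}) \<le> card (big (1/1000))" by (rule card_mono) auto
  finally have "(2 * real n - 4) * (1/200)
      \<le> 7 * real (deg v) + 6 * real (card (big (1/1000))) + 6 * (1/1000) * real n" by simp
  moreover have "10 ^ 5 * real (card (big (1/1000))) \<le> real n" using big_card_weak[of "1/1000"] by simp
  ultimately show ?thesis using n(2) by simp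
qed

text \<open>Vertices of linear degree are bounded in number by the degree sum:
  \<open>12000 = 6 * 2000\<close>.\<close>

lemma big_card: "card (big (1/200)) \<le> 12000"
proof -
  have "real (card (big (1/200))) * real n = (\<Sum>v\<in>big (1/200). real n)" by simp
  also have "\<dots> \<le> (\<Sum>v\<in>big (1/200). 2000 * real (deg v))" by (rule sum_mono) (rule big_degree)
  also have "\<dots> = 2000 * real (\<Sum>v\<in>big (1/200). deg v)" by (simp add: sum_distrib_left)
  also have "(\<Sum>v\<in>big (1/200). deg v) \<le> (\<Sum>v\<in>V. deg v)" by (rule sum_mono2) (use finV bigV in auto)
  also have "\<dots> \<le> 6 * card V" by (rule degree_sum)
  finally have "real (card (big (1/200))) * real n \<le> 12000 * real n" using n by simp
  then show ?thesis using n(2) by (simp add: mult_le_cancel_right)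
qed

text \<open>The set now has bounded size, so the square in \<open>codegree_sum_few\<close> is
  negligible against \<open>n\<close>.\<close>

lemma codegree_big:
  assumes "v \<in> V"
  shows "real (\<Sum>w\<in>big (1/200) - {v}. card (N v \<inter> N w)) \<le> real (deg v) + real n / 10000"
proof -
  let ?S = "big (1/200) - {v}"
  have "card ?S \<le> card (big (1/200))" by (rule card_mono) auto
  then have "real (card ?S) \<le> 12000" using big_card by linarith
  then have "(real (card ?S))\<^sup>2 \<le> 12000\<^sup>2" by (rule power_mono) simp
  moreover have "?S \<subseteq> V" using bigV by blast
  then have "(\<Sum>w\<in>?S. card (N v \<inter> N w)) \<le> deg v + (card ?S)\<^sup>2"
    by (rule codegree_sum_few) (use assms in simp_all)
  then have "real (\<Sum>w\<in>?S. card (N v \<inter> N w)) \<le> real (deg v + (card ?S)\<^sup>2)"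
    by (simp only: of_nat_le_iff)
  ultimately show ?thesis using n(2) by simp
qed

text \<open>The degree appears once for the walks returning to \<open>v\<close> and once for the
  codegrees with large entries; \<open>0.0301\<close> is \<open>6 / 200\<close> from the small
  entries plus \<open>1 / 10000\<close> from overlaps.\<close>

lemma entry_degree:
  assumes "v \<in> V"
  shows "(2 * real n - 4) * x v \<le> 2 * real (deg v) + 0.0301 * real n"
proof -
  have "(2 * real n - 4) * x v \<le> \<rho>\<^sup>2 * x v" using rho x0[OF assms] by (intro mult_right_mono)
  also have "\<dots> \<le> real (deg v) + real (\<Sum>w\<in>big (1/200) - {v}. card (N v \<inter> N w)) + 6 * (1/200) * real n"
    using two_step_bound[OF assms, of "1/200"] big_codegree[OF assms, of "1/200"] by linarith
  finally show ?thesis using codegree_big[OF assms] by simp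
qed

text \<open>An entry 1 needs about \<open>2 * n\<close> weighted walks of length two. Returning
  walks supply at most \<open>n\<close>, so the rest must come from a second vertex with entry near
  1. A further vertex meets the common neighbourhood of these two at most twice, so its degree and
  with it its entry are small.\<close>

theorem two_dominating:
  assumes z: "z \<in> V" "x z = 1"
  obtains v where "v \<in> V" "v \<noteq> z" "x v \<ge> 0.96" "real (card (N z \<inter> N v)) \<ge> 0.92 * real n"
    "\<And>s. s \<in> V \<Longrightarrow> s \<noteq> z \<Longrightarrow> s \<noteq> v \<Longrightarrow> x s \<le> 0.09"
proof -
  let ?L = "big (1/200)"
  have dz: "real (deg z) \<ge> 0.984 * real n" using entry_degree[OF z(1)] z(2) n(2) by simp
  have "\<exists>v\<in>?L - {z}. x v \<ge> 0.96"
  proof (rule ccontr)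
    assume "\<not> ?thesis"
    then have "x w \<le> 0.96" if "w \<in> ?L - {z}" for w using that by (meson linear)
    then have "(\<Sum>w\<in>?L - {z}. real (card (N z \<inter> N w)) * x w) \<le> (\<Sum>w\<in>?L - {z}. real (card (N z \<inter> N w)) * 0.96)"
      by (intro sum_mono mult_left_mono) simp_all
    also have "\<dots> = 0.96 * real (\<Sum>w\<in>?L - {z}. card (N z \<inter> N w))" by (simp add: sum_distrib_left mult.commute)
    also have "\<dots> \<le> 0.96 * (real (deg z) + real n / 10000)" using codegree_big[OF z(1)] by simp
    finally have "25 * (\<Sum>w\<in>?L - {z}. real (card (N z \<inter> N w)) * x w) \<le> 24 * real (deg z) + 3/1250 * real n"
      by simp
    moreover have "\<rho>\<^sup>2 \<le> real (deg z) + (\<Sum>w\<in>?L - {z}. real (card (N z \<inter> N w)) * x w) + 3/100 * real n"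
      using two_step_bound[OF z(1), of "1/200"] z(2) by simp
    moreover have "real (deg z) \<le> real n" using deg_le n by simp
    moreover have "real n > 10000" using n(2) by simp
    \<comment> \<open>If all other large entries were at most \<open>0.96\<close>, the square of
      \<open>\<rho>\<close> would be at most about \<open>1.9901 * n\<close>, short of
      \<open>2 * n - 4\<close>.\<close>
    ultimately show False using rho(2) by linarith
  qed
  then obtain v where v: "v \<in> V" "v \<noteq> z" "x v \<ge> 0.96" using bigV by blast
  have "(2 * real n - 4) * 0.96 \<le> (2 * real n - 4) * x v" using v(3) n(2) by (intro mult_left_mono) auto
  then have dv: "real (deg v) \<ge> 0.944 * real n" using entry_degree[OF v(1)] n(2) by simp
  let ?D = "N z \<inter> N v"
  have "card (N z \<union> N v) + card ?D = deg z + deg v" using card_Un_Int[of "N z" "N v"] by simp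
  moreover have "card (N z \<union> N v) \<le> n" using card_mono[OF finV, of "N z \<union> N v"] NV n(1) by auto
  ultimately have "real (deg z) + real (deg v) \<le> real n + real (card ?D)" by linarith
  then have D: "real (card ?D) \<ge> 0.928 * real n" using dz dv by simp
  have small: "x s \<le> 0.09" if s: "s \<in> V" "s \<noteq> z" "s \<noteq> v" for s
  proof -
    have "card (?D \<inter> N s) \<le> 2" using common3[of z v s] z v s by blast
    moreover have "card (N s) \<le> card (?D \<inter> N s) + card (V - ?D)"
    proof -
      have "N s \<subseteq> (?D \<inter> N s) \<union> (V - ?D)" using NV by blast
      then have "card (N s) \<le> card ((?D \<inter> N s) \<union> (V - ?D))" by (rule card_mono[rotated]) (use finV in auto)
      also have "\<dots> \<le> card (?D \<inter> N s) + card (V - ?D)" by (rule card_Un_le)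
      finally show ?thesis .
    qed
    moreover have "card (V - ?D) + card ?D = n"
      using NV n(1) finV by (metis card_Diff_subset card_mono finN finite_Int inf.coboundedI1 le_add_diff_inverse2)
    ultimately have "real (deg s) + real (card ?D) \<le> 2 + real n" by linarith
    then have "real (deg s) \<le> 2 + 0.072 * real n" using D by simp
    then have "(2 * real n - 4) * x s \<le> 0.1742 * real n" using entry_degree[OF s(1)] n(2) by simp
    also have "\<dots> \<le> (2 * real n - 4) * 0.09" using n(2) by simp
    finally have "(2 * real n - 4) * x s \<le> (2 * real n - 4) * 0.09" .
    moreover have "2 * real n - 4 > 0" using n(2) by simp
    ultimately show ?thesis by (rule mult_left_le_imp_le)
  qed
  show ?thesis by (rule that[OF v]) (use D small n(2) in auto)
qed

end

subsection \<open>Passing to the double cone\<close>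

lemma edges_at:
  assumes "graph_edges V E" "v \<in> V"
  shows "{e\<in>E. v \<in> e} = (\<lambda>u. {u, v}) ` nbrs V E v"
proof (rule subset_antisym; rule subsetI)
  fix e assume "e \<in> {e\<in>E. v \<in> e}"
  then have e: "e \<in> E" "v \<in> e" by auto
  obtain w where "w \<in> V" "e = {v, w}" using graph_edges_other[OF assms(1) e] by metis
  then show "e \<in> (\<lambda>u. {u, v}) ` nbrs V E v" using e by (auto simp: nbrs_def insert_commute)
qed (auto simp: nbrs_def)

lemma sum_UN_le:
  fixes f :: "'b \<Rightarrow> real"
  assumes "finite R" "\<And>r. r \<in> R \<Longrightarrow> finite (B r)" "\<And>r e. r \<in> R \<Longrightarrow> e \<in> B r \<Longrightarrow> 0 \<le> f e"
  shows "sum f (\<Union>r\<in>R. B r) \<le> (\<Sum>r\<in>R. sum f (B r))"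
  using assms
proof (induction R rule: finite_induct)
  case (insert r R)
  let ?U = "\<Union>r\<in>R. B r"
  have fin: "finite (B r)" "finite ?U" using insert by auto
  have "0 \<le> sum f (B r \<inter> ?U)" by (rule sum_nonneg) (use insert.prems(2) in blast)
  then have "sum f (B r \<union> ?U) \<le> sum f (B r) + sum f ?U" using sum.union_inter[OF fin, of f] by linarith
  moreover have "sum f ?U \<le> (\<Sum>r\<in>R. sum f (B r))"
    by (rule insert.IH) (use insert.prems in auto)
  moreover have "(\<Union>r\<in>insert r R. B r) = B r \<union> ?U" by blast
  ultimately show ?case using insert.hyps by simp
qed simp

text \<open>The product over the two-element set \<open>e\<close> is the weight of the edge; writing
  it as \<open>prod x e\<close> spares an orientation. Each edge is counted at both ends.\<close>

lemma adj_form_edges: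
  assumes gr: "graph_edges V E"
  shows "adj_form V E x x = 2 * (\<Sum>e\<in>E. prod x e)"
proof -
  have fin: "finite V" "finite E" using gr graph_edges_finite[OF gr] by (auto simp: graph_edges_def)
  have "adj_form V E x x = (\<Sum>v\<in>V. \<Sum>e\<in>{e. e \<in> E \<and> v \<in> e}. prod x e)"
    unfolding adj_form_def
  proof (rule sum.cong)
    fix v assume v: "v \<in> V"
    have "bij_betw (\<lambda>u. {u, v}) (nbrs V E v) {e. e \<in> E \<and> v \<in> e}"
    proof (rule bij_betw_imageI)
      show "inj_on (\<lambda>u. {u, v}) (nbrs V E v)" by (auto simp: inj_on_def doubleton_eq_iff)
      show "(\<lambda>u. {u, v}) ` nbrs V E v = {e. e \<in> E \<and> v \<in> e}" using edges_at[OF gr v] by simp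
    qed
    then have "(\<Sum>e\<in>{e. e \<in> E \<and> v \<in> e}. prod x e) = (\<Sum>u\<in>nbrs V E v. prod x {u, v})"
      using sum.reindex_bij_betw by metis
    also have "\<dots> = (\<Sum>u\<in>nbrs V E v. x v * x u)"
    proof (rule sum.cong)
      fix u assume "u \<in> nbrs V E v"
      then have "u \<noteq> v" using graph_edges_no_loop[OF gr] by (auto simp: nbrs_def)
      then show "prod x {u, v} = x v * x u" by simp
    qed simp
    finally show "x v * (\<Sum>u\<in>nbrs V E v. x u) = (\<Sum>e\<in>{e. e \<in> E \<and> v \<in> e}. prod x e)"
      by (simp add: sum_distrib_left)
  qed simp
  also have "\<dots> = (\<Sum>e\<in>E. \<Sum>v\<in>{v. v \<in> V \<and> v \<in> e}. prod x e)"
    by (rule sum.swap_restrict) (use fin in auto)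
  also have "\<dots> = (\<Sum>e\<in>E. 2 * prod x e)"
  proof (rule sum.cong)
    fix e assume "e \<in> E"
    then obtain a b where "a \<in> V" "b \<in> V" "a \<noteq> b" "e = {a, b}" using gr unfolding graph_edges_def by blast
    then have "{v. v \<in> V \<and> v \<in> e} = {a, b}" "a \<noteq> b" by auto
    then show "(\<Sum>v\<in>{v. v \<in> V \<and> v \<in> e}. prod x e) = 2 * prod x e" by simp
  qed simp
  finally show ?thesis by (simp add: sum_distrib_left)
qed

definition cone_edges :: "'a \<Rightarrow> 'a \<Rightarrow> 'a set \<Rightarrow> 'a set set \<Rightarrow> 'a set set" where
  "cone_edges u v W H = insert {u, v} ((\<lambda>s. {u, s}) ` W \<union> (\<lambda>s. {v, s}) ` W \<union> H)"

lemma cone_edges_graph: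
  assumes "graph_edges W H" "u \<noteq> v" "u \<notin> W" "v \<notin> W"
  shows "graph_edges (insert u (insert v W)) (cone_edges u v W H)"
proof -
  have "\<exists>a b. a \<in> insert u (insert v W) \<and> b \<in> insert u (insert v W) \<and> a \<noteq> b \<and> e = {a, b}"
    if "e \<in> H" for e
    using assms(1) that unfolding graph_edges_def by blast
  then show ?thesis using assms unfolding graph_edges_def cone_edges_def by fastforce
qed

context plane_like
begin

text \<open>Every nonempty subset has a vertex with at most six neighbours in it. Deleting such
  vertices one by one charges each edge to the end that is deleted first.\<close>

lemma peel_weight:
  assumes "S \<subseteq> V" "\<And>s. s \<in> S \<Longrightarrow> 0 \<le> x s \<and> x s \<le> (m::real)"
  shows "(\<Sum>e\<in>{e\<in>E. e \<subseteq> S}. prod x e) \<le> 6 * m * (\<Sum>s\<in>S. x s)"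
proof -
  have "finite S" using assms(1) finV finite_subset by blast
  then show ?thesis using assms
  proof (induction "card S" arbitrary: S)
    case 0
    then have "S = {}" by simp
    moreover have "{} \<notin> E" using gr by (auto simp: graph_edges_def)
    ultimately show ?case by (simp add: conj_commute cong: conj_cong)
  next
    case (Suc k)
    have ne: "S \<noteq> {}" using Suc by auto
    have "\<exists>s\<in>S. card (N s \<inter> S) \<le> 6"
    proof (rule ccontr)
      assume "\<not> ?thesis"
      then have "(\<Sum>s\<in>S. 7) \<le> (\<Sum>s\<in>S. card (N s \<inter> S))" by (intro sum_mono) force
      then have "7 * card S \<le> 6 * card S" using degree_sum_inside[OF Suc.prems(2)] by simp
      then show False using ne Suc.prems(1) by (simp add: card_gt_0_iff)
    qed
    then obtain s where s: "s \<in> S" "card (N s \<inter> S) \<le> 6" by blast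
    let ?T = "S - {s}"
    have T: "k = card ?T" "finite ?T" "?T \<subseteq> V" using Suc s by auto
    have IH: "(\<Sum>e\<in>{e\<in>E. e \<subseteq> ?T}. prod x e) \<le> 6 * m * (\<Sum>s\<in>?T. x s)"
      by (rule Suc.hyps(1)[OF T]) (use Suc.prems(3) in blast)
    have fE: "finite {e\<in>E. P e}" for P using finE by simp
    have "{e\<in>E. e \<subseteq> S} = {e\<in>E. e \<subseteq> ?T} \<union> {e\<in>E. e \<subseteq> S \<and> s \<in> e}" by blast
    then have "(\<Sum>e\<in>{e\<in>E. e \<subseteq> S}. prod x e)
        = (\<Sum>e\<in>{e\<in>E. e \<subseteq> ?T}. prod x e) + (\<Sum>e\<in>{e\<in>E. e \<subseteq> S \<and> s \<in> e}. prod x e)"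
      by (simp only:, intro sum.union_disjoint fE) blast
    moreover have "{e\<in>E. e \<subseteq> S \<and> s \<in> e} = (\<lambda>w. {s, w}) ` (N s \<inter> S)"
    proof -
      have "s \<in> V" using s(1) Suc.prems(2) by blast
      have "{e\<in>E. e \<subseteq> S \<and> s \<in> e} = {e\<in>{e\<in>E. s \<in> e}. e \<subseteq> S}" by blast
      also have "\<dots> = (\<lambda>w. {s, w}) ` (N s \<inter> S)"
        unfolding edges_at[OF gr \<open>s \<in> V\<close>] using s(1) by auto
      finally show ?thesis .
    qed
    moreover have "(\<Sum>e\<in>(\<lambda>w. {s, w}) ` (N s \<inter> S). prod x e) = (\<Sum>w\<in>N s \<inter> S. prod x {s, w})"
      by (subst sum.reindex) (auto simp: inj_on_def doubleton_eq_iff)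
    moreover have "(\<Sum>w\<in>N s \<inter> S. prod x {s, w}) \<le> (\<Sum>w\<in>N s \<inter> S. x s * m)"
    proof (rule sum_mono)
      fix w assume w: "w \<in> N s \<inter> S"
      then have "s \<noteq> w" using noloop by auto
      then show "prod x {s, w} \<le> x s * m" using Suc.prems(3) w s by (simp add: mult_left_mono)
    qed
    moreover have "(\<Sum>w\<in>N s \<inter> S. x s * m) \<le> 6 * (x s * m)"
    proof -
      have "0 \<le> x s * m" using Suc.prems(3)[OF s(1)] by simp
      moreover have "real (card (N s \<inter> S)) \<le> 6" using s(2) by linarith
      ultimately show ?thesis by (simp add: mult_right_mono)
    qed
    moreover have "(\<Sum>s\<in>S. x s) = x s + (\<Sum>s\<in>?T. x s)" using s Suc.prems(1) by (simp add: sum.remove)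
    ultimately show ?case using IH by (simp add: algebra_simps)
  qed
qed

text \<open>Everything is charged to the vertices \<open>s\<close> of \<open>R\<close>, those
  outside the common neighbourhood. Deleted edges cost at most \<open>6 * 9/100 + 2 * 9/100\<close>
  per unit of \<open>x s\<close>, whereas \<open>s\<close> gains an edge to \<open>u\<close> or
  \<open>v\<close> worth at least \<open>24/25\<close> per unit. In the equality case
  \<open>x\<close> is also an eigenvector for \<open>E'\<close>, hence positive on \<open>R\<close>,
  which leaves \<open>R\<close> empty.\<close>

theorem cone_comparison:
  assumes uv: "u \<in> V" "v \<in> V" "u \<noteq> v"
    and x0: "\<And>s. s \<in> V \<Longrightarrow> 0 \<le> x s" and xuv: "x u \<ge> (24/25)" "x v \<ge> (24/25)"
    and small: "\<And>s. s \<in> V \<Longrightarrow> s \<noteq> u \<Longrightarrow> s \<noteq> v \<Longrightarrow> x s \<le> (9/100)"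
    and eig: "\<And>s. s \<in> V \<Longrightarrow> (\<Sum>w\<in>N s. x w) = spectral_radius (V, E) * x s"
  defines "E' \<equiv> cone_edges u v (V - {u, v}) {e\<in>E. e \<subseteq> N u \<inter> N v}"
  shows "spectral_radius (V, E) \<le> spectral_radius (V, E')"
    and "spectral_radius (V, E) = spectral_radius (V, E') \<Longrightarrow> E = E'"
proof -
  define D where "D = N u \<inter> N v"
  define W where "W = V - {u, v}"
  define R where "R = W - D"
  have DW: "D \<subseteq> W" using NV noloop by (auto simp: D_def W_def)
  have finW: "finite W" "finite R" "finite D" using finV by (auto simp: W_def R_def D_def)
  have E': "E' = cone_edges u v W {e\<in>E. e \<subseteq> D}" by (simp add: E'_def D_def W_def)
  have "graph_edges W {e\<in>E. e \<subseteq> D}"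
    by (rule graph_edges_subset[OF gr]) (use DW in \<open>auto simp: W_def\<close>)
  then have "graph_edges (insert u (insert v W)) E'"
    unfolding E' by (rule cone_edges_graph) (use uv in \<open>auto simp: W_def\<close>)
  moreover have "insert u (insert v W) = V" using uv by (auto simp: W_def)
  ultimately have gr': "graph_edges V E'" by simp
  have finE': "finite E'" by (rule graph_edges_finite[OF gr'])
  have pr: "prod x {a, b} = x a * x b" if "a \<noteq> b" for a b using that by simp
  have pe0: "0 \<le> prod x e" if "e \<in> E \<or> e \<in> E'" for e
    by (rule prod_nonneg) (use that x0 graph_edges_vertex[OF gr] graph_edges_vertex[OF gr'] in blast)
  have RV: "R \<subseteq> V" by (auto simp: R_def W_def)
  have Rs: "s \<noteq> u \<and> s \<noteq> v" if "s \<in> R" for s using that by (auto simp: R_def W_def)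
  have Rx: "0 \<le> x s \<and> x s \<le> (9/100)" if "s \<in> R" for s
    using x0[of s] small[of s] Rs[OF that] that RV by blast
  have R0: "0 \<le> (\<Sum>s\<in>R. x s)" using x0 RV by (intro sum_nonneg) (auto simp: R_def W_def)
  have removed: "(\<Sum>e\<in>E - E'. prod x e) \<le> (18/25) * (\<Sum>s\<in>R. x s)"
  proof -
    let ?A = "{e\<in>E. e \<subseteq> R}" let ?B = "\<lambda>s. (\<lambda>w. {s, w}) ` (N s \<inter> D)"
    \<comment> \<open>All edges at \<open>u\<close> or \<open>v\<close> survive, and so do those
      inside \<open>D\<close>; a deleted edge therefore has an end in \<open>R\<close>.\<close>
    have "E - E' \<subseteq> ?A \<union> (\<Union>s\<in>R. ?B s)"
    proof
      fix e assume e: "e \<in> E - E'"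
      then obtain a b where ab: "a \<in> V" "b \<in> V" "a \<noteq> b" "e = {a, b}" using gr unfolding graph_edges_def by blast
      have nuv: "a \<noteq> u" "a \<noteq> v" "b \<noteq> u" "b \<noteq> v"
        using e ab unfolding E' cone_edges_def W_def by (auto simp: insert_commute)
      have "\<not> (a \<in> D \<and> b \<in> D)" using e ab unfolding E' cone_edges_def by auto
      moreover have "a \<in> W" "b \<in> W" using ab nuv by (auto simp: W_def)
      moreover have "a \<in> N b" "b \<in> N a" using e ab by (auto simp: nbrs_def insert_commute)
      ultimately show "e \<in> ?A \<union> (\<Union>s\<in>R. ?B s)"
        using e ab by (auto simp: R_def insert_commute)
    qed
    then have "(\<Sum>e\<in>E - E'. prod x e) \<le> (\<Sum>e\<in>?A \<union> (\<Union>s\<in>R. ?B s). prod x e)"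
    proof (rule sum_mono2[rotated])
      fix e assume "e \<in> ?A \<union> (\<Union>s\<in>R. ?B s) - (E - E')"
      then have "e \<in> E" by (auto simp: nbrs_def insert_commute)
      then show "0 \<le> prod x e" using pe0 by blast
    qed (use finE finW in auto)
    also have "\<dots> \<le> (\<Sum>e\<in>?A. prod x e) + (\<Sum>e\<in>(\<Union>s\<in>R. ?B s). prod x e)"
    proof -
      have "0 \<le> (\<Sum>e\<in>?A \<inter> (\<Union>s\<in>R. ?B s). prod x e)" by (rule sum_nonneg) (use pe0 in auto)
      then show ?thesis using sum.union_inter[of ?A "\<Union>s\<in>R. ?B s" "prod x"] finE finW by simp
    qed
    also have "(\<Sum>e\<in>?A. prod x e) \<le> 6 * (9/100) * (\<Sum>s\<in>R. x s)"
      by (rule peel_weight[OF RV Rx])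
    also have "(\<Sum>e\<in>(\<Union>s\<in>R. ?B s). prod x e) \<le> (\<Sum>s\<in>R. \<Sum>e\<in>?B s. prod x e)"
    proof (rule sum_UN_le[OF finW(2)])
      fix s e assume "e \<in> ?B s"
      then have "e \<in> E" by (auto simp: nbrs_def insert_commute)
      then show "0 \<le> prod x e" using pe0 by blast
    qed simp
    also have "\<dots> \<le> (\<Sum>s\<in>R. (9/50) * x s)"
    proof (rule sum_mono)
      fix s assume s: "s \<in> R"
      have sV: "s \<in> V" using s by (auto simp: R_def W_def)
      have "(\<Sum>e\<in>?B s. prod x e) = (\<Sum>w\<in>N s \<inter> D. prod x {s, w})"
        by (subst sum.reindex) (auto simp: inj_on_def doubleton_eq_iff)
      also have "\<dots> \<le> (\<Sum>w\<in>N s \<inter> D. x s * (9/100))"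
      proof (rule sum_mono)
        fix w assume w: "w \<in> N s \<inter> D"
        then have "s \<noteq> w" "w \<in> V" "w \<noteq> u" "w \<noteq> v" using noloop NV DW by (auto simp: W_def)
        then show "prod x {s, w} \<le> x s * (9/100)"
          unfolding pr[OF \<open>s \<noteq> w\<close>] using x0[OF sV] small[of w] by (intro mult_left_mono)
      qed
      also have "\<dots> = real (card (N s \<inter> D)) * (x s * (9/100))" by simp
      also have "\<dots> \<le> 2 * (x s * (9/100))"
      proof (rule mult_right_mono)
        have "N u \<inter> N v \<inter> N s = N s \<inter> D" by (auto simp: D_def)
        then have "card (N s \<inter> D) \<le> 2" using common3[of u v s] uv sV Rs[OF s] by auto
        then show "real (card (N s \<inter> D)) \<le> 2" by linarith
      qed (use x0[OF sV] in simp)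
      finally show "(\<Sum>e\<in>?B s. prod x e) \<le> (9/50) * x s" by simp
    qed
    also have "\<dots> = (9/50) * (\<Sum>s\<in>R. x s)" by (simp add: sum_distrib_left)
    finally show ?thesis by simp
  qed
  \<comment> \<open>A vertex of \<open>R\<close> is not adjacent to both \<open>u\<close> and
    \<open>v\<close>; \<open>c\<close> picks one that it misses.\<close>
  define c where "c s = (if {u, s} \<in> E then v else u)" for s
  have cs: "{c s, s} \<notin> E" "c s = u \<or> c s = v" if "s \<in> R" for s
    using that by (auto simp: c_def R_def D_def W_def nbrs_def insert_commute)
  let ?C = "(\<lambda>s. {c s, s}) ` R"
  have CE: "?C \<subseteq> E' - E"
  proof
    fix e assume "e \<in> ?C"
    then obtain s where s: "s \<in> R" "e = {c s, s}" by blast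
    then have "e \<in> E'" using cs(2)[OF s(1)] by (auto simp: E' cone_edges_def R_def)
    then show "e \<in> E' - E" using cs(1)[OF s(1)] s(2) by blast
  qed
  have sumC: "(\<Sum>e\<in>?C. prod x e) \<ge> (24/25) * (\<Sum>s\<in>R. x s)"
  proof -
    have inj: "inj_on (\<lambda>s. {c s, s}) R"
    proof (rule inj_onI)
      fix s s' assume "s \<in> R" "s' \<in> R" "{c s, s} = {c s', s'}"
      then show "s = s'" using cs(2) Rs by (metis doubleton_eq_iff)
    qed
    have "(24/25) * (\<Sum>s\<in>R. x s) = (\<Sum>s\<in>R. (24/25) * x s)" by (simp add: sum_distrib_left)
    also have "\<dots> \<le> (\<Sum>s\<in>R. prod x {c s, s})"
    proof (rule sum_mono)
      fix s assume s: "s \<in> R"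
      have "c s \<noteq> s" using cs(2)[OF s] Rs[OF s] by auto
      moreover have "x (c s) \<ge> (24/25)" using cs(2)[OF s] xuv by auto
      moreover have "0 \<le> x s" using x0 s by (auto simp: R_def W_def)
      ultimately show "(24/25) * x s \<le> prod x {c s, s}"
        unfolding pr[OF \<open>c s \<noteq> s\<close>] by (intro mult_right_mono)
    qed
    also have "\<dots> = (\<Sum>e\<in>?C. prod x e)" using inj by (simp add: sum.reindex)
    finally show ?thesis .
  qed
  \<comment> \<open>The edge \<open>{u, v}\<close> may be new as well. Its gain is kept apart so
    that equality can force it to be present already.\<close>
  define extra where "extra = (if {u, v} \<in> E then 0 else x u * x v)"
  have added: "(\<Sum>e\<in>E' - E. prod x e) \<ge> (24/25) * (\<Sum>s\<in>R. x s) + extra"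
  proof (cases "{u, v} \<in> E")
    case True
    have "(\<Sum>e\<in>?C. prod x e) \<le> (\<Sum>e\<in>E' - E. prod x e)"
      by (rule sum_mono2) (use finE' CE pe0 in auto)
    then show ?thesis using sumC True by (simp add: extra_def)
  next
    case False
    have "{u, v} \<notin> ?C" using cs(2) Rs by (auto simp: doubleton_eq_iff)
    then have "(\<Sum>e\<in>insert {u, v} ?C. prod x e) = x u * x v + (\<Sum>e\<in>?C. prod x e)"
      using finW pr[OF uv(3)] by simp
    moreover have "(\<Sum>e\<in>insert {u, v} ?C. prod x e) \<le> (\<Sum>e\<in>E' - E. prod x e)"
    proof (rule sum_mono2)
      have "{u, v} \<in> E'" by (simp add: E' cone_edges_def)
      then show "insert {u, v} ?C \<subseteq> E' - E" using CE False by blast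
      show "0 \<le> prod x e" if "e \<in> E' - E - insert {u, v} ?C" for e using pe0 that by blast
    qed (use finE' in simp)
    ultimately show ?thesis using sumC False by (simp add: extra_def)
  qed
  \<comment> \<open>The form counts edges twice, and twice the net gain \<open>24/25 - 18/25\<close>
    is more than \<open>1/5\<close>.\<close>
  have diff: "adj_form V E' x x \<ge> adj_form V E x x + ((\<Sum>s\<in>R. x s) / 5 + extra)"
  proof -
    have "(\<Sum>e\<in>E'. prod x e) = (\<Sum>e\<in>E' - E. prod x e) + (\<Sum>e\<in>E' \<inter> E. prod x e)"
      using sum.Int_Diff[OF finE', of "prod x" E] by simp
    moreover have "(\<Sum>e\<in>E. prod x e) = (\<Sum>e\<in>E - E'. prod x e) + (\<Sum>e\<in>E' \<inter> E. prod x e)"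
      using sum.Int_Diff[OF finE, of "prod x" E'] by (simp add: Int_commute)
    ultimately have "(\<Sum>e\<in>E. prod x e) + ((6/25) * (\<Sum>s\<in>R. x s) + extra) \<le> (\<Sum>e\<in>E'. prod x e)"
      using removed added by linarith
    moreover have "0 \<le> extra" using xuv by (simp add: extra_def)
    ultimately show ?thesis using adj_form_edges[OF gr, of x] adj_form_edges[OF gr', of x] R0 by linarith
  qed
  have ex0: "0 \<le> extra" using xuv by (simp add: extra_def)
  let ?s = "\<Sum>s\<in>V. (x s)\<^sup>2"
  have "adj_form V E x x = (\<Sum>s\<in>V. x s * (spectral_radius (V, E) * x s))"
    unfolding adj_form_def by (rule sum.cong) (auto simp: eig)
  then have fE: "adj_form V E x x = spectral_radius (V, E) * ?s"
    by (simp add: sum_distrib_left power2_eq_square mult.left_commute)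
  have ne: "V \<noteq> {}" using uv by auto
  note per = spectral_radius_perron[OF finV ne, of E']
  have s0: "?s > 0" using uv xuv finV by (intro sum_pos2[of V u]) auto
  have "spectral_radius (V, E) * ?s \<le> spectral_radius (V, E') * ?s"
    using diff fE per(1)[of x] R0 ex0 by linarith
  then show "spectral_radius (V, E) \<le> spectral_radius (V, E')" using s0 by simp
  show "E = E'" if eq: "spectral_radius (V, E) = spectral_radius (V, E')"
  proof -
    have le: "(\<Sum>s\<in>R. x s) / 5 + extra \<le> 0"
      using diff fE[unfolded eq] per(1)[of x] by linarith
    then have ex: "extra = 0" and sR: "(\<Sum>s\<in>R. x s) = 0" using R0 ex0 by linarith+
    have uvE: "{u, v} \<in> E"
    proof (rule ccontr)
      assume "{u, v} \<notin> E"
      then have "x u * x v = 0" using ex by (simp add: extra_def)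
      then show False using xuv by auto
    qed
    have "adj_form V E' x x = spectral_radius (V, E') * ?s"
      using diff fE[unfolded eq] per(1)[of x] sR ex by linarith
    then have eig': "(\<Sum>w\<in>nbrs V E' s. x w) = spectral_radius (V, E') * x s" if "s \<in> V" for s
      using rayleigh_max_eigenvector[OF finV per(1) _ that] by blast
    have "R = {}"
    proof (rule ccontr)
      assume "R \<noteq> {}"
      then obtain s where s: "s \<in> R" by blast
      then have sV: "s \<in> V" by (auto simp: R_def W_def)
      have "u \<in> nbrs V E' s" using uv s by (auto simp: nbrs_def E' cone_edges_def R_def)
      then have "x u \<le> (\<Sum>w\<in>nbrs V E' s. x w)"
        using finV x0 by (intro member_le_sum) (auto simp: nbrs_def)
      then have "spectral_radius (V, E') * x s > 0" using eig'[OF sV] xuv by simp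
      then have "x s \<noteq> 0" by auto
      then have "x s > 0" using x0[OF sV] by simp
      then have "(\<Sum>s\<in>R. x s) > 0"
        using s finW x0 by (intro sum_pos2[of R s]) (auto simp: R_def W_def)
      then show False using sR by simp
    qed
    then have DW': "D = W" using DW by (auto simp: R_def)
    show "E = E'"
    proof
      show "E' \<subseteq> E"
        using uvE DW' unfolding E' cone_edges_def by (auto simp: D_def nbrs_def insert_commute)
      show "E \<subseteq> E'"
      proof
        fix e assume e: "e \<in> E"
        then obtain a b where ab: "a \<in> V" "b \<in> V" "a \<noteq> b" "e = {a, b}" using gr unfolding graph_edges_def by blast
        have Wm: "s \<in> W \<longleftrightarrow> s \<noteq> u \<and> s \<noteq> v" if "s \<in> V" for s using that by (auto simp: W_def)
        consider "a \<in> W" "b \<in> W" | "a = u" | "a = v" | "b = u" | "b = v" using Wm ab by blast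
        then show "e \<in> E'"
        proof cases
          case 1
          then show ?thesis using e ab DW' by (auto simp: E' cone_edges_def)
        qed (use ab Wm in \<open>auto simp: E' cone_edges_def insert_commute\<close>)
      qed
    qed
  qed
qed

end

subsection \<open>Resolvent of a path\<close>

text \<open>For \<open>\<rho> = t + 1/t\<close>, \<open>path_entry t k\<close> is the solution of \<open>\<rho> y\<^sub>j = y\<^sub>j\<^sub>-\<^sub>1 + y\<^sub>j\<^sub>+\<^sub>1 + 1\<close>
  on the path with vertices \<open>1, \<dots>, k\<close> and zero boundary values at \<open>0\<close> and \<open>k + 1\<close>.\<close>

definition path_entry :: "real \<Rightarrow> nat \<Rightarrow> nat \<Rightarrow> real" where
  "path_entry t k j = t / (1 - t)\<^sup>2 * (1 - (t ^ j + t ^ (k + 1 - j)) / (1 + t ^ (k + 1)))"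

definition path_weight :: "real \<Rightarrow> nat \<Rightarrow> real" where
  "path_weight t k = (\<Sum>j=1..k. path_entry t k j)"

lemma path_entry_boundary:
  assumes "0 < t"
  shows "path_entry t k 0 = 0" "path_entry t k (Suc k) = 0"
proof -
  have "0 < t ^ (k + 1)" using assms by (rule zero_less_power)
  then have "1 + t ^ (k + 1) \<noteq> 0" by linarith
  then show "path_entry t k 0 = 0" "path_entry t k (Suc k) = 0" by (simp_all add: path_entry_def add.commute)
qed

text \<open>The powers \<open>t ^ j\<close> and \<open>t ^ (k + 1 - j)\<close> solve the homogeneous
  recursion with factor \<open>t + 1 / t\<close>, and \<open>t / (1 - t)\<^sup>2\<close>, which
  equals \<open>1 / (t + 1 / t - 2)\<close>, is the constant solution of the inhomogeneous one. For
  \<open>i < k\<close> none of the subtractions is truncated.\<close>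

lemma path_entry_rec:
  assumes t: "0 < t" "t < 1" and i: "i < k"
  shows "path_entry t k i + path_entry t k (i + 2) + 1 = (t + 1 / t) * path_entry t k (i + 1)"
proof -
  define m where "m = k - i - 1"
  have e: "k + 1 - i = m + 2" "k + 1 - (i + 2) = m" "k + 1 - (i + 1) = m + 1"
    using i by (auto simp: m_def)
  define P where "P = 1 + t ^ (k + 1)"
  have "0 < t ^ (k + 1)" using t(1) by (rule zero_less_power)
  then have P: "P \<noteq> 0" unfolding P_def by linarith
  define c where "c = t / (1 - t)\<^sup>2"
  define a where "a = (t ^ (i + 1) + t ^ (m + 1)) / P"
  have e1: "path_entry t k i + path_entry t k (i + 2) = c * (2 - ((t ^ i + t ^ (m + 2)) + (t ^ (i + 2) + t ^ m)) / P)"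
    unfolding path_entry_def e P_def[symmetric] c_def[symmetric] by (simp add: algebra_simps add_divide_distrib)
  have "(t ^ i + t ^ (m + 2)) + (t ^ (i + 2) + t ^ m) = (t + 1 / t) * (t ^ (i + 1) + t ^ (m + 1))"
    using t by (simp add: field_simps power2_eq_square)
  then have e2: "path_entry t k i + path_entry t k (i + 2) = c * (2 - (t + 1 / t) * a)"
    unfolding e1 a_def by simp
  have e3: "path_entry t k (i + 1) = c * (1 - a)"
    unfolding path_entry_def e P_def[symmetric] c_def[symmetric] a_def by simp
  have "(t + 1 / t) - 2 = (1 - t)\<^sup>2 / t" using t by (simp add: field_simps power2_eq_square)
  then have "c * ((t + 1 / t) - 2) = 1" using t by (simp add: c_def)
  then show ?thesis unfolding e2 e3 by (simp add: algebra_simps)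
qed

lemma sum_powers_from_1:
  assumes "t \<noteq> (1::real)"
  shows "(\<Sum>j=1..k. t ^ j) = (t - t ^ (k + 1)) / (1 - t)"
proof -
  have "(1 - t) * (\<Sum>j=1..k. t ^ j) = t - t ^ (k + 1)"
  proof (induction k)
    case (Suc k)
    have "(\<Sum>j=1..Suc k. t ^ j) = (\<Sum>j=1..k. t ^ j) + t ^ (k + 1)" by simp
    then have "(1 - t) * (\<Sum>j=1..Suc k. t ^ j) = (t - t ^ (k + 1)) + (1 - t) * t ^ (k + 1)"
      by (simp only: distrib_left Suc.IH)
    also have "\<dots> = t - t ^ (Suc k + 1)" by (simp add: algebra_simps)
    finally show ?case .
  qed simp
  then show ?thesis using assms by (simp add: eq_divide_eq mult.commute)
qed

lemma path_weight_closed: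
  assumes t: "0 < t" "t < 1"
  shows "path_weight t k = t / (1 - t)\<^sup>2 * (real k - 2 * (t - t ^ (k + 1)) / ((1 - t) * (1 + t ^ (k + 1))))"
proof -
  let ?S = "\<Sum>j=1..k. t ^ j"
  have "(\<Sum>j=1..k. t ^ (k + 1 - j)) = ?S" using sum.atLeastAtMost_rev[of "\<lambda>j. t ^ j" 1 k] by simp
  then have "(\<Sum>j=1..k. (t ^ j + t ^ (k + 1 - j)) / (1 + t ^ (k + 1))) = 2 * ?S / (1 + t ^ (k + 1))"
    by (simp add: sum.distrib sum_divide_distrib[symmetric])
  then have "path_weight t k = t / (1 - t)\<^sup>2 * (real k - 2 * ?S / (1 + t ^ (k + 1)))"
    unfolding path_weight_def path_entry_def by (simp only: sum_distrib_left[symmetric] sum_subtractf) simp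
  also have "2 * ?S / (1 + t ^ (k + 1)) = 2 * (t - t ^ (k + 1)) / ((1 - t) * (1 + t ^ (k + 1)))"
    using sum_powers_from_1[of t k] t by simp
  finally show ?thesis .
qed

lemma path_weight_0 [simp]: "path_weight t 0 = 0"
  by (simp add: path_weight_def)

text \<open>Midpoint concavity of 1 / (1 + e^y) in y, valid where e^y < 1. After
  cross-multiplication the difference is the positive product
  \<open>s * (1 - t)\<^sup>2 * (1 - t * s)\<close>.\<close>

lemma recip_concave:
  fixes s t :: real
  assumes "0 < s" "s < 1" "0 < t" "t < 1"
  shows "1 / (1 + s) + 1 / (1 + t\<^sup>2 * s) < 2 / (1 + t * s)"
proof -
  have pos: "1 + s > 0" "1 + t * s > 0" "1 + t\<^sup>2 * s > 0" using assms by (simp_all add: add_pos_pos)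
  have ts: "t * s < 1" using mult_strict_mono[of t 1 s 1] assms by simp
  have "2 * ((1 + s) * (1 + t\<^sup>2 * s)) - (1 + t * s) * ((1 + t\<^sup>2 * s) + (1 + s)) = s * (1 - t)\<^sup>2 * (1 - t * s)"
    by (simp add: algebra_simps power2_eq_square)
  moreover have "s * (1 - t)\<^sup>2 * (1 - t * s) > 0" using assms ts by simp
  ultimately have "(1 + t * s) * ((1 + t\<^sup>2 * s) + (1 + s)) < 2 * ((1 + s) * (1 + t\<^sup>2 * s))" by linarith
  moreover have "1 / (1 + s) + 1 / (1 + t\<^sup>2 * s) = ((1 + t\<^sup>2 * s) + (1 + s)) / ((1 + s) * (1 + t\<^sup>2 * s))"
    using pos by (simp add: add_divide_eq_iff divide_add_eq_iff field_simps)
  ultimately show ?thesis using pos by (simp add: divide_less_eq less_divide_eq mult.commute mult.left_commute)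
qed

text \<open>Only the boundary term is nonlinear in \<open>k\<close>, and it is an affine function of
  \<open>1 / (1 + t ^ (k + 1))\<close>. It enters with a negative sign, so its concavity is
  convexity of the weight.\<close>

lemma path_weight_strict_convex:
  assumes t: "0 < t" "t < 1"
  shows "path_weight t (k + 1) - path_weight t k < path_weight t (k + 2) - path_weight t (k + 1)"
proof -
  define s where "s = t ^ (k + 1)"
  have s: "0 < s" "s < 1" using t by (simp_all add: s_def power_less_one_iff del: power_Suc)
  define q where "q r = (t - r) / (1 + r)" for r
  have q: "q r = (1 + t) * (1 / (1 + r)) - 1" if "r > 0" for r using that by (simp add: q_def field_simps)
  have "path_weight t (k + i) = t / (1 - t)\<^sup>2 * (real (k + i) - 2 / (1 - t) * q (t ^ i * s))" for i
    using path_weight_closed[OF t, of "k + i"] by (simp add: q_def s_def power_add mult.commute mult.left_commute)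
  from this[of 0] this[of 1] this[of 2]
  have w: "path_weight t k = t / (1 - t)\<^sup>2 * (real k - 2 / (1 - t) * q s)"
    "path_weight t (k + 1) = t / (1 - t)\<^sup>2 * (real k + 1 - 2 / (1 - t) * q (t * s))"
    "path_weight t (k + 2) = t / (1 - t)\<^sup>2 * (real k + 2 - 2 / (1 - t) * q (t\<^sup>2 * s))" by simp_all
  have "q s + q (t\<^sup>2 * s) < 2 * q (t * s)"
  proof -
    define A B C where "A = 1 / (1 + s)" and "B = 1 / (1 + t\<^sup>2 * s)" and "C = 1 / (1 + t * s)"
    have "A + B < 2 * C" using recip_concave[OF s t] by (simp add: A_def B_def C_def)
    then have "(1 + t) * (A + B) < (1 + t) * (2 * C)" by (rule mult_strict_left_mono) (use t in simp)
    moreover have "q s = (1 + t) * A - 1" "q (t * s) = (1 + t) * C - 1" "q (t\<^sup>2 * s) = (1 + t) * B - 1"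
      unfolding A_def B_def C_def using s t by (simp_all add: q)
    ultimately show ?thesis by (simp add: algebra_simps)
  qed
  then have "2 / (1 - t) * (q s + q (t\<^sup>2 * s)) < 2 / (1 - t) * (2 * q (t * s))"
    by (rule mult_strict_left_mono) (use t in simp)
  then have "(2 * (real k + 1) - 2 / (1 - t) * (2 * q (t * s))) < (2 * real k + 2 - 2 / (1 - t) * (q s + q (t\<^sup>2 * s)))"
    by simp
  then have "t / (1 - t)\<^sup>2 * (2 * (real k + 1) - 2 / (1 - t) * (2 * q (t * s)))
      < t / (1 - t)\<^sup>2 * (2 * real k + 2 - 2 / (1 - t) * (q s + q (t\<^sup>2 * s)))"
    by (rule mult_strict_left_mono) (use t in simp)
  moreover define c d where "c = t / (1 - t)\<^sup>2" and "d = 2 / (1 - t)"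
  ultimately have "c * (2 * (real k + 1) - d * (2 * q (t * s))) < c * (2 * real k + 2 - d * (q s + q (t\<^sup>2 * s)))"
    by simp
  then show ?thesis unfolding w c_def[symmetric] d_def[symmetric] by (simp add: algebra_simps)
qed

text \<open>The loss against a linear weight grows with \<open>k\<close>: it equals
  \<open>2 * t / (1 + t\<^sup>2)\<close> at \<open>k = 1\<close> and tends to
  \<open>2 * t / (1 - t)\<close> for long paths.\<close>

lemma path_weight_bounds:
  assumes t: "0 < t" "t < 1" and k: "k \<ge> 1"
  shows "path_weight t k \<le> t / (1 - t)\<^sup>2 * (real k - 2 * t / (1 + t\<^sup>2))"
    and "t / (1 - t)\<^sup>2 * (real k - 2 * t / (1 - t)) \<le> path_weight t k"
proof -
  define s where "s = t ^ (k + 1)"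
  have s: "0 < s" "s \<le> t\<^sup>2"
    unfolding s_def using t k power_decreasing[of 2 "k + 1" t] by auto
  have w: "path_weight t k = t / (1 - t)\<^sup>2 * (real k - 2 * (t - s) / ((1 - t) * (1 + s)))"
    using path_weight_closed[OF t] by (simp add: s_def)
  have c: "0 \<le> t / (1 - t)\<^sup>2" using t by simp
  have "2 * (t - s) / ((1 - t) * (1 + s)) \<le> 2 * t / (1 - t)"
  proof -
    have "(t - s) / (1 + s) \<le> t" using s t by (simp add: divide_le_eq algebra_simps)
    then have "2 / (1 - t) * ((t - s) / (1 + s)) \<le> 2 / (1 - t) * t" using t by (intro mult_left_mono) auto
    then show ?thesis by simp
  qed
  then show "t / (1 - t)\<^sup>2 * (real k - 2 * t / (1 - t)) \<le> path_weight t k"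
    unfolding w using c by (intro mult_left_mono) auto
  have "2 * t / (1 + t\<^sup>2) \<le> 2 * (t - s) / ((1 - t) * (1 + s))"
  proof -
    have "(t - t\<^sup>2) * (1 + s) \<le> (t - s) * (1 + t\<^sup>2)"
    proof -
      have "(t - s) * (1 + t\<^sup>2) - (t - t\<^sup>2) * (1 + s) = (1 + t) * (t\<^sup>2 - s)"
        by (simp add: algebra_simps power2_eq_square)
      moreover have "0 \<le> (1 + t) * (t\<^sup>2 - s)" using s t by simp
      ultimately show ?thesis by linarith
    qed
    then have "(t - t\<^sup>2) / (1 + t\<^sup>2) \<le> (t - s) / (1 + s)"
      using s t by (simp add: divide_le_eq le_divide_eq add_pos_pos)
    then have "2 / (1 - t) * ((t - t\<^sup>2) / (1 + t\<^sup>2)) \<le> 2 / (1 - t) * ((t - s) / (1 + s))"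
      using t by (intro mult_left_mono) auto
    moreover have "2 / (1 - t) * ((t - t\<^sup>2) / (1 + t\<^sup>2)) = 2 * t / (1 + t\<^sup>2)"
    proof -
      have "t - t\<^sup>2 = (1 - t) * t" by (simp add: power2_eq_square algebra_simps)
      then show ?thesis using t by simp
    qed
    ultimately show ?thesis by simp
  qed
  then show "path_weight t k \<le> t / (1 - t)\<^sup>2 * (real k - 2 * t / (1 + t\<^sup>2))"
    unfolding w using c by (intro mult_left_mono) auto
qed

subsection \<open>Convex functions of block sizes\<close>

locale strictly_convex_seq =
  fixes \<phi> :: "nat \<Rightarrow> real"
  assumes convex: "\<And>k. \<phi> (k + 1) - \<phi> k < \<phi> (k + 2) - \<phi> (k + 1)" and zero: "\<phi> 0 = 0"
begin

lemma increment_strict_mono: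
  assumes "a < b"
  shows "\<phi> (Suc a) - \<phi> a < \<phi> (Suc b) - \<phi> b"
proof -
  have "strict_mono (\<lambda>k. \<phi> (Suc k) - \<phi> k)"
    by (rule strict_monoI_Suc) (use convex in simp)
  then show ?thesis using assms by (simp add: strict_mono_def)
qed

text \<open>Each single unit moved from the smaller to the larger block gains, since the increments
  increase.\<close>

lemma spread_less: "b \<le> a \<Longrightarrow> 0 < d \<Longrightarrow> d \<le> b \<Longrightarrow> \<phi> a + \<phi> b < \<phi> (a + d) + \<phi> (b - d)"
proof (induction d)
  case (Suc d)
  have inc: "\<phi> (Suc (b - Suc d)) - \<phi> (b - Suc d) < \<phi> (Suc (a + d)) - \<phi> (a + d)"
    by (rule increment_strict_mono) (use Suc.prems in simp)
  have e: "Suc (b - Suc d) = b - d" using Suc.prems by simp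
  show ?case
  proof (cases "d = 0")
    case True
    then show ?thesis using inc e by simp
  next
    case False
    then have "\<phi> a + \<phi> b < \<phi> (a + d) + \<phi> (b - d)" using Suc by simp
    then show ?thesis using inc unfolding e by simp
  qed
qed simp

definition packed :: "nat \<Rightarrow> nat \<Rightarrow> real" where
  "packed N S = real (S div N) * \<phi> N + \<phi> (S mod N)"

text \<open>The new block is combined with the remainder block. If both together stay below
  \<open>N\<close>, they fuse and leave a block of order 0, worth nothing by \<open>zero\<close>;
  otherwise units are moved until one block is full. Both are instances of
  \<open>spread_less\<close>.\<close>

lemma packed_step:
  assumes "0 < N" "k \<le> N"
  shows "packed N S + \<phi> k \<le> packed N (S + k)"
    and "0 < k \<Longrightarrow> k < N \<Longrightarrow> 0 < S mod N \<Longrightarrow> packed N S + \<phi> k < packed N (S + k)"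
proof -
  define r where "r = S mod N"
  define q where "q = S div N"
  have S: "S = q * N + r" "r < N" using assms(1) by (auto simp: q_def r_def)
  have *: "packed N S + \<phi> k \<le> packed N (S + k) \<and>
     (0 < k \<longrightarrow> k < N \<longrightarrow> 0 < r \<longrightarrow> packed N S + \<phi> k < packed N (S + k))"
  proof (cases "r + k < N")
    case True
    have "(S + k) div N = q" "(S + k) mod N = r + k"
      using True assms(1) unfolding S(1) by (simp_all add: add.assoc)
    then have p: "packed N (S + k) = real q * \<phi> N + \<phi> (r + k)" by (simp add: packed_def)
    have "\<phi> r + \<phi> k \<le> \<phi> (r + k) \<and> (0 < k \<longrightarrow> 0 < r \<longrightarrow> \<phi> r + \<phi> k < \<phi> (r + k))"
    proof (cases "0 < k \<and> 0 < r")
      case True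
      then show ?thesis
      proof (cases "r \<le> k")
        case True
        then show ?thesis using spread_less[of r k r] \<open>0 < k \<and> 0 < r\<close> zero by (simp add: add.commute)
      next
        case False
        then show ?thesis using spread_less[of k r k] \<open>0 < k \<and> 0 < r\<close> zero by (simp add: add.commute)
      qed
    qed (use zero in auto)
    then show ?thesis unfolding p by (simp add: packed_def q_def r_def)
  next
    case False
    define r' where "r' = r + k - N"
    have r': "r' < N" "r + k = N + r'" using False S(2) assms(2) by (auto simp: r'_def)
    have Sk: "S + k = (q + 1) * N + r'" using S(1) r'(2) by simp
    have "(S + k) div N = q + 1" "(S + k) mod N = r'"
      unfolding Sk using r'(1) assms(1) div_mult_self3[of N "q + 1" r'] mod_mult_self3[of "q + 1" N r']
      by (simp_all only: div_less mod_less)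
    then have p: "packed N (S + k) = real (q + 1) * \<phi> N + \<phi> r'" by (simp add: packed_def)
    have "\<phi> r + \<phi> k \<le> \<phi> N + \<phi> r' \<and> (k < N \<longrightarrow> \<phi> r + \<phi> k < \<phi> N + \<phi> r')"
    proof (cases "k = N")
      case True
      then show ?thesis using r' by simp
    next
      case kN: False
      show ?thesis
      proof (cases "r \<le> k")
        case True
        have "N = k + (N - k)" "r' = r - (N - k)" using assms(2) by (auto simp: r'_def)
        moreover have "N - k \<le> r" using False by linarith
        ultimately show ?thesis using spread_less[of r k "N - k"] True kN assms(2) by simp
      next
        case rk: False
        have "N = r + (N - r)" "r' = k - (N - r)" using S(2) by (auto simp: r'_def)
        moreover have "N - r \<le> k" using False by linarith
        ultimately show ?thesis using spread_less[of k r "N - r"] rk S(2) by simp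
      qed
    qed
    then show ?thesis unfolding p by (auto simp: packed_def q_def r_def algebra_simps)
  qed
  then show "packed N S + \<phi> k \<le> packed N (S + k)"
    and "0 < k \<Longrightarrow> k < N \<Longrightarrow> 0 < S mod N \<Longrightarrow> packed N S + \<phi> k < packed N (S + k)"
    by (auto simp: r_def)
qed

lemma packed_list:
  assumes "0 < N" "\<forall>k\<in>set ks. k \<le> N"
  shows "packed N S + sum_list (map \<phi> ks) \<le> packed N (S + sum_list ks)"
  using assms(2)
proof (induction ks arbitrary: S)
  case (Cons k ks)
  then have "packed N (S + k) + sum_list (map \<phi> ks) \<le> packed N (S + k + sum_list ks)" by simp
  moreover have "packed N S + \<phi> k \<le> packed N (S + k)" using packed_step(1)[OF assms(1)] Cons by simp
  ultimately show ?case by (simp add: add.assoc)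
qed simp

lemma packed_0 [simp]: "packed N 0 = 0"
  by (simp add: packed_def zero)

lemma sum_list_le_packed:
  assumes "0 < N" "\<forall>k\<in>set ks. k \<le> N"
  shows "sum_list (map \<phi> ks) \<le> packed N (sum_list ks)"
  using packed_list[OF assms, of 0] by simp

text \<open>Two blocks below \<open>N\<close> could be packed with strict gain, so at most one block
  is not full, and its order must be the remainder.\<close>

lemma sum_list_eq_packed:
  assumes N: "0 < N" and ks: "\<forall>k\<in>set ks. 0 < k \<and> k \<le> N"
    and eq: "sum_list (map \<phi> ks) = packed N (sum_list ks)"
  shows "mset ks = replicate_mset (sum_list ks div N) N + (if sum_list ks mod N = 0 then {#} else {#sum_list ks mod N#})"
proof -
  define small where "small = filter (\<lambda>k. k < N) ks"
  define full where "full = filter (\<lambda>k. \<not> k < N) ks"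
  have fullN: "k = N" if "k \<in> set full" for k using that ks by (auto simp: full_def)
  have ms: "mset ks = mset small + mset full" by (simp add: small_def full_def)
  have mf: "mset full = replicate_mset (length full) N"
    using fullN by (induction full) auto
  have ss: "sum_list ks = sum_list small + length full * N"
  proof -
    have "sum_list ks = sum_mset (mset ks)" by (simp add: sum_mset_sum_list)
    also have "\<dots> = sum_list small + sum_mset (replicate_mset (length full) N)"
      unfolding ms mf[symmetric] by (simp add: sum_mset_sum_list)
    finally show ?thesis by simp
  qed
  have "length small \<le> 1"
  proof (rule ccontr)
    assume "\<not> length small \<le> 1"
    then obtain a b rest where abr: "small = a # b # rest"
      by (cases small; cases "tl small") auto
    have "\<forall>k\<in>set small. 0 < k \<and> k < N" using ks by (auto simp: small_def)
    then have ab: "0 < a" "a < N" "0 < b" "b < N" and rest: "\<forall>k\<in>set rest. k \<le> N"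
      unfolding abr by auto
    let ?R = "rest @ full"
    have R: "\<forall>k\<in>set ?R. k \<le> N" using rest fullN by auto
    have mk: "mset ks = mset (a # b # ?R)" unfolding ms abr by simp
    have s1: "sum_list (map \<phi> ks) = \<phi> a + \<phi> b + sum_list (map \<phi> ?R)"
    proof -
      have "sum_list (map \<phi> ks) = sum_mset (image_mset \<phi> (mset ks))" by (simp add: sum_mset_sum_list[symmetric])
      also have "\<dots> = \<phi> a + \<phi> b + sum_mset (image_mset \<phi> (mset ?R))" unfolding mk by (simp add: add.assoc)
      also have "sum_mset (image_mset \<phi> (mset ?R)) = sum_list (map \<phi> ?R)" by (metis mset_map sum_mset_sum_list)
      finally show ?thesis .
    qed
    have s2: "sum_list ks = a + b + sum_list ?R"
    proof -
      have "sum_list ks = sum_mset (mset ks)" by (simp add: sum_mset_sum_list)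
      also have "\<dots> = a + b + sum_mset (mset ?R)" unfolding mk by (simp add: add.assoc)
      finally show ?thesis by (simp add: sum_mset_sum_list)
    qed
    have "packed N a = \<phi> a" using ab by (simp add: packed_def)
    then have "\<phi> a + \<phi> b < packed N (a + b)" using packed_step(2)[OF N, of b a] ab by simp
    moreover have "packed N (a + b) + sum_list (map \<phi> ?R) \<le> packed N (a + b + sum_list ?R)"
      by (rule packed_list[OF N R])
    ultimately show False using eq unfolding s1 s2 by simp
  qed
  then consider "small = []" | a where "small = [a]"
    by (cases small) auto
  then show ?thesis
  proof cases
    case 1
    then show ?thesis using ms mf ss N by simp
  next
    case 2
    then have "0 < a" "a < N" using ks by (auto simp: small_def filter_eq_Cons_iff)
    then show ?thesis using ms mf ss N 2 by simp
  qed
qed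

end

subsection \<open>Linear forests\<close>

definition forest_edges :: "'a list list \<Rightarrow> 'a set set" where
  "forest_edges ps = (\<Union>p\<in>set ps. path_edges p)"

lemma longest_path_end_edges:
  assumes gr: "graph_edges W H" and acyc: "\<And>xs. \<not> is_cycle W H xs"
    and p: "is_path W H (x # r)" "\<And>ys. is_path W H ys \<Longrightarrow> length ys \<le> length (x # r)"
    and e: "e \<in> H" "x \<in> e"
  shows "e \<in> path_edges (x # r)"
proof -
  obtain y where y: "y \<in> W" "y \<noteq> x" "e = {x, y}" using graph_edges_other[OF gr e] by metis
  then have "y \<in> set r" using longest_path_neighbour[of W H x r y] p e by auto
  then obtain x1 r' where r: "r = x1 # r'" by (cases r) auto
  have "y \<notin> set r'"
  proof
    assume "y \<in> set r'"
    then obtain xs where "is_cycle W H xs"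
      using path_chord_cycle[of W H x x1 r' y] p(1) y(3) e(1) r by auto
    then show False using acyc by blast
  qed
  then show ?thesis using \<open>y \<in> set r\<close> r y by auto
qed

text \<open>A longest path is a whole component: at an end by maximality and acyclicity, at an inner
  vertex because its two path edges already exhaust the degree.\<close>

lemma longest_path_closed:
  assumes gr: "graph_edges W H" and acyc: "\<And>xs. \<not> is_cycle W H xs"
    and deg: "\<And>s. s \<in> W \<Longrightarrow> card {e\<in>H. s \<in> e} \<le> 2"
    and p: "is_path W H p" "\<And>ys. is_path W H ys \<Longrightarrow> length ys \<le> length p"
    and e: "e \<in> H" "s \<in> e" "s \<in> set p"
  shows "e \<in> path_edges p"
proof -
  obtain A B where AB: "p = A @ s # B" using e(3) by (meson split_list)
  show ?thesis
  proof (cases "A = []")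
    case True
    then show ?thesis using longest_path_end_edges[OF gr acyc, of s B e] p e AB by simp
  next
    case A: False
    show ?thesis
    proof (cases "B = []")
      case True
      have "is_path W H (s # rev A)" using p(1) is_path_rev[of W H p] AB True by simp
      moreover have "length ys \<le> length (s # rev A)" if "is_path W H ys" for ys
        using p(2)[OF that] AB True by simp
      ultimately have "e \<in> path_edges (s # rev A)" using longest_path_end_edges[OF gr acyc] e by blast
      then have "e \<in> path_edges (rev p)" using AB True by simp
      then show ?thesis by (simp add: path_edges_rev)
    next
      case B: False
      obtain A' a where A': "A = A' @ [a]" using A by (metis rev_exhaust)
      obtain b B' where B': "B = b # B'" using B by (cases B) auto
      have pp: "p = A' @ a # s # b # B'" using AB A' B' by simp
      have sub: "{{a, s}, {s, b}} \<subseteq> path_edges p"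
        unfolding pp using path_edges_append[of A' a "s # b # B'"] by auto
      have "distinct p" "path_edges p \<subseteq> H" "set p \<subseteq> W" using p(1) by (auto simp: is_path_def)
      then have "{a, s} \<noteq> {s, b}" "s \<in> W" using pp by (auto simp: doubleton_eq_iff)
      then have c2: "card {{a, s}, {s, b}} = 2" by simp
      have "{{a, s}, {s, b}} \<subseteq> {e\<in>H. s \<in> e}" using sub \<open>path_edges p \<subseteq> H\<close> by auto
      moreover have "finite {e\<in>H. s \<in> e}" using graph_edges_finite[OF gr] by simp
      ultimately have "{{a, s}, {s, b}} = {e\<in>H. s \<in> e}"
        using card_seteq deg[OF \<open>s \<in> W\<close>] c2 by metis
      then show ?thesis using sub e by blast
    qed
  qed
qed

lemma linear_forest_decomposition:
  assumes "graph_edges W H" "\<And>s. s \<in> W \<Longrightarrow> card {e\<in>H. s \<in> e} \<le> 2" "\<And>xs. \<not> is_cycle W H xs"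
  shows "\<exists>ps. distinct (concat ps) \<and> set (concat ps) = W \<and> [] \<notin> set ps \<and> forest_edges ps = H"
  using assms
proof (induction "card W" arbitrary: W H rule: less_induct)
  case less
  note gr = less.prems(1) and deg = less.prems(2) and acyc = less.prems(3)
  have fin: "finite W" using gr by (simp add: graph_edges_def)
  show ?case
  proof (cases "W = {}")
    case True
    then have "H = {}" using gr by (auto simp: graph_edges_def)
    then show ?thesis using True by (intro exI[of _ "[]"]) (simp add: forest_edges_def)
  next
    case False
    obtain p where p: "is_path W H p" "\<And>ys. is_path W H ys \<Longrightarrow> length ys \<le> length p"
      using longest_path_exists[OF fin False] by blast
    have pp: "p \<noteq> []" "distinct p" "set p \<subseteq> W" "path_edges p \<subseteq> H" using p(1) by (auto simp: is_path_def)
    let ?W = "W - set p" let ?H = "H - path_edges p"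
    have closed: "e \<in> path_edges p" if "e \<in> H" "s \<in> e" "s \<in> set p" for e s
      by (rule longest_path_closed[OF gr acyc deg p that])
    have eW: "e \<subseteq> ?W" if "e \<in> ?H" for e using that closed graph_edges_vertex[OF gr] by blast
    have gr': "graph_edges ?W ?H" by (rule graph_edges_subset[OF gr _ _ eW]) auto
    have "card ?W < card W" using pp fin by (intro psubset_card_mono) (auto simp: neq_Nil_conv)
    moreover have "card {e\<in>?H. s \<in> e} \<le> 2" if "s \<in> ?W" for s
    proof -
      have "card {e\<in>?H. s \<in> e} \<le> card {e\<in>H. s \<in> e}"
        by (rule card_mono) (use graph_edges_finite[OF gr] in auto)
      then show ?thesis using deg[of s] that by simp
    qed
    moreover have "\<not> is_cycle ?W ?H xs" for xs using acyc is_cycle_subgraph[of ?W ?H xs W H] by blast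
    ultimately obtain ps where ps: "distinct (concat ps)" "set (concat ps) = ?W" "[] \<notin> set ps" "forest_edges ps = ?H"
      using less.hyps[OF _ gr'] by blast
    have "distinct (concat (p # ps))" using pp ps by auto
    moreover have "set (concat (p # ps)) = W" using pp ps by auto
    moreover have "[] \<notin> set (p # ps)" using pp ps by auto
    moreover have "forest_edges (p # ps) = H" using pp(4) ps(4) by (auto simp: forest_edges_def)
    ultimately show ?thesis by blast
  qed
qed

lemma path_edges_nth: "path_edges xs = {{xs ! i, xs ! Suc i} | i. Suc i < length xs}"
proof (induction xs rule: path_edges.induct)
  case (1 x y zs)
  have "{{(x # y # zs) ! i, (x # y # zs) ! Suc i} | i. Suc i < length (x # y # zs)}
      = insert {x, y} {{(y # zs) ! i, (y # zs) ! Suc i} | i. Suc i < length (y # zs)}" (is "?L = ?R")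
  proof (rule subset_antisym; rule subsetI)
    fix e assume "e \<in> ?L"
    then obtain i where i: "Suc i < length (x # y # zs)" "e = {(x # y # zs) ! i, (x # y # zs) ! Suc i}" by blast
    show "e \<in> ?R"
    proof (cases i)
      case 0
      then show ?thesis using i by simp
    next
      case (Suc j)
      then have "Suc j < length (y # zs) \<and> e = {(y # zs) ! j, (y # zs) ! Suc j}" using i by simp
      then show ?thesis by blast
    qed
  next
    fix e assume "e \<in> ?R"
    then consider "e = {x, y}" | j where "Suc j < length (y # zs)" "e = {(y # zs) ! j, (y # zs) ! Suc j}" by blast
    then show "e \<in> ?L"
    proof cases
      case 1
      then show ?thesis by (intro CollectI exI[of _ 0]) simp
    next
      case 2
      then show ?thesis by (intro CollectI exI[of _ "Suc j"]) simp
    qed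
  qed
  then show ?case using 1 by simp
qed auto

subsection \<open>Spectral radius of a double cone over a linear forest\<close>

definition cone_vertices :: "'a \<Rightarrow> 'a \<Rightarrow> 'a list list \<Rightarrow> 'a set" where
  "cone_vertices u v ps = insert u (insert v (set (concat ps)))"

definition forest_cone :: "'a \<Rightarrow> 'a \<Rightarrow> 'a list list \<Rightarrow> 'a set set" where
  "forest_cone u v ps = cone_edges u v (set (concat ps)) (forest_edges ps)"

definition forest_weight :: "real \<Rightarrow> 'a list list \<Rightarrow> real" where
  "forest_weight t ps = sum_list (map (path_weight t) (map length ps))"

lemma nth_in_concat: "p \<in> set ps \<Longrightarrow> i < length p \<Longrightarrow> p ! i \<in> set (concat ps)"
  unfolding set_concat by (rule UN_I) (assumption, rule nth_mem)

lemma in_concat_nth: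
  assumes "s \<in> set (concat ps)"
  obtains p i where "p \<in> set ps" "i < length p" "s = p ! i"
proof -
  obtain p where p: "p \<in> set ps" "s \<in> set p" using assms by auto
  then obtain i where "i < length p" "p ! i = s" unfolding in_set_conv_nth[of s p] by blast
  then show ?thesis using that p by blast
qed

text \<open>Positions on disjoint lists can carry independent values; the default \<open>c\<close>
  will serve as the value at the two apexes.\<close>

lemma values_along_paths:
  assumes "distinct (concat ps)"
  obtains z :: "'a \<Rightarrow> real" where "\<And>p i. p \<in> set ps \<Longrightarrow> i < length p \<Longrightarrow> z (p ! i) = g p i"
    "\<And>w. w \<notin> set (concat ps) \<Longrightarrow> z w = c"
proof -
  have "\<exists>z. (\<forall>p\<in>set ps. \<forall>i<length p. z (p ! i) = g p i) \<and> (\<forall>w. w \<notin> set (concat ps) \<longrightarrow> z w = c)"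
    using assms
  proof (induction ps)
    case Nil
    then show ?case by (intro exI[of _ "\<lambda>_. c"]) simp
  next
    case (Cons p ps)
    then obtain z where z: "\<forall>p\<in>set ps. \<forall>i<length p. z (p ! i) = g p i" "\<forall>w. w \<notin> set (concat ps) \<longrightarrow> z w = c"
      by auto
    have dp: "distinct p" "set p \<inter> set (concat ps) = {}" using Cons.prems by auto
    define z' where "z' w = (if w \<in> set p then the (map_of (zip p (map (g p) [0..<length p])) w) else z w)" for w
    have "z' (p ! i) = g p i" if "i < length p" for i
      using map_of_zip_nth[of p "map (g p) [0..<length p]" i] dp(1) that by (simp add: z'_def)
    moreover have "z' (q ! i) = g q i" if "q \<in> set ps" "i < length q" for q i
    proof -
      have "q ! i \<in> set (concat ps)" by (rule nth_in_concat[OF that])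
      then have "q ! i \<notin> set p" using dp(2) by blast
      then show ?thesis using z(1) that by (simp add: z'_def)
    qed
    moreover have "z' w = c" if "w \<notin> set (concat (p # ps))" for w using that z(2) by (simp add: z'_def)
    ultimately show ?case by (intro exI[of _ z']) auto
  qed
  then show ?thesis using that by blast
qed

lemma same_path:
  assumes "distinct (concat ps)" "p \<in> set ps" "q \<in> set ps" "w \<in> set p" "w \<in> set q"
  shows "p = q"
  using assms by (induction ps) (auto simp: disjoint_iff)

lemma sum_set_concat:
  fixes z :: "'a \<Rightarrow> real"
  assumes "distinct (concat ps)"
  shows "(\<Sum>w\<in>set (concat ps). z w) = sum_list (map (\<lambda>p. \<Sum>i<length p. z (p ! i)) ps)"
proof -
  have "(\<Sum>w\<in>set (concat ps). z w) = sum_list (map z (concat ps))"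
    by (rule sum_list_distinct_conv_sum_set[OF assms, symmetric])
  also have "\<dots> = sum_list (map (\<lambda>p. sum_list (map z p)) ps)"
    by (induction ps) auto
  also have "\<dots> = sum_list (map (\<lambda>p. \<Sum>i<length p. z (p ! i)) ps)"
    by (simp add: sum_list_sum_nth atLeast0LessThan)
  finally show ?thesis .
qed

text \<open>Disjointness of the paths confines the edges at a vertex to its own path, and
  distinctness confines them to the adjacent positions.\<close>

lemma forest_nbrs:
  assumes d: "distinct (concat ps)" and p: "p \<in> set ps" "i < length p"
  shows "{w. {w, p ! i} \<in> forest_edges ps}
    = (if 0 < i then {p ! (i - 1)} else {}) \<union> (if Suc i < length p then {p ! Suc i} else {})"
proof -
  have dp: "distinct p" using d p by (auto simp: distinct_concat_iff)
  have "{w, p ! i} \<in> forest_edges ps \<longleftrightarrow> {w, p ! i} \<in> path_edges p" for w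
  proof
    assume "{w, p ! i} \<in> forest_edges ps"
    then obtain q where q: "q \<in> set ps" "{w, p ! i} \<in> path_edges q" by (auto simp: forest_edges_def)
    then have "p ! i \<in> set q" using path_edges_subset by blast
    then have "p = q" using same_path[OF d p(1) q(1) nth_mem[OF p(2)]] by blast
    then show "{w, p ! i} \<in> path_edges p" using q by simp
  qed (use p in \<open>auto simp: forest_edges_def\<close>)
  moreover have "{w, p ! i} \<in> path_edges p \<longleftrightarrow> (0 < i \<and> w = p ! (i - 1)) \<or> (Suc i < length p \<and> w = p ! Suc i)" for w
  proof
    assume "{w, p ! i} \<in> path_edges p"
    then obtain j where j: "Suc j < length p" "{w, p ! i} = {p ! j, p ! Suc j}" by (auto simp: path_edges_nth)
    then consider "w = p ! j" "p ! i = p ! Suc j" | "w = p ! Suc j" "p ! i = p ! j" by (auto simp: doubleton_eq_iff)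
    then show "(0 < i \<and> w = p ! (i - 1)) \<or> (Suc i < length p \<and> w = p ! Suc i)"
    proof cases
      case 1
      then have "i = Suc j" using nth_eq_iff_index_eq[OF dp, of i "Suc j"] p j by simp
      then show ?thesis using 1 by simp
    next
      case 2
      then have "i = j" using nth_eq_iff_index_eq[OF dp, of i j] p j by simp
      then show ?thesis using 2 j by simp
    qed
  next
    assume "(0 < i \<and> w = p ! (i - 1)) \<or> (Suc i < length p \<and> w = p ! Suc i)"
    then show "{w, p ! i} \<in> path_edges p"
    proof (elim disjE conjE)
      assume "0 < i" "w = p ! (i - 1)"
      then show ?thesis unfolding path_edges_nth using p(2) by (intro CollectI exI[of _ "i - 1"]) auto
    next
      assume "Suc i < length p" "w = p ! Suc i"
      then show ?thesis unfolding path_edges_nth by (intro CollectI exI[of _ i]) (auto simp: insert_commute)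
    qed
  qed
  ultimately show ?thesis by auto
qed

lemma forest_graph:
  assumes "distinct (concat ps)"
  shows "graph_edges (set (concat ps)) (forest_edges ps)"
  unfolding graph_edges_def
proof (intro conjI ballI)
  fix e assume "e \<in> forest_edges ps"
  then obtain p i where p: "p \<in> set ps" "Suc i < length p" "e = {p ! i, p ! Suc i}"
    by (auto simp: forest_edges_def path_edges_nth)
  moreover have "distinct p" using assms p by (auto simp: distinct_concat_iff)
  ultimately have "p ! i \<noteq> p ! Suc i" using nth_eq_iff_index_eq[of p i "Suc i"] by simp
  moreover have "p ! i \<in> set (concat ps)" "p ! Suc i \<in> set (concat ps)"
    using nth_in_concat[OF p(1)] p(2) by simp_all
  ultimately show "\<exists>a b. a \<in> set (concat ps) \<and> b \<in> set (concat ps) \<and> a \<noteq> b \<and> e = {a, b}"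
    using p(3) by blast
qed simp

lemma forest_cone_graph:
  assumes "distinct (u # v # concat ps)"
  shows "graph_edges (cone_vertices u v ps) (forest_cone u v ps)"
  unfolding cone_vertices_def forest_cone_def
  by (rule cone_edges_graph[OF forest_graph]) (use assms in auto)

lemma forest_cone_nbrs:
  assumes d: "distinct (u # v # concat ps)"
  shows "nbrs (cone_vertices u v ps) (forest_cone u v ps) u = insert v (set (concat ps))"
    and "nbrs (cone_vertices u v ps) (forest_cone u v ps) v = insert u (set (concat ps))"
    and "p \<in> set ps \<Longrightarrow> i < length p \<Longrightarrow>
       nbrs (cone_vertices u v ps) (forest_cone u v ps) (p ! i)
        = {u, v} \<union> ((if 0 < i then {p ! (i - 1)} else {}) \<union> (if Suc i < length p then {p ! Suc i} else {}))"
proof -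
  let ?W = "set (concat ps)" let ?E = "forest_cone u v ps"
  have nW: "u \<notin> ?W" "v \<notin> ?W" "u \<noteq> v" using d by auto
  have dc: "distinct (concat ps)" using d by simp
  have sub: "e \<subseteq> ?W" if "e \<in> forest_edges ps" for e
    using that graph_edges_vertex[OF forest_graph[OF dc]] by blast
  have nF: "{a, u} \<notin> forest_edges ps" "{a, v} \<notin> forest_edges ps" for a
    using sub[of "{a, u}"] sub[of "{a, v}"] nW by auto
  have au: "{a, u} \<in> ?E \<longleftrightarrow> a = v \<or> a \<in> ?W" for a
    using nF nW by (auto simp: forest_cone_def cone_edges_def doubleton_eq_iff image_iff)
  have av: "{a, v} \<in> ?E \<longleftrightarrow> a = u \<or> a \<in> ?W" for a
    using nF nW by (auto simp: forest_cone_def cone_edges_def doubleton_eq_iff image_iff)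
  show "nbrs (cone_vertices u v ps) ?E u = insert v ?W" "nbrs (cone_vertices u v ps) ?E v = insert u ?W"
    unfolding nbrs_def au av cone_vertices_def by auto
  assume p: "p \<in> set ps" "i < length p"
  have s: "p ! i \<in> ?W" by (rule nth_in_concat[OF p])
  then have ns: "p ! i \<noteq> u" "p ! i \<noteq> v" using nW by blast+
  have as: "{a, p ! i} \<in> ?E \<longleftrightarrow> a = u \<or> a = v \<or> {a, p ! i} \<in> forest_edges ps" for a
    using s ns nW by (auto simp: forest_cone_def cone_edges_def doubleton_eq_iff image_iff)
  have "nbrs (cone_vertices u v ps) ?E (p ! i) = {u, v} \<union> {a. {a, p ! i} \<in> forest_edges ps}"
    unfolding nbrs_def as cone_vertices_def using sub by auto
  then show "nbrs (cone_vertices u v ps) ?E (p ! i)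
     = {u, v} \<union> ((if 0 < i then {p ! (i - 1)} else {}) \<union> (if Suc i < length p then {p ! Suc i} else {}))"
    unfolding forest_nbrs[OF dc p] .
qed

text \<open>The vector is 1 at both apexes and twice the path solution along each path, as every
  path vertex sees both apexes. The eigenvalue equation then holds on all paths; only the sums at
  the apexes depend on the forest.\<close>

lemma cone_vector:
  assumes d: "distinct (u # v # concat ps)" and t: "0 < t" "t < 1"
  defines "V \<equiv> cone_vertices u v ps" and "E \<equiv> forest_cone u v ps"
  obtains z where "z u = 1" "z v = 1"
    "(\<Sum>w\<in>nbrs V E u. z w) = 1 + 2 * forest_weight t ps"
    "(\<Sum>w\<in>nbrs V E v. z w) = 1 + 2 * forest_weight t ps"
    "\<And>s. s \<in> set (concat ps) \<Longrightarrow> (\<Sum>w\<in>nbrs V E s. z w) = (t + 1 / t) * z s"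
proof -
  let ?W = "set (concat ps)"
  have dc: "distinct (concat ps)" and nW: "u \<notin> ?W" "v \<notin> ?W" "u \<noteq> v" using d by auto
  obtain z where z: "\<And>p i. p \<in> set ps \<Longrightarrow> i < length p \<Longrightarrow> z (p ! i) = 2 * path_entry t (length p) (Suc i)"
    "\<And>w. w \<notin> ?W \<Longrightarrow> z w = (1::real)"
    using values_along_paths[OF dc, of "\<lambda>p i. 2 * path_entry t (length p) (Suc i)" 1] by blast
  have zuv: "z u = 1" "z v = 1" using z(2) nW by auto
  have "(\<Sum>i<length p. z (p ! i)) = 2 * path_weight t (length p)" if "p \<in> set ps" for p
  proof -
    have "(\<Sum>i<length p. z (p ! i)) = (\<Sum>i<length p. 2 * path_entry t (length p) (Suc i))"
      by (rule sum.cong) (use z(1)[OF that] in auto)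
    also have "\<dots> = 2 * path_weight t (length p)"
      unfolding path_weight_def sum.atLeast1_atMost_eq[simplified] sum_distrib_left[symmetric]
      by (simp add: sum.atLeast1_atMost_eq)
    finally show ?thesis .
  qed
  then have "(\<Sum>w\<in>?W. z w) = sum_list (map (\<lambda>p. 2 * path_weight t (length p)) ps)"
    unfolding sum_set_concat[OF dc] by (metis (no_types, lifting) map_cong)
  also have "\<dots> = 2 * forest_weight t ps" by (simp add: forest_weight_def sum_list_const_mult o_def)
  finally have sW: "(\<Sum>w\<in>?W. z w) = 2 * forest_weight t ps" .
  show ?thesis
  proof (rule that[OF zuv])
    show "(\<Sum>w\<in>nbrs V E u. z w) = 1 + 2 * forest_weight t ps" "(\<Sum>w\<in>nbrs V E v. z w) = 1 + 2 * forest_weight t ps"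
      unfolding V_def E_def forest_cone_nbrs(1,2)[OF d] using nW sW zuv by simp_all
    fix s assume "s \<in> ?W"
    then obtain p i where p: "p \<in> set ps" "i < length p" "s = p ! i" by (rule in_concat_nth)
    have dp: "distinct p" using dc p by (auto simp: distinct_concat_iff)
    let ?A = "if 0 < i then {p ! (i - 1)} else {}" let ?B = "if Suc i < length p then {p ! Suc i} else {}"
    let ?k = "length p"
    have subW: "?A \<union> ?B \<subseteq> ?W"
      using nth_in_concat[OF p(1), of "i - 1"] nth_in_concat[OF p(1), of "Suc i"] p(2)
      by (simp del: set_concat split: if_split)
    have "p ! (i - 1) \<noteq> p ! Suc i" if "Suc i < ?k"
      using nth_eq_iff_index_eq[OF dp, of "i - 1" "Suc i"] that by simp
    then have disj: "?A \<inter> ?B = {}" by auto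
    \<comment> \<open>At an end of the path a neighbour is missing; the zero boundary value of
      \<open>path_entry\<close> stands in for it, here and in \<open>B\<close>.\<close>
    have A: "(\<Sum>w\<in>?A. z w) = 2 * path_entry t ?k i"
      using z(1)[OF p(1), of "i - 1"] p(2) path_entry_boundary(1)[OF t(1)] by auto
    have B: "(\<Sum>w\<in>?B. z w) = 2 * path_entry t ?k (Suc (Suc i))"
    proof (cases "Suc i < ?k")
      case False
      then have "Suc i = ?k" using p(2) by simp
      then show ?thesis using path_entry_boundary(2)[OF t(1), of ?k] by simp
    qed (use z(1)[OF p(1), of "Suc i"] in auto)
    have "(\<Sum>w\<in>nbrs V E s. z w) = (\<Sum>w\<in>{u, v} \<union> (?A \<union> ?B). z w)"
      unfolding V_def E_def p(3) forest_cone_nbrs(3)[OF d p(1,2)] ..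
    also have "\<dots> = (\<Sum>w\<in>{u, v}. z w) + (\<Sum>w\<in>?A \<union> ?B. z w)"
      by (rule sum.union_disjoint) (use subW nW in auto)
    also have "(\<Sum>w\<in>?A \<union> ?B. z w) = (\<Sum>w\<in>?A. z w) + (\<Sum>w\<in>?B. z w)"
      by (rule sum.union_disjoint) (use disj in auto)
    also have "(\<Sum>w\<in>{u, v}. z w) + ((\<Sum>w\<in>?A. z w) + (\<Sum>w\<in>?B. z w))
       = 2 * (path_entry t ?k i + path_entry t ?k (i + 2) + 1)"
      unfolding A B using zuv nW by simp
    also have "\<dots> = (t + 1 / t) * z s"
      unfolding path_entry_rec[OF t p(2)] using z(1)[OF p(1,2)] p(3) by simp
    finally show "(\<Sum>w\<in>nbrs V E s. z w) = (t + 1 / t) * z s" .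
  qed
qed

lemma sum_cone_vertices:
  fixes f :: "'a \<Rightarrow> real"
  assumes "distinct (u # v # concat ps)"
  shows "(\<Sum>s\<in>cone_vertices u v ps. f s) = f u + f v + (\<Sum>s\<in>set (concat ps). f s)"
  using assms by (simp add: cone_vertices_def)

text \<open>The form is evaluated on the Perron vector \<open>x\<close> and the vector
  \<open>z\<close> from either side. The path vertices cancel, and the equation remains, multiplied
  by \<open>x u + x v\<close>. This factor is positive: were it 0, the equation at \<open>u\<close>
  would force \<open>x = 0\<close> everywhere.\<close>

theorem cone_spectral_radius:
  assumes d: "distinct (u # v # concat ps)" and t: "0 < t" "t < 1"
    and rho: "spectral_radius (cone_vertices u v ps, forest_cone u v ps) = t + 1 / t"
  shows "t + 1 / t = 1 + 2 * forest_weight t ps"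
proof -
  let ?V = "cone_vertices u v ps" let ?E = "forest_cone u v ps" let ?\<rho> = "t + 1 / t" let ?W = "set (concat ps)"
  have fin: "finite ?V" "?V \<noteq> {}" by (auto simp: cone_vertices_def)
  obtain z where z: "z u = 1" "z v = 1"
    "(\<Sum>w\<in>nbrs ?V ?E u. z w) = 1 + 2 * forest_weight t ps"
    "(\<Sum>w\<in>nbrs ?V ?E v. z w) = 1 + 2 * forest_weight t ps"
    "\<And>s. s \<in> ?W \<Longrightarrow> (\<Sum>w\<in>nbrs ?V ?E s. z w) = ?\<rho> * z s"
    using cone_vector[OF d t] by blast
  obtain x where x: "\<And>s. s \<in> ?V \<Longrightarrow> 0 \<le> x s" "\<exists>s\<in>?V. 0 < x s" "\<And>s. s \<in> ?V \<Longrightarrow> (\<Sum>w\<in>nbrs ?V ?E s. x w) = ?\<rho> * x s"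
    using spectral_radius_perron(2)[OF fin, of ?E] unfolding rho by blast
  have uv: "u \<in> ?V" "v \<in> ?V" "?W \<subseteq> ?V" by (auto simp: cone_vertices_def)
  have nW: "u \<notin> ?W" "v \<notin> ?W" "u \<noteq> v" using d by auto
  have pos: "x u + x v > 0"
  proof (rule ccontr)
    assume "\<not> x u + x v > 0"
    then have xx: "x u = 0" "x v = 0" using x(1)[OF uv(1)] x(1)[OF uv(2)] by linarith+
    have "x v + (\<Sum>s\<in>?W. x s) = ?\<rho> * x u" using x(3)[OF uv(1)] nW unfolding forest_cone_nbrs(1)[OF d] by simp
    then have "(\<Sum>s\<in>?W. x s) = 0" using xx by simp
    then have "\<forall>s\<in>?W. x s = 0" using x(1) uv(3) by (subst (asm) sum_nonneg_eq_0_iff) auto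
    then show False using x(2) xx by (auto simp: cone_vertices_def)
  qed
  have "adj_form ?V ?E x z = (\<Sum>s\<in>?V. x s * (\<Sum>w\<in>nbrs ?V ?E s. z w))" by (simp add: adj_form_def)
  also have "\<dots> = (x u + x v) * (1 + 2 * forest_weight t ps) + (\<Sum>s\<in>?W. ?\<rho> * (x s * z s))"
    unfolding sum_cone_vertices[OF d] z(3,4) by (simp add: z(5) algebra_simps)
  finally have 1: "adj_form ?V ?E x z = (x u + x v) * (1 + 2 * forest_weight t ps) + (\<Sum>s\<in>?W. ?\<rho> * (x s * z s))" .
  have "adj_form ?V ?E x z = adj_form ?V ?E z x" by (rule adj_form_commute[OF fin(1)])
  also have "\<dots> = (\<Sum>s\<in>?V. ?\<rho> * (x s * z s))"
    unfolding adj_form_def by (rule sum.cong) (simp_all add: x(3) algebra_simps)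
  also have "\<dots> = ?\<rho> * (x u + x v) + (\<Sum>s\<in>?W. ?\<rho> * (x s * z s))"
    unfolding sum_cone_vertices[OF d] z(1,2) by (simp add: distrib_left)
  finally have "(x u + x v) * (1 + 2 * forest_weight t ps) = (x u + x v) * ?\<rho>" using 1 by (simp add: mult.commute)
  then show ?thesis using pos by simp
qed

text \<open>The test vector for the second cone is built with the parameter \<open>t\<close> of the
  first. Its form exceeds \<open>t + 1 / t\<close> times its squared norm by exactly four times the
  difference of the forest weights.\<close>

theorem cone_spectral_compare:
  assumes d: "distinct (u # v # concat ps)" and d': "distinct (u' # v' # concat ps')" and t: "0 < t" "t < 1"
    and rho: "spectral_radius (cone_vertices u v ps, forest_cone u v ps) = t + 1 / t"
    and le: "forest_weight t ps \<le> forest_weight t ps'"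
  shows "spectral_radius (cone_vertices u v ps, forest_cone u v ps)
      \<le> spectral_radius (cone_vertices u' v' ps', forest_cone u' v' ps')"
    and "forest_weight t ps < forest_weight t ps' \<Longrightarrow>
      spectral_radius (cone_vertices u v ps, forest_cone u v ps)
      < spectral_radius (cone_vertices u' v' ps', forest_cone u' v' ps')"
proof -
  let ?V = "cone_vertices u' v' ps'" let ?E = "forest_cone u' v' ps'" let ?\<rho> = "t + 1 / t" let ?W = "set (concat ps')"
  define r where "r = spectral_radius (?V, ?E)"
  have fin: "finite ?V" "?V \<noteq> {}" by (auto simp: cone_vertices_def)
  obtain z where z: "z u' = 1" "z v' = 1"
    "(\<Sum>w\<in>nbrs ?V ?E u'. z w) = 1 + 2 * forest_weight t ps'"
    "(\<Sum>w\<in>nbrs ?V ?E v'. z w) = 1 + 2 * forest_weight t ps'"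
    "\<And>s. s \<in> ?W \<Longrightarrow> (\<Sum>w\<in>nbrs ?V ?E s. z w) = ?\<rho> * z s"
    using cone_vector[OF d' t] by blast
  have "adj_form ?V ?E z z = (\<Sum>s\<in>?V. z s * (\<Sum>w\<in>nbrs ?V ?E s. z w))" by (simp add: adj_form_def)
  also have "\<dots> = 2 * (1 + 2 * forest_weight t ps') + (\<Sum>s\<in>?W. ?\<rho> * (z s)\<^sup>2)"
    unfolding sum_cone_vertices[OF d'] z(1-4) by (simp add: z(5) power2_eq_square mult.left_commute)
  finally have "adj_form ?V ?E z z = 2 * (1 + 2 * forest_weight t ps') + ?\<rho> * (\<Sum>s\<in>?W. (z s)\<^sup>2)"
    by (simp only: sum_distrib_left)
  moreover have s: "(\<Sum>s\<in>?V. (z s)\<^sup>2) = 2 + (\<Sum>s\<in>?W. (z s)\<^sup>2)"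
    unfolding sum_cone_vertices[OF d'] z(1,2) by simp
  moreover have "adj_form ?V ?E z z \<le> r * (\<Sum>s\<in>?V. (z s)\<^sup>2)"
    unfolding r_def by (rule spectral_radius_perron(1)[OF fin])
  moreover have "?\<rho> = 1 + 2 * forest_weight t ps" by (rule cone_spectral_radius[OF d t rho])
  ultimately have *: "?\<rho> * (\<Sum>s\<in>?V. (z s)\<^sup>2) + (4 * forest_weight t ps' - 4 * forest_weight t ps)
      \<le> r * (\<Sum>s\<in>?V. (z s)\<^sup>2)"
  proof -
    assume h0: "adj_form ?V ?E z z = 2 * (1 + 2 * forest_weight t ps') + ?\<rho> * (\<Sum>s\<in>?W. (z s)\<^sup>2)"
      and s: "(\<Sum>s\<in>?V. (z s)\<^sup>2) = 2 + (\<Sum>s\<in>?W. (z s)\<^sup>2)"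
      and le: "adj_form ?V ?E z z \<le> r * (\<Sum>s\<in>?V. (z s)\<^sup>2)" and rho: "?\<rho> = 1 + 2 * forest_weight t ps"
    have h: "adj_form ?V ?E z z = 2 + 4 * forest_weight t ps' + ?\<rho> * (\<Sum>s\<in>?W. (z s)\<^sup>2)"
      using h0 by simp
    have "?\<rho> * (\<Sum>s\<in>?V. (z s)\<^sup>2) = 2 * ?\<rho> + ?\<rho> * (\<Sum>s\<in>?W. (z s)\<^sup>2)"
      unfolding s by (simp only: distrib_left mult.commute)
    also have "2 * ?\<rho> = 2 + 4 * forest_weight t ps" unfolding rho by simp
    finally show ?thesis using h le by linarith
  qed
  have pos: "(\<Sum>s\<in>?V. (z s)\<^sup>2) > 0" unfolding s by (simp add: add_pos_nonneg sum_nonneg)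
  have "?\<rho> * (\<Sum>s\<in>?V. (z s)\<^sup>2) \<le> r * (\<Sum>s\<in>?V. (z s)\<^sup>2)" using * le by linarith
  then show "spectral_radius (cone_vertices u v ps, forest_cone u v ps) \<le> spectral_radius (?V, ?E)"
    using pos unfolding rho r_def by simp
  assume "forest_weight t ps < forest_weight t ps'"
  then have "?\<rho> * (\<Sum>s\<in>?V. (z s)\<^sup>2) < r * (\<Sum>s\<in>?V. (z s)\<^sup>2)" using * by linarith
  then show "spectral_radius (cone_vertices u v ps, forest_cone u v ps) < spectral_radius (?V, ?E)"
    using pos unfolding rho r_def by simp
qed

text \<open>The test vector is the Perron vector of K_{2,m}, with \<open>sqrt (real m / 2)\<close>
  at both apexes; this subgraph already has spectral radius \<open>sqrt (2 * m)\<close>.\<close>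

lemma cone_lower_bound:
  assumes d: "distinct (u # v # concat ps)" and W: "length (concat ps) = m" "0 < m"
  shows "2 * real m \<le> (spectral_radius (cone_vertices u v ps, forest_cone u v ps))\<^sup>2"
    and "0 \<le> spectral_radius (cone_vertices u v ps, forest_cone u v ps)"
proof -
  let ?V = "cone_vertices u v ps" let ?E = "forest_cone u v ps" let ?W = "set (concat ps)"
  define r where "r = spectral_radius (?V, ?E)"
  define a where "a = sqrt (real m / 2)"
  have a2: "a * a = real m / 2" "a > 0" using W by (simp_all add: a_def)
  define z where "z s = (if s \<in> ?W then 1 else a)" for s
  have nW: "u \<notin> ?W" "v \<notin> ?W" "u \<noteq> v" using d by auto
  have cW: "card ?W = m" using distinct_card[of "concat ps"] d W(1) by (simp del: set_concat)
  have fin: "finite ?V" "?V \<noteq> {}" by (auto simp: cone_vertices_def)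
  have su: "(\<Sum>w\<in>nbrs ?V ?E u. z w) = a + real m" "(\<Sum>w\<in>nbrs ?V ?E v. z w) = a + real m"
    unfolding forest_cone_nbrs(1,2)[OF d] using nW cW by (simp_all add: z_def)
  have z0: "0 \<le> z s" for s using a2 by (simp add: z_def)
  have ss: "2 * a \<le> (\<Sum>w\<in>nbrs ?V ?E s. z w)" if sW: "s \<in> ?W" for s
  proof -
    obtain p i where p: "p \<in> set ps" "i < length p" "s = p ! i" by (rule in_concat_nth[OF sW])
    have "(\<Sum>w\<in>{u, v}. z w) \<le> (\<Sum>w\<in>nbrs ?V ?E s. z w)"
      by (rule sum_mono2) (use fin z0 forest_cone_nbrs(3)[OF d p(1,2)] p(3) in auto)
    then show ?thesis using nW by (simp add: z_def)
  qed
  have "adj_form ?V ?E z z = z u * (a + real m) + z v * (a + real m) + (\<Sum>s\<in>?W. z s * (\<Sum>w\<in>nbrs ?V ?E s. z w))"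
    unfolding adj_form_def sum_cone_vertices[OF d] su ..
  also have "\<dots> \<ge> a * real m + a * real m + (\<Sum>s\<in>?W. 2 * a)"
  proof (intro add_mono)
    show "a * real m \<le> z u * (a + real m)" "a * real m \<le> z v * (a + real m)"
      using nW a2 by (auto simp: z_def)
    show "(\<Sum>s\<in>?W. 2 * a) \<le> (\<Sum>s\<in>?W. z s * (\<Sum>w\<in>nbrs ?V ?E s. z w))"
      by (rule sum_mono) (use ss in \<open>simp add: z_def\<close>)
  qed
  finally have 1: "4 * a * real m \<le> adj_form ?V ?E z z" using cW by simp
  have "(\<Sum>s\<in>?V. (z s)\<^sup>2) = 2 * real m"
    unfolding sum_cone_vertices[OF d] using nW cW a2 by (simp add: z_def power2_eq_square)
  then have "4 * a * real m \<le> r * (2 * real m)"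
    using order.trans[OF 1 spectral_radius_perron(1)[OF fin]] unfolding r_def by simp
  then have "(2 * a) * (2 * real m) \<le> r * (2 * real m)" by simp
  then have "2 * a \<le> r" by (rule mult_right_le_imp_le) (use W(2) in simp)
  then have "(2 * a) * (2 * a) \<le> r * r" using a2(2) by (intro mult_mono) auto
  then show "2 * real m \<le> (spectral_radius (?V, ?E))\<^sup>2" using a2(1) by (simp add: r_def power2_eq_square)
  show "0 \<le> spectral_radius (?V, ?E)" using \<open>2 * a \<le> r\<close> a2(2) by (simp add: r_def)
qed

subsection \<open>Isomorphic graphs\<close>

lemma graph_iso_sym:
  assumes "graph_iso G F"
  shows "graph_iso F G"
proof -
  obtain f where f: "bij_betw f (fst G) (fst F)"
    "\<And>u v. u \<in> fst G \<Longrightarrow> v \<in> fst G \<Longrightarrow> {u, v} \<in> snd G \<longleftrightarrow> {f u, f v} \<in> snd F"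
    using assms unfolding graph_iso_def by blast
  let ?g = "inv_into (fst G) f"
  have g: "bij_betw ?g (fst F) (fst G)" by (rule bij_betw_inv_into[OF f(1)])
  have gV: "?g w \<in> fst G" and fg: "f (?g w) = w" if "w \<in> fst F" for w
    using that g bij_betw_inv_into_right[OF f(1)] by (auto simp: bij_betw_def)
  show ?thesis
    unfolding graph_iso_def by (intro exI[of _ ?g] conjI g ballI) (simp add: f(2) gV fg)
qed

lemma graph_iso_eigenvalue:
  assumes "graph_iso G F" "adj_eigenvalue F \<mu>"
  shows "adj_eigenvalue G \<mu>"
proof -
  obtain f where f: "bij_betw f (fst G) (fst F)"
    "\<And>u v. u \<in> fst G \<Longrightarrow> v \<in> fst G \<Longrightarrow> {u, v} \<in> snd G \<longleftrightarrow> {f u, f v} \<in> snd F"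
    using assms(1) unfolding graph_iso_def by blast
  obtain x where x: "\<exists>v\<in>fst F. x v \<noteq> 0"
    "\<And>v. v \<in> fst F \<Longrightarrow> (\<Sum>u\<in>{u\<in>fst F. {u, v} \<in> snd F}. x u) = \<mu> * x v"
    using assms(2) unfolding adj_eigenvalue_def by blast
  have im: "f ` fst G = fst F" and inj: "inj_on f (fst G)" using f(1) by (auto simp: bij_betw_def)
  show ?thesis
    unfolding adj_eigenvalue_def
  proof (intro exI[of _ "x \<circ> f"] conjI ballI)
    show "\<exists>v\<in>fst G. (x \<circ> f) v \<noteq> 0" using x(1) im by (metis comp_apply imageE)
    fix v assume v: "v \<in> fst G"
    have "f ` {u\<in>fst G. {u, v} \<in> snd G} = {w\<in>fst F. {w, f v} \<in> snd F}"
      using f(2) v im by (auto simp: image_iff) (metis im imageE)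
    moreover have "inj_on f {u\<in>fst G. {u, v} \<in> snd G}" using inj by (rule inj_on_subset) auto
    ultimately have "bij_betw f {u\<in>fst G. {u, v} \<in> snd G} {w\<in>fst F. {w, f v} \<in> snd F}" by (simp add: bij_betw_def)
    then have "(\<Sum>u\<in>{u\<in>fst G. {u, v} \<in> snd G}. x (f u)) = (\<Sum>w\<in>{w\<in>fst F. {w, f v} \<in> snd F}. x w)"
      by (rule sum.reindex_bij_betw)
    then show "(\<Sum>u\<in>{u\<in>fst G. {u, v} \<in> snd G}. (x \<circ> f) u) = \<mu> * (x \<circ> f) v" using x(2)[of "f v"] v im by auto
  qed
qed

text \<open>Carries results over to the join, whose vertices belong to a different type.\<close>

lemma graph_iso_spectral_radius:
  assumes "graph_iso G F"
  shows "spectral_radius G = spectral_radius F"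
proof -
  have "adj_eigenvalue G \<mu> \<longleftrightarrow> adj_eigenvalue F \<mu>" for \<mu>
    using graph_iso_eigenvalue[OF assms] graph_iso_eigenvalue[OF graph_iso_sym[OF assms]] by blast
  then show ?thesis by (simp add: spectral_radius_def)
qed

subsection \<open>Packed linear forests\<close>

text \<open>Orders of the blocks as \<open>Hgraph\<close> lists them: full blocks first, the shorter
  one last.\<close>

definition packed_lengths :: "nat \<Rightarrow> nat \<Rightarrow> nat list" where
  "packed_lengths N m = replicate (m div N) N @ (if m mod N = 0 then [] else [m mod N])"

lemma packed_lengths_less: "0 < m \<Longrightarrow> m < N \<Longrightarrow> packed_lengths N m = [m]"
  by (simp add: packed_lengths_def)

lemma packed_lengths_0: "packed_lengths N 0 = []"
  by (simp add: packed_lengths_def)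

lemma packed_lengths_add: "0 < N \<Longrightarrow> packed_lengths N (N + m) = N # packed_lengths N m"
  by (simp add: packed_lengths_def)

lemma chunks_exist:
  assumes "0 < N"
  shows "\<exists>ps. concat ps = ws \<and> map length ps = packed_lengths N (length ws)"
proof (induction "length ws" arbitrary: ws rule: less_induct)
  case less
  consider "ws = []" | "0 < length ws" "length ws < N" | "N \<le> length ws" by fastforce
  then show ?case
  proof cases
    case 1
    then show ?thesis by (intro exI[of _ "[]"]) (simp add: packed_lengths_0)
  next
    case 2
    then show ?thesis by (intro exI[of _ "[ws]"]) (simp add: packed_lengths_less)
  next
    case 3
    then have "length (drop N ws) < length ws" using assms by simp
    then obtain ps where ps: "concat ps = drop N ws" "map length ps = packed_lengths N (length (drop N ws))"
      using less by blast
    have e: "length ws = N + length (drop N ws)" using 3 by simp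
    have "map length (take N ws # ps) = packed_lengths N (length ws)"
      by (subst e, subst packed_lengths_add[OF assms]) (use ps 3 in simp)
    moreover have "concat (take N ws # ps) = ws" using ps by simp
    ultimately show ?thesis by blast
  qed
qed

text \<open>All blocks but the last have order \<open>N\<close>, so the borders between blocks are
  the positions divisible by \<open>N\<close>. This is the form in which \<open>Hgraph\<close>
  describes its edges.\<close>

lemma packed_forest_edges:
  assumes "0 < N" "map length ps = packed_lengths N m"
  shows "forest_edges ps = {{concat ps ! j, concat ps ! Suc j} | j. Suc j < length (concat ps) \<and> Suc j mod N \<noteq> 0}"
  using assms(2)
proof (induction m arbitrary: ps rule: less_induct)
  case (less m)
  consider "m = 0" | "0 < m" "m < N" | "N \<le> m" by linarith
  then show ?case
  proof cases
    case 1
    then show ?thesis using less.prems by (simp add: packed_lengths_0 forest_edges_def)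
  next
    case 2
    then obtain p where p: "ps = [p]" "length p = m" using less.prems by (auto simp: packed_lengths_less)
    then have "Suc j mod N \<noteq> 0" if "Suc j < length p" for j using 2 that by simp
    then show ?thesis using p by (auto simp: forest_edges_def path_edges_nth)
  next
    case 3
    define m' where "m' = m - N"
    have m: "m = N + m'" "m' < m" using 3 assms(1) by (auto simp: m'_def)
    then obtain p qs where pq: "ps = p # qs" "length p = N" "map length qs = packed_lengths N m'"
      using less.prems packed_lengths_add[OF assms(1), of m'] by (auto simp: map_eq_Cons_conv)
    let ?c = "concat qs"
    have IH: "forest_edges qs = {{?c ! j, ?c ! Suc j} | j. Suc j < length ?c \<and> Suc j mod N \<noteq> 0}"
      by (rule less.IH[OF m(2) pq(3)])
    have "forest_edges ps = path_edges p \<union> forest_edges qs" by (simp add: forest_edges_def pq(1))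
    also have "\<dots> = {{(p @ ?c) ! j, (p @ ?c) ! Suc j} | j. Suc j < length (p @ ?c) \<and> Suc j mod N \<noteq> 0}" (is "_ = ?R")
    proof (rule subset_antisym; rule subsetI)
      fix e assume "e \<in> path_edges p \<union> forest_edges qs"
      then consider i where "Suc i < length p" "e = {p ! i, p ! Suc i}"
        | j where "Suc j < length ?c" "Suc j mod N \<noteq> 0" "e = {?c ! j, ?c ! Suc j}"
        unfolding IH path_edges_nth by blast
      then show "e \<in> ?R"
      proof cases
        case 1
        then show ?thesis using pq(2) by (intro CollectI exI[of _ i]) (simp add: nth_append)
      next
        case 2
        then show ?thesis using pq(2)
          by (intro CollectI exI[of _ "N + j"]) (simp add: nth_append flip: add_Suc_right)
      qed
    next
      fix e assume "e \<in> ?R"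
      then obtain j where j: "Suc j < length (p @ ?c)" "Suc j mod N \<noteq> 0" "e = {(p @ ?c) ! j, (p @ ?c) ! Suc j}" by blast
      consider "Suc j < N" | "Suc j = N" | "N \<le> j" by linarith
      then show "e \<in> path_edges p \<union> forest_edges qs"
      proof cases
        case 1
        then have "e = {p ! j, p ! Suc j}" "Suc j < length p" using j pq(2) by (auto simp: nth_append)
        then show ?thesis unfolding path_edges_nth by blast
      next
        case 2
        then show ?thesis using j by simp
      next
        case 3
        define i where "i = j - N"
        have i: "j = N + i" using 3 by (simp add: i_def)
        have "e = {?c ! i, ?c ! Suc i}" "Suc i < length ?c" "Suc i mod N \<noteq> 0"
          using j pq(2) unfolding i by (simp_all add: nth_append flip: add_Suc_right)
        then show ?thesis unfolding IH by blast
      qed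
    qed
    finally show ?thesis by (simp add: pq(1))
  qed
qed

text \<open>When both block orders agree, the first block is no exception and the three-way
  condition collapses to divisibility.\<close>

lemma Hgraph_edge:
  assumes "0 < N"
  shows "{j, k} \<in> snd (Hgraph n N N) \<longleftrightarrow>
    (\<exists>i. {j, k} = {i, Suc i} \<and> Suc i < n - 2 \<and> Suc i mod N \<noteq> 0)"
proof -
  have "(if i + 1 < N then True else if i + 1 = N then False else (i + 1 - N) mod N \<noteq> 0) \<longleftrightarrow> Suc i mod N \<noteq> 0" for i
  proof -
    consider "i + 1 < N" | "i + 1 = N" | "N < i + 1" by linarith
    then show ?thesis
    proof cases
      case 3
      then have "(i + 1 - N) mod N = Suc i mod N" by (metis Suc_eq_plus1 le_mod_geq less_imp_le)
      then show ?thesis using 3 by simp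
    qed auto
  qed
  then show ?thesis by (simp add: Hgraph_def)
qed

text \<open>Reading the paths one after another numbers the vertices as in \<open>Hgraph\<close>.
  The bijection is built from the join to the cone, where list positions define it, and turned round
  at the end.\<close>

lemma packed_cone_iso:
  assumes N: "0 < N" and d: "distinct (u # v # concat ps)"
    and ps: "map length ps = packed_lengths N m" and len: "length (concat ps) = n - 2"
  shows "graph_iso (cone_vertices u v ps, forest_cone u v ps) (graph_join K2 (Hgraph n N N))"
proof -
  let ?V = "cone_vertices u v ps" let ?E = "forest_cone u v ps" let ?ws = "concat ps"
  let ?F = "graph_join K2 (Hgraph n N N)"
  define g where "g w = (case w of Inl (i::nat) \<Rightarrow> if i = 0 then u else v | Inr j \<Rightarrow> ?ws ! j)" for w
  have gsimp: "g (Inl 0) = u" "g (Inl (Suc 0)) = v" "g (Inr j) = ?ws ! j" for j by (simp_all add: g_def)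
  have dw: "distinct ?ws" and nW: "u \<notin> set ?ws" "v \<notin> set ?ws" "u \<noteq> v" using d by auto
  have VF: "fst ?F = {Inl 0, Inl 1} \<union> Inr ` {0..<n - 2}"
    by (auto simp: graph_join_def K2_def Hgraph_def)
  have wsim: "?ws ! j \<in> set ?ws" if "j < n - 2" for j using nth_mem[of j ?ws] that len by metis
  have wsin: "?ws ! j \<noteq> u" "?ws ! j \<noteq> v" if "j < n - 2" for j using wsim[OF that] nW by blast+
  have bij: "bij_betw g (fst ?F) ?V"
  proof (rule bij_betw_imageI)
    show "inj_on g (fst ?F)"
    proof (rule inj_onI)
      fix a b assume ab: "a \<in> fst ?F" "b \<in> fst ?F" "g a = g b"
      then consider "a \<in> {Inl 0, Inl 1}" "b \<in> {Inl 0, Inl 1}"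
        | j where "a \<in> {Inl 0, Inl 1}" "b = Inr j" "j < n - 2" | j where "b \<in> {Inl 0, Inl 1}" "a = Inr j" "j < n - 2"
        | j k where "a = Inr j" "b = Inr k" "j < n - 2" "k < n - 2"
        unfolding VF by auto
      then show "a = b"
      proof cases
        case 1
        then show ?thesis using ab nW gsimp by auto
      next
        case 2
        then show ?thesis using ab wsin[OF 2(3)] gsimp by auto
      next
        case 3
        then show ?thesis using ab wsin[OF 3(3)] gsimp by auto
      next
        case 4
        then show ?thesis using ab nth_eq_iff_index_eq[OF dw, of j k] len gsimp by simp
      qed
    qed
    have "set ?ws = (\<lambda>j. ?ws ! j) ` {0..<n - 2}" using len by (metis list.set_map map_nth set_upt)
    then show "g ` fst ?F = ?V"
      unfolding VF cone_vertices_def by (simp add: image_Un image_image gsimp del: set_concat)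
  qed
  have uE: "{u, v} \<in> ?E" by (simp add: forest_cone_def cone_edges_def)
  have sE: "{u, s} \<in> ?E" "{v, s} \<in> ?E" if "s \<in> set ?ws" for s
    using that unfolding forest_cone_def cone_edges_def by blast+
  have loop: "{w} \<notin> ?E" for w by (rule graph_edges_no_loop[OF forest_cone_graph[OF d]])
  have inner: "{?ws ! j, ?ws ! k} \<in> ?E \<longleftrightarrow> {j, k} \<in> snd (Hgraph n N N)" if jk: "j < n - 2" "k < n - 2" for j k
  proof -
    have "{?ws ! j, ?ws ! k} \<in> ?E \<longleftrightarrow> {?ws ! j, ?ws ! k} \<in> forest_edges ps"
      using wsin[OF jk(1)] wsin[OF jk(2)] unfolding forest_cone_def cone_edges_def by (auto simp: doubleton_eq_iff)
    also have "\<dots> \<longleftrightarrow> (\<exists>i. {?ws ! j, ?ws ! k} = {?ws ! i, ?ws ! Suc i} \<and> Suc i < n - 2 \<and> Suc i mod N \<noteq> 0)"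
      unfolding packed_forest_edges[OF N ps] len by blast
    also have "\<dots> \<longleftrightarrow> (\<exists>i. {j, k} = {i, Suc i} \<and> Suc i < n - 2 \<and> Suc i mod N \<noteq> 0)"
    proof -
      have "{?ws ! j, ?ws ! k} = {?ws ! i, ?ws ! Suc i} \<longleftrightarrow> {j, k} = {i, Suc i}" if "Suc i < n - 2" for i
      proof -
        have ix: "?ws ! a = ?ws ! b \<longleftrightarrow> a = b" if "a < n - 2" "b < n - 2" for a b
          using nth_eq_iff_index_eq[OF dw] that len by simp
        show ?thesis using ix jk that unfolding doubleton_eq_iff by (metis Suc_lessD)
      qed
      note E = this
      show ?thesis
      proof (rule ex_cong1)
        fix i
        show "({?ws ! j, ?ws ! k} = {?ws ! i, ?ws ! Suc i} \<and> Suc i < n - 2 \<and> Suc i mod N \<noteq> 0) \<longleftrightarrow>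
          ({j, k} = {i, Suc i} \<and> Suc i < n - 2 \<and> Suc i mod N \<noteq> 0)"
        proof (cases "Suc i < n - 2")
          case True
          show ?thesis unfolding E[OF True] ..
        qed simp
      qed
    qed
    finally show ?thesis unfolding Hgraph_edge[OF N] .
  qed
  have fE: "{Inl i, Inl j} \<in> snd ?F \<longleftrightarrow> {i, j} = {0, 1}"
    "{Inr i', Inr j'} \<in> snd ?F \<longleftrightarrow> {i', j'} \<in> snd (Hgraph n N N)"
    "{Inl i, Inr j'} \<in> snd ?F \<longleftrightarrow> i \<in> {0, 1} \<and> j' < n - 2" for i j i' j'
  proof -
    show "{Inl i, Inl j} \<in> snd ?F \<longleftrightarrow> {i, j} = {0, 1}"
      by (auto simp: graph_join_def K2_def doubleton_eq_iff image_iff)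
    let ?I = "(\<lambda>e. Inr ` e) :: nat set \<Rightarrow> (nat + nat) set"
    have "{Inr i', Inr j'} \<in> snd ?F \<longleftrightarrow> ?I {i', j'} \<in> ?I ` snd (Hgraph n N N)"
      unfolding graph_join_def K2_def by (auto simp: doubleton_eq_iff)
    also have "\<dots> \<longleftrightarrow> {i', j'} \<in> snd (Hgraph n N N)"
      by (rule inj_image_mem_iff) (auto simp: inj_def inj_image_eq_iff)
    finally show "{Inr i', Inr j'} \<in> snd ?F \<longleftrightarrow> {i', j'} \<in> snd (Hgraph n N N)" .
    show "{Inl i, Inr j'} \<in> snd ?F \<longleftrightarrow> i \<in> {0, 1} \<and> j' < n - 2"
      by (auto simp: graph_join_def K2_def Hgraph_def doubleton_eq_iff image_iff)
  qed
  have edges: "{a, b} \<in> snd ?F \<longleftrightarrow> {g a, g b} \<in> ?E" if abF: "a \<in> fst ?F" "b \<in> fst ?F" for a b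
  proof -
    consider i j where "a = Inl i" "b = Inl j" "i \<in> {0,1}" "j \<in> {0,1}"
        | i j where "a = Inl i" "b = Inr j" "i \<in> {0,1}" "j < n - 2" | i j where "b = Inl i" "a = Inr j" "i \<in> {0,1}" "j < n - 2"
        | j k where "a = Inr j" "b = Inr k" "j < n - 2" "k < n - 2"
      using abF unfolding VF by auto
    then show ?thesis
    proof cases
      case 1
      then show ?thesis using uE loop gsimp by (auto simp: fE insert_commute)
    next
      case 2
      then show ?thesis using sE[OF wsim[OF 2(4)]] gsimp by (auto simp: fE)
    next
      case 3
      then show ?thesis using sE[OF wsim[OF 3(4)]] gsimp by (auto simp: fE insert_commute)
    next
      case 4
      then show ?thesis using inner[OF 4(3,4)] by (simp add: fE gsimp)
    qed
  qed
  have "graph_iso ?F (?V, ?E)"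
    unfolding graph_iso_def using bij edges by (intro exI[of _ g]) auto
  then show ?thesis by (rule graph_iso_sym)
qed

text \<open>Equality in the packing bound yields only a multiset of orders; moving the full blocks
  to the front restores the listing of \<open>Hgraph\<close>.\<close>

lemma reorder_packed:
  assumes "mset (map length ps) = mset (packed_lengths N m)" "0 < N"
  obtains qs where "mset qs = mset ps" "map length qs = packed_lengths N m"
proof -
  define A where "A = filter (\<lambda>p. length p = N) ps"
  define B where "B = filter (\<lambda>p. length p \<noteq> N) ps"
  have rN: "m mod N < N" using assms(2) by simp
  have mA: "mset (map length A) = filter_mset (\<lambda>k. k = N) (mset (map length ps))"
  proof -
    have "map length A = filter (\<lambda>k. k = N) (map length ps)" by (simp add: A_def filter_map o_def)
    then show ?thesis by (metis mset_filter)
  qed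
  have mB: "mset (map length B) = filter_mset (\<lambda>k. k \<noteq> N) (mset (map length ps))"
  proof -
    have "map length B = filter (\<lambda>k. k \<noteq> N) (map length ps)" by (simp add: B_def filter_map o_def)
    then show ?thesis by (metis mset_filter)
  qed
  have "mset (map length A) = replicate_mset (m div N) N"
    unfolding mA assms(1) packed_lengths_def using rN by (auto simp: filter_mset_eq_conv)
  then have "size (mset (map length A)) = m div N" by simp
  then have "length A = m div N" by simp
  moreover have "\<forall>k\<in>set (map length A). k = N" by (auto simp: A_def)
  ultimately have lA: "map length A = replicate (m div N) N" by (metis length_map replicate_eqI)
  have "mset (map length B) = (if m mod N = 0 then {#} else {#m mod N#})"
    unfolding mB assms(1) packed_lengths_def using rN by (auto simp: filter_mset_eq_conv)
  then have lB: "map length B = (if m mod N = 0 then [] else [m mod N])"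
    using mset_single_iff[of "map length B" "m mod N"] mset_zero_iff[of "map length B"]
    by (simp del: mset_map split: if_splits)
  show ?thesis
  proof (rule that)
    show "mset (A @ B) = mset ps" by (simp add: A_def B_def)
    show "map length (A @ B) = packed_lengths N m" by (simp add: lA lB packed_lengths_def)
  qed
qed

lemma forest_mset_cong:
  assumes "mset qs = mset ps"
  shows "forest_edges qs = forest_edges ps" "set (concat qs) = set (concat ps)"
    "distinct (concat qs) = distinct (concat ps)" "length (concat qs) = length (concat ps)"
proof -
  have s: "set qs = set ps" by (rule mset_eq_setD[OF assms])
  show "forest_edges qs = forest_edges ps" "set (concat qs) = set (concat ps)" using s by (simp_all add: forest_edges_def)
  have "mset (concat xs) = \<Sum>\<^sub># (image_mset mset (mset xs))" for xs :: "'a list list"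
    by (induction xs) auto
  then have "mset (concat qs) = mset (concat ps)" using assms by simp
  then show "distinct (concat qs) = distinct (concat ps)" by (rule mset_eq_imp_distinct_iff)
  show "length (concat qs) = length (concat ps)" by (rule mset_eq_length) fact
qed

subsection \<open>Two cycles sharing a vertex\<close>

text \<open>The list \<open>u # A @ B\<close> is the numbering of \<open>Cll\<close>:
  \<open>A\<close> fills the places 1 to \<open>l - 1\<close>, and \<open>B\<close> the places
  \<open>l\<close> to \<open>2 * l - 2\<close>.\<close>

lemma contains_Cll:
  assumes l: "3 \<le> l" and d: "distinct (u # A @ B)" and len: "length A = l - 1" "length B = l - 1"
    and V: "set (u # A @ B) \<subseteq> V" and E: "path_edges (u # A @ [u]) \<subseteq> E" "path_edges (u # B @ [u]) \<subseteq> E"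
  shows "contains_subgraph (V, E) (Cll l)"
proof -
  define f where "f i = (u # A @ B) ! i" for i
  have f0: "f 0 = u" by (simp add: f_def)
  have fA: "f i = (u # A @ [u]) ! i" if "i \<le> l - 1" for i
    using that len by (cases i) (auto simp: f_def nth_append)
  have fB: "f (l + i) = (u # B @ [u]) ! Suc i" if "i \<le> l - 2" for i
  proof -
    have "l + i = Suc (length A + i)" using l len by simp
    then have "f (l + i) = B ! i" by (simp add: f_def)
    moreover have "i < length B" using len that l by simp
    ultimately show ?thesis by (simp add: nth_append)
  qed
  have A: "{f i, f (Suc i)} \<in> E" if "Suc i \<le> l - 1" for i
  proof -
    have "{(u # A @ [u]) ! i, (u # A @ [u]) ! Suc i} \<in> path_edges (u # A @ [u])"
      unfolding path_edges_nth using that len by (intro CollectI exI[of _ i]) auto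
    then show ?thesis using fA[of i] fA[of "Suc i"] that E(1) by (metis Suc_leD subsetD)
  qed
  have A0: "{f (l - 1), f 0} \<in> E"
  proof -
    have "{(u # A @ [u]) ! (l - 1), (u # A @ [u]) ! Suc (l - 1)} \<in> path_edges (u # A @ [u])"
      unfolding path_edges_nth using len by (intro CollectI exI[of _ "l - 1"]) auto
    moreover have "(u # A @ [u]) ! Suc (l - 1) = u" using len by (simp add: nth_append)
    ultimately show ?thesis using fA[of "l - 1"] f0 E(1) by auto
  qed
  have B0: "{f 0, f l} \<in> E"
  proof -
    have "{(u # B @ [u]) ! 0, (u # B @ [u]) ! Suc 0} \<in> path_edges (u # B @ [u])"
      unfolding path_edges_nth by (intro CollectI exI[of _ 0]) auto
    then show ?thesis using fB[of 0] f0 E(2) by auto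
  qed
  have B: "{f i, f (Suc i)} \<in> E" if "l \<le> i" "Suc i \<le> 2 * l - 2" for i
  proof -
    define j where "j = i - l"
    have j: "i = l + j" "Suc j \<le> l - 2" using that by (auto simp: j_def)
    have "{(u # B @ [u]) ! Suc j, (u # B @ [u]) ! Suc (Suc j)} \<in> path_edges (u # B @ [u])"
      unfolding path_edges_nth using j len by (intro CollectI exI[of _ "Suc j"]) auto
    then show ?thesis using fB[of j] fB[of "Suc j"] j E(2) by auto
  qed
  have B1: "{f (2 * l - 2), f 0} \<in> E"
  proof -
    have "{(u # B @ [u]) ! (l - 1), (u # B @ [u]) ! Suc (l - 1)} \<in> path_edges (u # B @ [u])"
      unfolding path_edges_nth using len by (intro CollectI exI[of _ "l - 1"]) auto
    moreover have "(u # B @ [u]) ! Suc (l - 1) = u" using len by (simp add: nth_append)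
    moreover have "f (2 * l - 2) = (u # B @ [u]) ! (l - 1)"
    proof -
      have "l + (l - 2) = 2 * l - 2" "Suc (l - 2) = l - 1" using l by auto
      then show ?thesis using fB[of "l - 2"] by simp
    qed
    ultimately show ?thesis using f0 E(2) by auto
  qed
  have L: "length (u # A @ B) = 2 * l - 1" using len l by simp
  have rng: "{0..2 * l - 2} = {..<length (u # A @ B)}" unfolding L using l by auto
  have "inj_on f {0..2 * l - 2}"
    unfolding rng f_def by (rule inj_on_nth[OF d]) auto
  moreover have "f ` {0..2 * l - 2} \<subseteq> V"
  proof -
    have "f i \<in> set (u # A @ B)" if "i \<in> {0..2 * l - 2}" for i
      using that unfolding rng f_def by (intro nth_mem) auto
    then show ?thesis using V by blast
  qed
  moreover have "f ` e \<in> E" if "e \<in> snd (Cll l)" for e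
    using that A A0 B0 B B1 unfolding Cll_def by auto
  ultimately show ?thesis unfolding contains_subgraph_def by (intro exI[of _ f]) (auto simp: Cll_def)
qed

lemma path_edges_closed_walk:
  "A \<noteq> [] \<Longrightarrow> path_edges (u # A @ [u]) = insert {u, hd A} (insert {last A, u} (path_edges A))"
proof -
  assume A: "A \<noteq> []"
  then have "path_edges (u # A) = insert {u, hd A} (path_edges A)" by (cases A) auto
  then show ?thesis using path_edges_snoc[of "u # A" u] A by auto
qed

lemma path_edges_take: "path_edges (take k xs) \<subseteq> path_edges xs"
  unfolding path_edges_nth by fastforce

lemma path_edges_drop: "path_edges (drop k xs) \<subseteq> path_edges xs"
proof
  fix e assume "e \<in> path_edges (drop k xs)"
  then obtain i where "Suc i < length (drop k xs)" "e = {drop k xs ! i, drop k xs ! Suc i}"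
    unfolding path_edges_nth by blast
  then have "Suc (k + i) < length xs \<and> e = {xs ! (k + i), xs ! Suc (k + i)}" by auto
  then show "e \<in> path_edges xs" unfolding path_edges_nth by blast
qed

lemma fan_closed_walk:
  assumes "A \<noteq> []" "set A \<subseteq> nbrs V E u" "path_edges A \<subseteq> E"
  shows "path_edges (u # A @ [u]) \<subseteq> E"
proof -
  have "{u, hd A} \<in> E" "{last A, u} \<in> E"
    using hd_in_set[OF assms(1)] last_in_set[OF assms(1)] assms(2) by (auto simp: nbrs_def insert_commute)
  then show ?thesis unfolding path_edges_closed_walk[OF assms(1)] using assms(3) by blast
qed

text \<open>A path through neighbours of \<open>u\<close> is a fan; two disjoint stretches of
  \<open>l - 1\<close> vertices close up through \<open>u\<close> to two cycles of length
  \<open>l\<close>.\<close>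

lemma two_fans_Cll:
  assumes gr: "graph_edges V E" and l: "3 \<le> l" and u: "u \<in> V"
    and p: "distinct p" "set p \<subseteq> nbrs V E u" "path_edges p \<subseteq> E" "2 * (l - 1) \<le> length p"
  shows "contains_subgraph (V, E) (Cll l)"
proof -
  let ?A = "take (l - 1) p" let ?B = "take (l - 1) (drop (l - 1) p)"
  have un: "u \<notin> nbrs V E u" using graph_edges_no_loop[OF gr] by (auto simp: nbrs_def)
  have sub: "set ?A \<subseteq> set p" "set ?B \<subseteq> set p" by (meson set_take_subset set_drop_subset order.trans)+
  have len: "length ?A = l - 1" "length ?B = l - 1" using p(4) by auto
  then have ne: "?A \<noteq> []" "?B \<noteq> []" using l by (metis One_nat_def diff_is_0_eq list.size(3) not_numeral_le_zero numeral_le_one_iff le_trans semiring_norm(70))+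
  have "?A @ ?B = take (2 * (l - 1)) p" by (simp add: take_add mult_2)
  then have "distinct (?A @ ?B)" using p(1) by (metis distinct_take)
  moreover have "u \<notin> set ?A" "u \<notin> set ?B" using un sub p(2) by blast+
  ultimately have d: "distinct (u # ?A @ ?B)" by simp
  have "set (u # ?A @ ?B) \<subseteq> V" using u sub p(2) by (auto simp: nbrs_def)
  moreover have "path_edges (u # ?A @ [u]) \<subseteq> E"
    by (rule fan_closed_walk[OF ne(1)]) (use sub p(2,3) path_edges_take in blast)+
  moreover have "path_edges (u # ?B @ [u]) \<subseteq> E"
    by (rule fan_closed_walk[OF ne(2)]) (use sub p(2,3) path_edges_take path_edges_drop in blast)+
  ultimately show ?thesis using contains_Cll[OF l d len] by blast
qed

text \<open>The first cycle is a fan of \<open>u\<close> over \<open>p\<close>. The second runs from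
  \<open>u\<close> along part of \<open>q1\<close>, through \<open>v\<close>, along part of
  \<open>q2\<close> and back to \<open>u\<close>, so that \<open>v\<close> links two blocks with no
  edge between them.\<close>

lemma fan_and_link_Cll:
  assumes gr: "graph_edges V E" and l: "4 \<le> l" and uv: "u \<in> V" "v \<in> V" "u \<noteq> v"
    and d: "distinct (p @ q1 @ q2)" and D: "set (p @ q1 @ q2) \<subseteq> nbrs V E u \<inter> nbrs V E v"
    and e: "path_edges p \<subseteq> E" "path_edges q1 \<subseteq> E" "path_edges q2 \<subseteq> E"
    and len: "l - 1 \<le> length p" "1 \<le> length q1" "1 \<le> length q2" "l - 2 \<le> length q1 + length q2"
  shows "contains_subgraph (V, E) (Cll l)"
proof -
  \<comment> \<open>Cutting at \<open>l - 3\<close> keeps at least one vertex for the piece of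
    \<open>q2\<close>.\<close>
  define a where "a = min (length q1) (l - 3)"
  define A Q1 Q2 where "A = take (l - 1) p" and "Q1 = take a q1" and "Q2 = take (l - 2 - a) q2"
  have lA: "length A = l - 1" "length Q1 = a" "length Q2 = l - 2 - a" "1 \<le> a" "1 \<le> l - 2 - a"
    using len l by (auto simp: A_def Q1_def Q2_def a_def)
  then have ne: "A \<noteq> []" "Q1 \<noteq> []" "Q2 \<noteq> []" using l by auto
  have sub: "set A \<subseteq> set p" "set Q1 \<subseteq> set q1" "set Q2 \<subseteq> set q2"
    unfolding A_def Q1_def Q2_def by (rule set_take_subset)+
  have esub: "path_edges A \<subseteq> E" "path_edges Q1 \<subseteq> E" "path_edges Q2 \<subseteq> E"
    unfolding A_def Q1_def Q2_def using e path_edges_take by blast+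
  let ?D = "nbrs V E u \<inter> nbrs V E v"
  have nD: "u \<notin> ?D" "v \<notin> ?D" using graph_edges_no_loop[OF gr] by (auto simp: nbrs_def)
  have inD: "set A \<subseteq> ?D" "set Q1 \<subseteq> ?D" "set Q2 \<subseteq> ?D" using sub D by auto
  let ?B = "Q1 @ v # Q2"
  have "distinct A" "distinct Q1" "distinct Q2" using d by (auto simp: A_def Q1_def Q2_def)
  moreover have "set A \<inter> set Q1 = {}" "set A \<inter> set Q2 = {}" "set Q1 \<inter> set Q2 = {}" using d sub by auto
  moreover have "u \<notin> set A \<union> set Q1 \<union> set Q2" "v \<notin> set A \<union> set Q1 \<union> set Q2" using inD nD by blast+
  ultimately have dist: "distinct (u # A @ ?B)" using uv(3) by auto
  have "length ?B = l - 1" using lA l by simp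
  moreover have "set (u # A @ ?B) \<subseteq> V" using inD uv by (auto simp: nbrs_def)
  moreover have "path_edges (u # A @ [u]) \<subseteq> E" by (rule fan_closed_walk[OF ne(1) _ esub(1)]) (use inD in blast)
  moreover have "path_edges (u # ?B @ [u]) \<subseteq> E"
  proof -
    have "path_edges ?B = path_edges (Q1 @ [v]) \<union> path_edges (v # Q2)" by (rule path_edges_append)
    also have "\<dots> = insert {last Q1, v} (path_edges Q1) \<union> insert {v, hd Q2} (path_edges Q2)"
      using ne path_edges_snoc[OF ne(2), of v] by (cases Q2) auto
    finally have B: "path_edges ?B = insert {last Q1, v} (path_edges Q1) \<union> insert {v, hd Q2} (path_edges Q2)" .
    have "hd Q1 \<in> ?D" "last Q1 \<in> ?D" "hd Q2 \<in> ?D" "last Q2 \<in> ?D"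
      using hd_in_set[OF ne(2)] last_in_set[OF ne(2)] hd_in_set[OF ne(3)] last_in_set[OF ne(3)] inD by blast+
    then have "{u, hd Q1} \<in> E" "{last Q1, v} \<in> E" "{v, hd Q2} \<in> E" "{last Q2, u} \<in> E"
      by (auto simp: nbrs_def insert_commute)
    moreover have "?B \<noteq> []" "hd ?B = hd Q1" "last ?B = last Q2" using ne by auto
    ultimately show ?thesis unfolding path_edges_closed_walk[OF \<open>?B \<noteq> []\<close>] B using esub by simp
  qed
  ultimately show ?thesis using contains_Cll[of l u A ?B V E] dist lA(1) l by simp
qed

section \<open>Numerical comparison with the packed forest\<close>

lemma solve_reciprocal_sum:
  fixes r :: real
  assumes "200 \<le> r"
  obtains t where "0 < t" "t \<le> 1/100" "t + 1 / t = r"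
proof -
  define s where "s = sqrt (r\<^sup>2 - 4)"
  have r2: "4 \<le> r\<^sup>2" using power_mono[of 200 r 2] assms by simp
  have s2: "s * s = r * r - 4" using r2 by (simp add: s_def power2_eq_square)
  have s0: "0 \<le> s" using r2 by (simp add: s_def)
  have sr: "s < r" by (rule power2_less_imp_less) (use s2 assms in \<open>auto simp: power2_eq_square\<close>)
  \<comment> \<open>The smaller root of \<open>t\<^sup>2 - r * t + 1 = 0\<close>; the other root is
    its inverse.\<close>
  define t where "t = (r - s) / 2"
  have t: "0 < t" using sr by (simp add: t_def)
  have "t * ((r + s) / 2) = 1" using s2 by (simp add: t_def algebra_simps)
  then have it: "1 / t = (r + s) / 2" using t by (simp add: field_simps)
  then have "100 \<le> 1 / t" using s0 assms by simp
  then have "t \<le> 1/100" using t by (simp add: field_simps)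
  moreover have "t + 1 / t = r" unfolding it by (simp add: t_def field_simps)
  ultimately show ?thesis using that t by blast
qed

lemma path_weight_convex_seq: "0 < t \<Longrightarrow> t < 1 \<Longrightarrow> strictly_convex_seq (path_weight t)"
  by unfold_locales (rule path_weight_strict_convex, assumption, assumption, rule path_weight_0)

lemma sum_list_path_weight_upper:
  assumes t: "0 < t" "t < 1" and ks: "\<forall>k\<in>set ks. 1 \<le> k"
  shows "sum_list (map (path_weight t) ks)
    \<le> t / (1 - t)\<^sup>2 * (real (sum_list ks) - real (length ks) * (2 * t / (1 + t\<^sup>2)))"
  using ks
proof (induction ks)
  case (Cons k ks)
  define c b where "c = t / (1 - t)\<^sup>2" and "b = 2 * t / (1 + t\<^sup>2)"
  have "path_weight t k \<le> c * (real k - b)"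
    unfolding c_def b_def by (rule path_weight_bounds(1)[OF t]) (use Cons in simp)
  moreover have "sum_list (map (path_weight t) ks) \<le> c * (real (sum_list ks) - real (length ks) * b)"
    unfolding c_def b_def by (rule Cons.IH) (use Cons.prems in simp)
  ultimately have "sum_list (map (path_weight t) (k # ks))
      \<le> c * (real (sum_list (k # ks)) - real (length (k # ks)) * b)"
    by (simp add: algebra_simps)
  then show ?case unfolding c_def b_def .
qed simp

text \<open>There are at most \<open>S div N + 1\<close> blocks, each losing at most
  \<open>2 * t / (1 - t)\<close>. An absent remainder block is charged too, which only weakens the
  bound.\<close>

lemma packed_path_weight_lower:
  assumes t: "0 < t" "t < 1" and N: "0 < N"
  shows "t / (1 - t)\<^sup>2 * (real S - (real (S div N) + 1) * (2 * t / (1 - t)))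
    \<le> strictly_convex_seq.packed (path_weight t) N S"
proof -
  define c b where "c = t / (1 - t)\<^sup>2" and "b = 2 * t / (1 - t)"
  have c0: "0 \<le> c" "0 \<le> b" using t by (auto simp: c_def b_def)
  have "c * (real N - b) \<le> path_weight t N" unfolding c_def b_def by (rule path_weight_bounds(2)[OF t]) (use N in simp)
  then have "real (S div N) * (c * (real N - b)) \<le> real (S div N) * path_weight t N" by (rule mult_left_mono) simp
  moreover have "c * (real (S mod N) - b) \<le> path_weight t (S mod N)"
  proof (cases "S mod N = 0")
    case True
    then show ?thesis using c0 by simp
  next
    case False
    then show ?thesis unfolding c_def b_def by (intro path_weight_bounds(2)[OF t]) simp
  qed
  moreover have "real S = real (S div N) * real N + real (S mod N)"
    by (metis div_mult_mod_eq of_nat_add of_nat_mult)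
  ultimately show ?thesis
    unfolding strictly_convex_seq.packed_def[OF path_weight_convex_seq[OF t]] c_def[symmetric] b_def[symmetric]
    by (simp add: algebra_simps)
qed

text \<open>A forest with one long block has about twice as many blocks as the packed one, and the loss of
  weight per block is nearly the same for all block sizes.\<close>

lemma many_blocks_weight:
  assumes t: "0 < t" "t \<le> 1/100" and N: "2 \<le> N" and ks: "\<forall>k\<in>set ks. 1 \<le> k" "2 \<le> length ks"
    and count: "2 * sum_list ks \<le> 2 * (2 * N + 1) + 2 * (N - 2) + (length ks - 2) * (N - 1)"
    and large: "20 * N \<le> sum_list ks"
  shows "sum_list (map (path_weight t) ks) < strictly_convex_seq.packed (path_weight t) N (sum_list ks)"
proof -
  define S where "S = sum_list ks"
  define m where "m = length ks"
  define q where "q = S div N"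
  have t1: "t < 1" using t by simp
  have "(m - 2) * (N - 1) \<le> m * N" by (rule mult_le_mono) auto
  then have "2 * S \<le> 6 * N + m * N" using count N by (simp add: S_def m_def)
  then have mN: "2 * real S \<le> 6 * real N + real m * real N"
    by (metis (mono_tags) of_nat_add of_nat_le_iff of_nat_mult of_nat_numeral)
  have "q * N \<le> S" by (simp add: q_def)
  then have qN: "real q * real N \<le> real S" by (metis of_nat_le_iff of_nat_mult)
  have SN: "20 * real N \<le> real S" using large unfolding S_def by linarith
  \<comment> \<open>The number \<open>m\<close> of blocks is nearly \<open>2 * S / N\<close>, and
    \<open>q + 1\<close> is about half of that. The ratio 11/10 suffices, and
    \<open>S \<ge> 20 * N\<close> covers the error terms.\<close>
  have "11 * ((real q + 1) * real N) \<le> 10 * (real m * real N)"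
  proof -
    have "(real q + 1) * real N = real q * real N + real N" by (simp add: distrib_right)
    then show ?thesis using mN qN SN by linarith
  qed
  then have "(11 * (real q + 1)) * real N \<le> (10 * real m) * real N" by (simp only: mult.assoc)
  then have qm: "11 * (real q + 1) \<le> 10 * real m" by (rule mult_right_le_imp_le) (use N in simp)
  \<comment> \<open>For \<open>t \<le> 1/100\<close> the largest and the smallest loss per block
    differ by a factor of at most \<open>101 / 99\<close>, which is less than
    \<open>11 / 10\<close>.\<close>
  have t2: "t\<^sup>2 \<le> 1/100" using mult_mono[OF t(2) t(2)] t(1) by (simp add: power2_eq_square)
  have "(real q + 1) * (1 + t\<^sup>2) \<le> (real q + 1) * (101/100)" using t2 by (intro mult_left_mono) auto
  also have "\<dots> < real m * (99/100)" using qm by (simp add: field_simps)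
  also have "\<dots> \<le> real m * (1 - t)" using t by (intro mult_left_mono) auto
  finally have key: "(real q + 1) * (1 + t\<^sup>2) < real m * (1 - t)" .
  have pos: "1 + t\<^sup>2 > 0" "1 - t > 0" using t1 by (auto simp: add_pos_nonneg)
  have "(real q + 1) / (1 - t) < real m / (1 + t\<^sup>2)"
    using key pos by (simp add: divide_less_eq less_divide_eq field_simps)
  then have "(real q + 1) / (1 - t) * (2 * t) < real m / (1 + t\<^sup>2) * (2 * t)"
    by (rule mult_strict_right_mono) (use t in simp)
  then have d: "(real q + 1) * (2 * t / (1 - t)) < real m * (2 * t / (1 + t\<^sup>2))" by simp
  have c: "0 < t / (1 - t)\<^sup>2" using t t1 by simp
  have "sum_list (map (path_weight t) ks) \<le> t / (1 - t)\<^sup>2 * (real S - real m * (2 * t / (1 + t\<^sup>2)))"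
    unfolding S_def m_def by (rule sum_list_path_weight_upper[OF t(1) t1 ks(1)])
  also have "\<dots> < t / (1 - t)\<^sup>2 * (real S - (real q + 1) * (2 * t / (1 - t)))"
    by (rule mult_strict_left_mono[OF _ c]) (use d in simp)
  also have "\<dots> \<le> strictly_convex_seq.packed (path_weight t) N S"
    unfolding q_def by (rule packed_path_weight_lower[OF t(1) t1]) (use N in simp)
  finally show ?thesis by (simp add: S_def)
qed

lemma forest_weight_packed:
  assumes t: "0 < t" "t < 1" and "map length ps = packed_lengths N m"
  shows "forest_weight t ps = strictly_convex_seq.packed (path_weight t) N m"
  unfolding forest_weight_def assms(3) packed_lengths_def
    strictly_convex_seq.packed_def[OF path_weight_convex_seq[OF t]]
  by (simp add: sum_list_replicate)

subsection \<open>The extremal graph\<close>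

lemma distinct_concat_distinct:
  assumes "distinct (concat ps)" "[] \<notin> set ps"
  shows "distinct ps"
  using assms by (simp add: distinct_concat_iff removeAll_id)

lemma drawing_plane_like:
  assumes "drawing V E p \<gamma>"
  shows "plane_like V E"
  by unfold_locales
    (use drawing_graph[OF assms] plane_induced_card_edges[OF assms] plane_common_nbrs[OF assms] in auto)

context plane_like
begin

text \<open>Degree at most two is \<open>common3\<close> for \<open>u\<close>, \<open>v\<close> and
  \<open>s\<close>. A cycle must pass through all common neighbours by \<open>acyc\<close>; cut
  open, it is a path long enough for two fans at \<open>u\<close>.\<close>

lemma dominated_forest:
  assumes uv: "u \<in> V" "v \<in> V" "u \<noteq> v" and l: "4 \<le> l"
    and acyc: "\<And>xs w. is_cycle (N u \<inter> N v) E xs \<Longrightarrow> w \<in> N u \<inter> N v \<Longrightarrow> w \<in> set xs"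
    and free: "\<not> contains_subgraph (V, E) (Cll l)"
    and large: "2 * (l - 1) \<le> card (N u \<inter> N v)"
  obtains ps where "distinct (concat ps)" "set (concat ps) = N u \<inter> N v" "[] \<notin> set ps"
    "forest_edges ps = {e\<in>E. e \<subseteq> N u \<inter> N v}" "\<And>p. p \<in> set ps \<Longrightarrow> length p < 2 * (l - 1)"
proof -
  let ?D = "N u \<inter> N v" let ?H = "{e\<in>E. e \<subseteq> ?D}"
  have DV: "?D \<subseteq> V" using NV by blast
  have grH: "graph_edges ?D ?H" by (rule graph_edges_subset[OF gr DV]) auto
  have fans: "length p < 2 * (l - 1)" if p: "distinct p" "set p \<subseteq> ?D" "path_edges p \<subseteq> E" for p
  proof (rule ccontr)
    assume "\<not> length p < 2 * (l - 1)"
    then have long: "2 * (l - 1) \<le> length p" by simp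
    have "3 \<le> l" using l by simp
    moreover have "set p \<subseteq> N u" using p(2) by simp
    ultimately have "contains_subgraph (V, E) (Cll l)"
      using two_fans_Cll[OF gr _ uv(1) p(1) _ p(3) long] by simp
    then show False using free by simp
  qed
  have "card {e\<in>?H. s \<in> e} \<le> 2" if s: "s \<in> ?D" for s
  proof -
    have sV: "s \<in> V" using s DV by blast
    have "u \<noteq> s" "v \<noteq> s" using s noloop by auto
    then have "card (N u \<inter> N v \<inter> N s) \<le> 2" using common3[OF uv(1,2) sV uv(3)] by simp
    moreover have "{e\<in>?H. s \<in> e} \<subseteq> (\<lambda>w. {w, s}) ` (?D \<inter> N s)"
    proof
      fix e assume "e \<in> {e\<in>?H. s \<in> e}"
      then have e: "e \<in> {e\<in>E. s \<in> e}" "e \<subseteq> ?D" by auto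
      then obtain w where "w \<in> N s" "e = {w, s}" unfolding edges_at[OF gr sV] by blast
      then show "e \<in> (\<lambda>w. {w, s}) ` (?D \<inter> N s)" using e(2) by blast
    qed
    then have "card {e\<in>?H. s \<in> e} \<le> card (?D \<inter> N s)" by (rule surj_card_le[rotated]) simp
    ultimately show ?thesis by linarith
  qed
  moreover have "\<not> is_cycle ?D ?H xs" for xs
  proof
    assume c: "is_cycle ?D ?H xs"
    have cE: "is_cycle ?D E xs" by (rule is_cycle_subgraph[OF c]) auto
    have "set xs = ?D" using acyc[OF cE] c by (auto simp: is_cycle_def)
    then have "length xs = card ?D" using c distinct_card[of xs] by (simp add: is_cycle_def)
    moreover have "path_edges xs \<subseteq> E"
    proof -
      have "xs \<noteq> []" using c by (auto simp: is_cycle_def)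
      then have "path_edges xs \<subseteq> cycle_edges xs" using path_edges_snoc[of xs "hd xs"] by (auto simp: cycle_edges_def)
      then show ?thesis using cE by (auto simp: is_cycle_def)
    qed
    moreover have "distinct xs" "set xs \<subseteq> ?D" using c by (auto simp: is_cycle_def)
    ultimately show False using fans[of xs] large by simp
  qed
  ultimately obtain ps where ps: "distinct (concat ps)" "set (concat ps) = ?D" "[] \<notin> set ps" "forest_edges ps = ?H"
    using linear_forest_decomposition[OF grH] by blast
  show ?thesis
  proof (rule that[OF ps])
    fix p assume p: "p \<in> set ps"
    show "length p < 2 * (l - 1)"
    proof (rule fans)
      show "distinct p" using ps(1) p by (auto simp: distinct_concat_iff)
      show "set p \<subseteq> ?D" using ps(2) p by auto
      show "path_edges p \<subseteq> E" using ps(4) p by (auto simp: forest_edges_def)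
    qed
  qed
qed

text \<open>Beside a block of more than \<open>l - 2\<close> vertices, two further blocks have at
  most \<open>N' - 1\<close> vertices together, since otherwise they could be linked through
  \<open>v\<close>. So at most one further block exceeds half of this number. The \<open>k\<close>
  singletons stand for the vertices outside the common neighbourhood; all bounds are doubled to
  avoid halves.\<close>

lemma long_block_count:
  fixes k :: nat
  assumes uv: "u \<in> V" "v \<in> V" "u \<noteq> v" and l: "4 \<le> l" "N' = l - 2"
    and free: "\<not> contains_subgraph (V, E) (Cll l)"
    and ps: "distinct (concat ps)" "set (concat ps) = N u \<inter> N v" "[] \<notin> set ps"
      "forest_edges ps = {e\<in>E. e \<subseteq> N u \<inter> N v}" "\<And>p. p \<in> set ps \<Longrightarrow> length p < 2 * (l - 1)"
    and large: "2 * (2 * N' + 1) < card (N u \<inter> N v)"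
    and p0: "p0 \<in> set ps" "N' < length p0"
  defines "ks \<equiv> map length ps @ replicate k 1"
  shows "2 \<le> length ks" "2 * sum_list ks \<le> 2 * (2 * N' + 1) + 2 * (N' - 2) + (length ks - 2) * (N' - 1)"
proof -
  let ?D = "N u \<inter> N v"
  have dps: "distinct ps" by (rule distinct_concat_distinct[OF ps(1,3)])
  have len: "length p \<le> 2 * N' + 1" if "p \<in> set ps" for p using ps(5)[OF that] l by simp
  have pos: "1 \<le> length p" if "p \<in> set ps" for p
  proof -
    have "p \<noteq> []" using that ps(3) by blast
    then show ?thesis by (simp add: Suc_leI)
  qed
  have sums: "sum_list (map length ps) = (\<Sum>p\<in>set ps. length p)"
    by (rule sum_list_distinct_conv_sum_set[OF dps])
  have "card ?D = length (concat ps)" using distinct_card[OF ps(1)] unfolding ps(2) .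
  also have "\<dots> = (\<Sum>p\<in>set ps. length p)" by (simp add: length_concat sums)
  also have "\<dots> \<le> (\<Sum>p\<in>set ps. 2 * N' + 1)" by (rule sum_mono) (rule len)
  also have "\<dots> = card (set ps) * (2 * N' + 1)" by simp
  finally have "2 * (2 * N' + 1) < card (set ps) * (2 * N' + 1)" using large by linarith
  \<comment> \<open>Two blocks hold at most \<open>2 * (2 * N' + 1)\<close> vertices, so there must
    be a third.\<close>
  then have "2 < card (set ps)" by (simp only: mult_less_cancel2)
  then have c3: "3 \<le> card (set ps)" by simp
  define Q where "Q = set ps - {p0}"
  have cQ: "card Q + 1 = card (set ps)" "finite Q" using p0 c3 by (auto simp: Q_def)
  have pair: "length q1 + length q2 \<le> N' - 1" if q: "q1 \<in> Q" "q2 \<in> Q" "q1 \<noteq> q2" for q1 q2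
  proof (rule ccontr)
    assume "\<not> length q1 + length q2 \<le> N' - 1"
    then have long: "l - 2 \<le> length q1 + length q2" using l by simp
    have in_ps: "q1 \<in> set ps" "q2 \<in> set ps" "p0 \<noteq> q1" "p0 \<noteq> q2" using q by (auto simp: Q_def)
    have disj: "set a \<inter> set b = {}" if "a \<in> set ps" "b \<in> set ps" "a \<noteq> b" for a b
      using same_path[OF ps(1) that(1,2)] that(3) by blast
    have "distinct p0" "distinct q1" "distinct q2" using ps(1) in_ps p0 by (auto simp: distinct_concat_iff)
    then have "distinct (p0 @ q1 @ q2)" using disj in_ps p0(1) q(3) by auto
    moreover have "set (p0 @ q1 @ q2) \<subseteq> ?D" using ps(2) in_ps p0(1) by auto
    moreover have "path_edges p0 \<subseteq> E" "path_edges q1 \<subseteq> E" "path_edges q2 \<subseteq> E"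
      using ps(4) in_ps p0(1) by (auto simp: forest_edges_def)
    moreover have "l - 1 \<le> length p0" using p0(2) l by simp
    moreover have "1 \<le> length q1" "1 \<le> length q2" using pos in_ps by auto
    ultimately have "contains_subgraph (V, E) (Cll l)"
      using fan_and_link_Cll[OF gr l(1) uv] long by blast
    then show False using free by blast
  qed
  have "Q \<noteq> {}" using cQ c3 by auto
  then have "Max (length ` Q) \<in> length ` Q" using cQ(2) by simp
  \<comment> \<open>The largest block besides \<open>p0\<close> is the only one that may exceed half
    of \<open>N' - 1\<close>.\<close>
  then obtain q1 where q1: "q1 \<in> Q" "length q1 = Max (length ` Q)" by auto
  have q1max: "length q \<le> length q1" if "q \<in> Q" for q unfolding q1(2) using that cQ(2) by simp
  have "card (Q - {q1}) + 1 = card Q" using q1(1) cQ(2) by (simp add: card_Diff_singleton card_gt_0_iff Suc_leI \<open>Q \<noteq> {}\<close>)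
  then have "1 \<le> card (Q - {q1})" using cQ(1) c3 by linarith
  then obtain q2 where q2: "q2 \<in> Q" "q2 \<noteq> q1" by (metis Diff_iff card.empty ex_in_conv insertI1 not_one_le_zero)
  have "q2 \<in> set ps" "q1 \<in> set ps" using q1(1) q2(1) by (auto simp: Q_def)
  then have l2: "1 \<le> length q2" "1 \<le> length q1" by (auto intro: pos simp del: One_nat_def)
  have "length q1 + length q2 \<le> N' - 1" by (rule pair) (use q1 q2 in auto)
  \<comment> \<open>The inequality \<open>2 \<le> N' - 1\<close> lets the added singletons obey the
    same bound as the small blocks.\<close>
  then have q1le: "length q1 \<le> N' - 2" and N3: "2 \<le> N' - 1" using l2 by linarith+
  have half: "2 * length q \<le> N' - 1" if "q \<in> Q - {q1}" for q
    using pair[of q q1] q1max[of q] that q1(1) by fastforce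
  have "(\<Sum>p\<in>set ps. length p) = length p0 + (\<Sum>p\<in>Q. length p)"
    unfolding Q_def using p0(1) by (simp add: sum.remove)
  also have "(\<Sum>p\<in>Q. length p) = length q1 + (\<Sum>p\<in>Q - {q1}. length p)"
    using q1(1) cQ(2) by (simp add: sum.remove)
  finally have tot: "(\<Sum>p\<in>set ps. length p) = length p0 + length q1 + (\<Sum>p\<in>Q - {q1}. length p)" by simp
  have "2 * (\<Sum>p\<in>Q - {q1}. length p) = (\<Sum>p\<in>Q - {q1}. 2 * length p)" by (simp add: sum_distrib_left)
  also have "\<dots> \<le> (\<Sum>p\<in>Q - {q1}. N' - 1)" by (rule sum_mono) (rule half)
  also have "\<dots> = card (Q - {q1}) * (N' - 1)" by simp
  finally have rest: "2 * (\<Sum>p\<in>Q - {q1}. length p) \<le> card (Q - {q1}) * (N' - 1)" .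
  have lks: "length ks = card (Q - {q1}) + 2 + k"
    unfolding ks_def using distinct_card[OF dps] cQ(1) \<open>card (Q - {q1}) + 1 = card Q\<close> by simp
  then show "2 \<le> length ks" by simp
  have sk: "sum_list ks = (\<Sum>p\<in>set ps. length p) + k" by (simp add: ks_def sums sum_list_replicate)
  have k2: "2 * k \<le> k * (N' - 1)" using mult_le_mono2[OF N3, of k] by (simp add: mult.commute)
  have "2 * sum_list ks = (2 * length p0 + 2 * length q1) + (2 * (\<Sum>p\<in>Q - {q1}. length p) + 2 * k)"
    unfolding sk tot by (simp add: distrib_left)
  also have "\<dots> \<le> (2 * (2 * N' + 1) + 2 * (N' - 2)) + (card (Q - {q1}) * (N' - 1) + k * (N' - 1))"
    by (intro add_mono mult_le_mono2 len[OF p0(1)] q1le rest k2)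
  also have "card (Q - {q1}) * (N' - 1) + k * (N' - 1) = (length ks - 2) * (N' - 1)"
    unfolding lks by (simp add: add_mult_distrib)
  finally show "2 * sum_list ks \<le> 2 * (2 * N' + 1) + 2 * (N' - 2) + (length ks - 2) * (N' - 1)" .
qed

end

lemma normalized_perron:
  assumes fin: "finite V" "V \<noteq> {}"
  obtains x z where "\<And>s. s \<in> V \<Longrightarrow> 0 \<le> x s" "\<And>s. s \<in> V \<Longrightarrow> x s \<le> 1" "z \<in> V" "x z = (1::real)"
    "\<And>s. s \<in> V \<Longrightarrow> (\<Sum>u\<in>nbrs V E s. x u) = spectral_radius (V, E) * x s"
proof -
  obtain y where y: "\<And>v. v \<in> V \<Longrightarrow> 0 \<le> y v" "\<exists>v\<in>V. 0 < y v"
    "\<And>v. v \<in> V \<Longrightarrow> (\<Sum>u\<in>nbrs V E v. y u) = spectral_radius (V, E) * y v"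
    using spectral_radius_perron(2)[OF fin, of E] by blast
  define m where "m = Max (y ` V)"
  have "m \<in> y ` V" unfolding m_def using fin by (intro Max_in) auto
  then obtain z where z: "z \<in> V" "y z = m" by auto
  have le: "y s \<le> m" if "s \<in> V" for s unfolding m_def using fin(1) that by simp
  have m: "0 < m" using y(2) le by (meson less_le_trans)
  show ?thesis
  proof (rule that[of "\<lambda>s. y s / m" z])
    show "(\<Sum>u\<in>nbrs V E s. y u / m) = spectral_radius (V, E) * (y s / m)" if "s \<in> V" for s
      using y(3)[OF that] by (simp add: sum_divide_distrib[symmetric])
  qed (use y z le m in auto)
qed

lemma block_size_small:
  assumes "4 \<le> l" "n \<ge> 9 * 2 ^ (l - 1) + 3"
  shows "20 * (l - 2) \<le> n - 2"
proof -
  define k where "k = l - 3"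
  have k: "l = k + 3" using assms(1) by (simp add: k_def)
  have "k < 2 ^ k" by (rule less_exp)
  then have "k + 1 \<le> 2 ^ k" by linarith
  moreover have "(2::nat) ^ (l - 1) = 4 * 2 ^ k" using k by (simp add: power_add)
  ultimately show ?thesis using assms(2) k by simp
qed

theorem theorem2:
  fixes G :: "'a graph" and l n :: nat
  assumes "l \<ge> 4"
    and "real n \<ge> 2.16 * 10 ^ 17"
    and "n \<ge> 9 * 2 ^ (l - 1) + 3"
    and "real n \<ge> 625 / 32 * (real ((l - 3) div 2))\<^sup>2 + 4"
    and "simple_graph G" and "card (fst G) = n"
    and "planar G"
    and "\<not> contains_subgraph G (Cll l)"
  shows "spectral_radius G \<le> spectral_radius (graph_join K2 (Hgraph n (l - 2) (l - 2)))
    \<and> (spectral_radius G = spectral_radius (graph_join K2 (Hgraph n (l - 2) (l - 2)))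
         \<longleftrightarrow> graph_iso G (graph_join K2 (Hgraph n (l - 2) (l - 2))))"
proof -
  define V where "V = fst G"
  define E where "E = snd G"
  define N where "N = l - 2"
  define F where "F = graph_join K2 (Hgraph n N N)"
  have G: "G = (V, E)" by (simp add: V_def E_def)
  have N: "2 \<le> N" "0 < N" using assms(1) by (auto simp: N_def)
  obtain p \<gamma> where dr: "drawing V E p \<gamma>"
    using planar_drawing[OF assms(5,7)] unfolding V_def E_def by blast
  interpret plane_like V E by (rule drawing_plane_like[OF dr])
  have cV: "card V = n" using assms(6) by (simp add: V_def)
  have n: "real n \<ge> 2.16 * 10 ^ 17" by fact
  have ne: "V \<noteq> {}" using cV n by auto
  have nN: "20 * N \<le> n - 2" unfolding N_def by (rule block_size_small[OF assms(1,3)])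
  have free: "\<not> contains_subgraph (V, E) (Cll l)" using assms(8) by (simp add: G)
  have "2 < real n" using n by simp
  then have n2: "2 < n" by simp
  \<comment> \<open>Any listing of the vertices presents the extremal graph as a forest cone, the
    form in which spectral radii can be compared.\<close>
  have packed: "\<exists>qs. concat qs = ws \<and> map length qs = packed_lengths N (n - 2)
      \<and> graph_iso (cone_vertices u v qs, forest_cone u v qs) F"
    if "distinct (u # v # ws)" "length ws = n - 2" for u v and ws :: "'a list"
  proof -
    obtain qs where qs: "concat qs = ws" "map length qs = packed_lengths N (length ws)"
      using chunks_exist[OF N(2)] by blast
    have "graph_iso (cone_vertices u v qs, forest_cone u v qs) F"
      unfolding F_def by (rule packed_cone_iso[OF N(2)]) (use that qs in auto)
    then show ?thesis using qs that by metis
  qed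
  have FV: "2 * real (n - 2) \<le> (spectral_radius F)\<^sup>2" "0 \<le> spectral_radius F"
  proof -
    obtain xs where xs: "set xs = V" "distinct xs" using finite_distinct_list[OF finV] by blast
    then have lx: "length xs = n" using distinct_card cV by metis
    then obtain u v ws where ws: "xs = u # v # ws" using n2 by (cases xs; cases "tl xs") auto
    then obtain qs where qs: "concat qs = ws" "graph_iso (cone_vertices u v qs, forest_cone u v qs) F"
      using packed[of u v ws] xs(2) lx by auto
    have "distinct (u # v # concat qs)" "length (concat qs) = n - 2" "0 < n - 2" using qs xs lx ws n2 by auto
    from cone_lower_bound[OF this] show "2 * real (n - 2) \<le> (spectral_radius F)\<^sup>2" "0 \<le> spectral_radius F"
      unfolding graph_iso_spectral_radius[OF qs(2)] by auto
  qed
  \<comment> \<open>Only a spectral radius at least that of \<open>F\<close> needs work: it is shown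
    to force equality and isomorphism, and both claims follow.\<close>
  have main: "spectral_radius (V, E) = spectral_radius F \<and> graph_iso (V, E) F"
    if ge: "spectral_radius F \<le> spectral_radius (V, E)"
  proof -
    define r where "r = spectral_radius (V, E)"
    have r2: "2 * real n - 4 \<le> r\<^sup>2"
    proof -
      have "(spectral_radius F)\<^sup>2 \<le> r\<^sup>2" unfolding r_def using ge FV(2) by (rule power_mono)
      then show ?thesis using FV(1) n2 by (simp add: of_nat_diff)
    qed
    have r0: "0 \<le> r" using ge FV(2) by (simp add: r_def)
    have r200: "200 \<le> r"
    proof (rule power2_le_imp_le[OF _ r0])
      show "200\<^sup>2 \<le> r\<^sup>2" using r2 n by simp
    qed
    obtain x u where x: "\<And>s. s \<in> V \<Longrightarrow> 0 \<le> x s" "\<And>s. s \<in> V \<Longrightarrow> x s \<le> 1" "u \<in> V" "x u = 1"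
      "\<And>s. s \<in> V \<Longrightarrow> (\<Sum>w\<in>nbrs V E s. x w) = r * x s"
      using normalized_perron[OF finV ne, of E] unfolding r_def by blast
    interpret P: plane_like_perron V E x r n
      by unfold_locales (use x cV n r2 r200 in auto)
    obtain v where v: "v \<in> V" "v \<noteq> u" "x v \<ge> 0.96" "real (card (nbrs V E u \<inter> nbrs V E v)) \<ge> 0.92 * real n"
      "\<And>s. s \<in> V \<Longrightarrow> s \<noteq> u \<Longrightarrow> s \<noteq> v \<Longrightarrow> x s \<le> 0.09"
      using P.two_dominating[OF x(3,4)] by blast
    define D where "D = nbrs V E u \<inter> nbrs V E v"
    define R where "R = V - {u, v} - D"
    define E' where "E' = cone_edges u v (V - {u, v}) {e\<in>E. e \<subseteq> D}"
    have cmp: "spectral_radius (V, E) \<le> spectral_radius (V, E')"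
      "spectral_radius (V, E) = spectral_radius (V, E') \<Longrightarrow> E = E'"
    proof -
      have "u \<noteq> v" "24/25 \<le> x u" "24/25 \<le> x v" using v(2,3) x(4) by auto
      moreover have "x s \<le> 9/100" if "s \<in> V" "s \<noteq> u" "s \<noteq> v" for s using v(5)[OF that] by simp
      ultimately have *: "u \<noteq> v" "24/25 \<le> x u" "24/25 \<le> x v" "\<And>s. s \<in> V \<Longrightarrow> s \<noteq> u \<Longrightarrow> s \<noteq> v \<Longrightarrow> x s \<le> 9/100"
        by blast+
      show "spectral_radius (V, E) \<le> spectral_radius (V, E')"
        "spectral_radius (V, E) = spectral_radius (V, E') \<Longrightarrow> E = E'"
        unfolding E'_def D_def
        using cone_comparison[OF x(3) v(1) *(1) x(1) *(2-4) x(5)[unfolded r_def]] by blast+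
    qed
    have uv: "u \<noteq> v" using v(2) by simp
    have DW: "D \<subseteq> V - {u, v}" using nbrs_def[of V E] noloop by (auto simp: D_def nbrs_def)
    have Dl: "2 * (2 * N + 1) < card D"
    proof -
      have "real (20 * N) \<le> real n" using nN by linarith
      then show ?thesis using v(4) n unfolding D_def by simp
    qed
    have l1: "2 * (l - 1) \<le> card D" using Dl assms(1) by (simp add: N_def)
    have acyc: "w \<in> set xs" if "is_cycle D E xs" "w \<in> D" for xs w
      using plane_common_nbrs_acyclic[OF dr x(3) v(1) uv] that unfolding D_def by blast
    obtain ps where ps: "distinct (concat ps)" "set (concat ps) = D" "[] \<notin> set ps"
      "forest_edges ps = {e\<in>E. e \<subseteq> D}" "\<And>p. p \<in> set ps \<Longrightarrow> length p < 2 * (l - 1)"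
      using dominated_forest[OF x(3) v(1) uv assms(1) acyc[unfolded D_def] free l1[unfolded D_def]]
      unfolding D_def by blast
    \<comment> \<open>Vertices outside the common neighbourhood have lost all edges except those to
      \<open>u\<close> and \<open>v\<close>; in the cone they are blocks of order one.\<close>
    obtain rs where rs: "set rs = R" "distinct rs" using finite_distinct_list[of R] finV by (auto simp: R_def)
    define ps' where "ps' = ps @ map (\<lambda>s. [s]) rs"
    have cps': "concat ps' = concat ps @ rs" by (simp add: ps'_def)
    have setps': "set (concat ps') = V - {u, v}" unfolding cps' set_append ps(2) rs(1) R_def using DW by blast
    have fps': "forest_edges ps' = {e\<in>E. e \<subseteq> D}" using ps(4) by (auto simp: ps'_def forest_edges_def)
    have "D \<inter> R = {}" by (auto simp: R_def)
    then have "distinct (concat ps')" unfolding cps' using ps(1,2) rs by auto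
    then have d: "distinct (u # v # concat ps')" using uv setps' by auto
    have VE': "(cone_vertices u v ps', forest_cone u v ps') = (V, E')"
      unfolding cone_vertices_def forest_cone_def setps' fps' E'_def using x(3) v(1) by auto
    have S: "length (concat ps') = n - 2"
    proof -
      have "length (concat ps') = card (V - {u, v})" using distinct_card[OF \<open>distinct (concat ps')\<close>] setps' by simp
      also have "\<dots> = n - 2" using x(3) v(1) uv cV finV by (simp add: card_Diff_subset)
      finally show ?thesis .
    qed
    define ks where "ks = map length ps'"
    have sumks: "sum_list ks = n - 2" using S by (simp add: ks_def length_concat)
    have ks_eq: "ks = map length ps @ replicate (length rs) 1"
      by (simp add: ks_def ps'_def o_def map_replicate_const)
    have ks1: "\<forall>k\<in>set ks. 1 \<le> k" using ps(3) unfolding ks_eq by (auto simp: Suc_le_eq)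
    \<comment> \<open>The parameter \<open>t\<close> is taken from the modified graph rather than
      from \<open>G\<close>, because that graph is the cone whose forest weight is to be compared
      with the packed one.\<close>
    have "200 \<le> spectral_radius (V, E')" using r200 cmp(1) unfolding r_def by linarith
    then obtain t where t: "0 < t" "t \<le> 1/100" "t + 1 / t = spectral_radius (V, E')"
      using solve_reciprocal_sum by blast
    have t1: "t < 1" using t by simp
    interpret C: strictly_convex_seq "path_weight t" by (rule path_weight_convex_seq[OF t(1) t1])
    have fw: "forest_weight t ps' = sum_list (map (path_weight t) ks)" by (simp add: forest_weight_def ks_def)
    obtain qs where qs: "concat qs = concat ps'" "map length qs = packed_lengths N (n - 2)"
      "graph_iso (cone_vertices u v qs, forest_cone u v qs) F"
      using packed[OF d S] by blast
    have dq: "distinct (u # v # concat qs)" unfolding qs(1) by (rule d)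
    have fq: "forest_weight t qs = C.packed N (n - 2)" by (rule forest_weight_packed[OF t(1) t1 qs(2)])
    have rho: "spectral_radius (cone_vertices u v ps', forest_cone u v ps') = t + 1 / t" unfolding VE' t(3) ..
    \<comment> \<open>A block longer than \<open>N\<close> makes the inequality strict, so equality
      leaves only admissible orders, to which the packing argument applies.\<close>
    have le: "forest_weight t ps' \<le> C.packed N (n - 2)
      \<and> (forest_weight t ps' = C.packed N (n - 2) \<longrightarrow> (\<forall>k\<in>set ks. k \<le> N))"
    proof (cases "\<forall>k\<in>set ks. k \<le> N")
      case True
      then show ?thesis using C.sum_list_le_packed[OF N(2) True] unfolding fw sumks by simp
    next
      case False
      then obtain p0 where p0: "p0 \<in> set ps" "N < length p0" unfolding ks_eq using N by auto
      have "sum_list (map (path_weight t) ks) < C.packed N (sum_list ks)"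
      proof (rule many_blocks_weight[OF t(1,2) N(1) ks1])
        note c = long_block_count[OF x(3) v(1) uv assms(1) N_def free ps(1) ps(2-4)[unfolded D_def] ps(5)
            Dl[unfolded D_def] p0, of "length rs"]
        show "2 \<le> length ks" "2 * sum_list ks \<le> 2 * (2 * N + 1) + 2 * (N - 2) + (length ks - 2) * (N - 1)"
          unfolding ks_eq using c by blast+
        show "20 * N \<le> sum_list ks" using nN sumks by simp
      qed
      then show ?thesis unfolding fw sumks by simp
    qed
    have up: "spectral_radius (V, E') \<le> spectral_radius F"
      using cone_spectral_compare(1)[OF d dq t(1) t1 rho] le
      unfolding fq graph_iso_spectral_radius[OF qs(3)] VE' by simp
    have eqs: "spectral_radius (V, E) = spectral_radius F" "spectral_radius (V, E) = spectral_radius (V, E')"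
      "spectral_radius (V, E') = spectral_radius F" using up cmp(1) ge by linarith+
    have EE': "E = E'" by (rule cmp(2)[OF eqs(2)])
    have "forest_weight t ps' = C.packed N (n - 2)"
    proof (rule ccontr)
      assume "forest_weight t ps' \<noteq> C.packed N (n - 2)"
      then have "spectral_radius (V, E') < spectral_radius F"
        using cone_spectral_compare(2)[OF d dq t(1) t1 rho] le
        unfolding fq graph_iso_spectral_radius[OF qs(3)] VE' by simp
      then show False using eqs(3) by simp
    qed
    then have "mset ks = mset (packed_lengths N (n - 2))"
      using C.sum_list_eq_packed[OF N(2), of ks] le ks1 unfolding fw sumks
      by (simp add: packed_lengths_def Suc_le_eq)
    then obtain os where os: "mset os = mset ps'" "map length os = packed_lengths N (n - 2)"
      using reorder_packed[of ps' N "n - 2"] N(2) unfolding ks_def by blast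
    note fm = forest_mset_cong[OF os(1)]
    have dos: "distinct (u # v # concat os)" using d fm(2,3) by simp
    have "graph_iso (cone_vertices u v os, forest_cone u v os) F"
      unfolding F_def by (rule packed_cone_iso[OF N(2) dos os(2)]) (simp add: fm(4) S)
    moreover have "(cone_vertices u v os, forest_cone u v os) = (V, E)"
      unfolding EE' VE'[symmetric] cone_vertices_def forest_cone_def fm(1,2) ..
    ultimately show ?thesis using eqs(1) by simp
  qed
  have iso: "graph_iso (V, E) F \<Longrightarrow> spectral_radius (V, E) = spectral_radius F"
    by (rule graph_iso_spectral_radius)
  have "spectral_radius (V, E) \<le> spectral_radius F \<and> (spectral_radius (V, E) = spectral_radius F \<longleftrightarrow> graph_iso (V, E) F)"
  proof (cases "spectral_radius F \<le> spectral_radius (V, E)")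
    case True
    then show ?thesis using main[OF True] by simp
  next
    case False
    then show ?thesis using iso by auto
  qed
  then show ?thesis unfolding F_def N_def G .
qed

end
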